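(* If $L$ and $L'$ are concordant virtual links, then $\mathrm{Zh}(L)$ and $\mathrm{Zh}(L')$ are concordant as semi-welded links.
   Context: A virtual link diagram is an immersion of oriented circles in the plane whose double points are each either classical (with over/under information) or virtual. The generalized Reidemeister moves are planar isotopy, the classical Reidemeister moves, and the detour move (an arc passing only through virtual crossings may be replaced by any other arc with the same endpoints, with all its double points virtual). A virtual link is an equivalence class of diagrams under these moves. Up to detour moves, a diagram is the same as its Gauss diagram: oriented circles with one signed arrow per classical crossing, pointing from the overcrossing point (foot) to the undercrossing point (head). The forbidden overpass move moves an overcrossing arc across a virtual crossing; on Gauss diagrams it exchanges two adjacent arrow feet. Zh-construction: $\mathrm{Zh}(L)=L\cup\omega$ is obtained from a diagram of $L$ by adding one new component $\omega$, having exactly two classical crossings for each classical crossing of the diagram, at both of which $\omega$ is the overcrossing strand. On Gauss diagrams: for each arrow of sign $\varepsilon$, add two arrows with feet on $\omega$, one with head just before the foot of the given arrow with sign $-\varepsilon$, and one with head just after the head of the given arrow with sign $\varepsilon$. (Equivalently, the heads may be placed just after the foot and just before the head, with the same signs.) The order of the arrow feet along $\omega$ is arbitrary. It is considered up to semi-welded equivalence: generalized Reidemeister moves anywhere, and forbidden overpass moves only when the overcrossing arc belongs to the $\omega$-component. This class depends only on the virtual link $L$. Concordance: a birth (death) is the addition (removal) of a trivial unknotted unlinked component; a saddle cuts and rejoins two arcs respecting orientations. Virtual links $L=K_1\cup\cdots\cup K_\mu$ and $L'=K'_1\cup\cdots\cup K'_\mu$ are concordant if there is a finite sequence of generalized Reidemeister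 moves and $b_i$ births, $d_i$ deaths and $s_i$ saddles, with $b_i+d_i=s_i$, taking $K_i$ to $K_i'$ for each $i$ (the $i$-th traced surface being a connected cobordism from $K_i$ to $K_i'$, hence an annulus). Semi-welded links are concordant if the same holds with generalized Reidemeister moves replaced by the moves of semi-welded equivalence, the $\omega$-component being taken to the $\omega$-component. *)

theory Defs
  imports "HOL-Combinatorics.Transposition"
begin

section \<open>Gauss diagrams\<close>

text \<open>
  Virtual link diagrams are represented by their Gauss diagrams. Virtual crossings leave no trace in
  a Gauss diagram, so planar isotopy and the detour move become equalities.

  An arrow is a name together with a sign (\<open>True\<close> is positive). Its foot is the overcrossing point,
  its head the undercrossing point.
\<close>

type_synonym arrow = "nat \<times> bool"

datatype endpoint = Foot arrow | Head arrow

text \<open>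
  \<open>Comp i\<close> is the \<open>i\<close>-th component of the link (counting from 0) and \<open>Omega\<close> is the distinguished
  component of a semi-welded link. In the middle of a cobordism one component may consist of several
  circles, so a circle is a component label together with a number.
\<close>

datatype component = Comp nat | Omega

type_synonym circle = "component \<times> nat"

text \<open>
  The circles of a diagram form its domain. The word of a circle lists its arrow endpoints along the
  orientation, starting from an arbitrary base point; moving the base point is one of the moves below.
\<close>

type_synonym diagram = "circle \<Rightarrow> endpoint list option"

definition endpoints :: "diagram \<Rightarrow> endpoint set" where
  "endpoints D = (\<Union>w\<in>ran D. set w)"

definition arrows :: "diagram \<Rightarrow> arrow set" where
  "arrows D = {a. Foot a \<in> endpoints D \<or> Head a \<in> endpoints D}"

definition wf_diagram :: "diagram \<Rightarrow> bool" where
  "wf_diagram D \<longleftrightarrow>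
     finite (dom D) \<and>
     (\<forall>c w. D c = Some w \<longrightarrow> distinct w) \<and>
     (\<forall>c c' w w'. c \<noteq> c' \<longrightarrow> D c = Some w \<longrightarrow> D c' = Some w' \<longrightarrow> set w \<inter> set w' = {}) \<and>
     (\<forall>a. Foot a \<in> endpoints D \<longleftrightarrow> Head a \<in> endpoints D)"

text \<open>A link diagram has exactly one circle for each component of the link.\<close>

definition virtual_diagram :: "nat \<Rightarrow> diagram \<Rightarrow> bool" where
  "virtual_diagram \<mu> D \<longleftrightarrow> wf_diagram D \<and> dom D = {(Comp i, 0) | i. i < \<mu>}"

definition semi_welded_diagram :: "nat \<Rightarrow> diagram \<Rightarrow> bool" where
  "semi_welded_diagram \<mu> D \<longleftrightarrow>
     wf_diagram D \<and> dom D = insert (Omega, 0) {(Comp i, 0) | i. i < \<mu>}"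


section \<open>Moves\<close>

definition map_endpoints :: "(endpoint \<Rightarrow> endpoint) \<Rightarrow> diagram \<Rightarrow> diagram" where
  "map_endpoints f D = (\<lambda>c. map_option (map f) (D c))"

fun rename_arrow :: "(arrow \<Rightarrow> arrow) \<Rightarrow> endpoint \<Rightarrow> endpoint" where
  "rename_arrow f (Foot a) = Foot (f a)"
| "rename_arrow f (Head a) = Head (f a)"

definition delete_arrows :: "arrow set \<Rightarrow> diagram \<Rightarrow> diagram" where
  "delete_arrows A D =
     (\<lambda>c. map_option (filter (\<lambda>x. x \<notin> Foot ` A \<and> x \<notin> Head ` A)) (D c))"

text \<open>On the circle \<open>c\<close>, \<open>y\<close> comes directly after \<open>x\<close> in the cyclic order.\<close>

definition adjacent_on :: "diagram \<Rightarrow> circle \<Rightarrow> endpoint \<Rightarrow> endpoint \<Rightarrow> bool" where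
  "adjacent_on D c x y \<longleftrightarrow> (\<exists>w n u. D c = Some w \<and> rotate n w = x # y # u)"

definition adjacent :: "diagram \<Rightarrow> endpoint \<Rightarrow> endpoint \<Rightarrow> bool" where
  "adjacent D x y \<longleftrightarrow> (\<exists>c. adjacent_on D c x y)"

definition adjacent_in_order :: "bool \<Rightarrow> diagram \<Rightarrow> endpoint \<Rightarrow> endpoint \<Rightarrow> bool" where
  "adjacent_in_order p D x y \<longleftrightarrow> (if p then adjacent D x y else adjacent D y x)"

text \<open>
  Every endpoint occurs only once in a diagram, so applying a transposition to all words exchanges
  the positions of two endpoints.
\<close>

definition exchange :: "endpoint \<Rightarrow> endpoint \<Rightarrow> diagram \<Rightarrow> diagram" where
  "exchange x y = map_endpoints (Transposition.transpose x y)"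

text \<open>
  The classical Reidemeister moves in all their oriented versions, together with the choice of base
  points and arrow names. The moves are directed here; they are used through their symmetric closure.

  In \<open>R3\<close> the arrows \<open>a\<close>, \<open>b\<close>, \<open>c\<close> go from the top to the middle, from the top to the bottom and from
  the middle to the bottom strand; \<open>p\<close>, \<open>q\<close>, \<open>r\<close> record the order of the crossings along the top, middle
  and bottom strand. To see which combinations of signs and orders occur, let the strands be oriented
  lines with directions \<open>v1\<close>, \<open>v2\<close>, \<open>v3\<close> (top, middle, bottom). A crossing of \<open>vi\<close> over \<open>vj\<close> has sign
  \<open>det (vi, vj)\<close>, and up to a common sign, depending on which side of the triple point the third line
  passes, the orders \<open>p\<close>, \<open>q\<close>, \<open>r\<close> are the signs \<open>sgn b\<close>, \<open>sgn c\<close> and \<open>sgn a * sgn b * sgn c\<close>. All eight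
  combinations of signs arise from lines, which gives the two conditions below. Equivalently: they
  hold for the positive braid relation (equal signs, equal orders), for its mirror image, and
  for what is obtained from these by reversing strands.
\<close>

inductive reidemeister :: "diagram \<Rightarrow> diagram \<Rightarrow> bool" where
  base_point:
    "wf_diagram D \<Longrightarrow> D c = Some (u @ v) \<Longrightarrow> reidemeister D (D(c \<mapsto> v @ u))"
| rename:
    "wf_diagram D \<Longrightarrow> inj_on f (arrows D) \<Longrightarrow> (\<And>a. snd (f a) = snd a) \<Longrightarrow>
     reidemeister D (map_endpoints (rename_arrow f) D)"
| R1:
    "wf_diagram D \<Longrightarrow> adjacent D (Foot a) (Head a) \<or> adjacent D (Head a) (Foot a) \<Longrightarrow>
     reidemeister D (delete_arrows {a} D)"
| R2:
    "wf_diagram D \<Longrightarrow> snd a \<noteq> snd b \<Longrightarrow> adjacent D (Foot a) (Foot b) \<Longrightarrow>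
     adjacent D (Head a) (Head b) \<or> adjacent D (Head b) (Head a) \<Longrightarrow>
     reidemeister D (delete_arrows {a, b} D)"
| R3:
    "wf_diagram D \<Longrightarrow> distinct [a, b, c] \<Longrightarrow>
     adjacent_in_order p D (Foot a) (Foot b) \<Longrightarrow>
     adjacent_in_order q D (Head a) (Foot c) \<Longrightarrow>
     adjacent_in_order r D (Head b) (Head c) \<Longrightarrow>
     p = q \<longleftrightarrow> snd b = snd c \<Longrightarrow>
     p = r \<longleftrightarrow> snd a = snd c \<Longrightarrow>
     reidemeister D
       (exchange (Foot a) (Foot b) (exchange (Head a) (Foot c) (exchange (Head b) (Head c) D)))"

inductive semi_welded_move :: "diagram \<Rightarrow> diagram \<Rightarrow> bool" where
  reidemeister:
    "reidemeister D D' \<Longrightarrow> semi_welded_move D D'"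
| omega_overpass:
    "wf_diagram D \<Longrightarrow> adjacent_on D (Omega, k) (Foot a) (Foot b) \<Longrightarrow>
     semi_welded_move D (exchange (Foot a) (Foot b) D)"

definition virtual_links :: "nat \<Rightarrow> diagram set set" where
  "virtual_links \<mu> = {D. virtual_diagram \<mu> D} // {(D, D'). equivclp reidemeister D D'}"


section \<open>The Zh-construction\<close>

text \<open>
  The arrow \<open>(n, e)\<close> is renamed to \<open>(3 * n, e)\<close>. The new arrows belonging to it are \<open>(3 * n + 1, \<not> e)\<close>,
  with head just before its foot, and \<open>(3 * n + 2, e)\<close>, with head just after its head.
\<close>

fun zh_endpoint :: "endpoint \<Rightarrow> endpoint list" where
  "zh_endpoint (Foot (n, e)) = [Head (3 * n + 1, \<not> e), Foot (3 * n, e)]"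
| "zh_endpoint (Head (n, e)) = [Head (3 * n, e), Head (3 * n + 2, e)]"

definition zh_word :: "endpoint list \<Rightarrow> endpoint list" where
  "zh_word w = concat (map zh_endpoint w)"

definition omega_feet :: "diagram \<Rightarrow> endpoint set" where
  "omega_feet D = (\<Union>(n, e)\<in>arrows D. {Foot (3 * n + 1, \<not> e), Foot (3 * n + 2, e)})"

text \<open>The order of the feet along the new component is arbitrary, hence a relation.\<close>

definition zh_diagram :: "diagram \<Rightarrow> diagram \<Rightarrow> bool" where
  "zh_diagram D Z \<longleftrightarrow>
     (\<exists>ws. distinct ws \<and> set ws = omega_feet D \<and>
           Z = (\<lambda>c. map_option zh_word (D c))((Omega, 0) \<mapsto> ws))"

definition Zh :: "diagram set \<Rightarrow> diagram set" where
  "Zh L = {Z. \<exists>D\<in>L. \<exists>Z0. zh_diagram D Z0 \<and> equivclp semi_welded_move Z0 Z}"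


section \<open>Concordance\<close>

text \<open>
  The stages of a cobordism. A saddle either merges two circles of the same component or splits a
  circle. Since base points may be moved, merging and splitting words at their ends covers saddles
  between arbitrary arcs. \<open>Rename\<close> only changes the number of a circle.
\<close>

datatype event =
    Move
  | Birth circle
  | Death circle
  | Merge circle circle
  | Split circle circle
  | Rename circle circle

inductive cobordism_step ::
  "(diagram \<Rightarrow> diagram \<Rightarrow> bool) \<Rightarrow> diagram \<Rightarrow> event \<Rightarrow> diagram \<Rightarrow> bool" for R where
  "symclp R D D' \<Longrightarrow> cobordism_step R D Move D'"
| "D c = None \<Longrightarrow> cobordism_step R D (Birth c) (D(c \<mapsto> []))"
| "D c = Some [] \<Longrightarrow> cobordism_step R D (Death c) (D(c := None))"
| "c \<noteq> c' \<Longrightarrow> fst c = fst c' \<Longrightarrow> D c = Some u \<Longrightarrow> D c' = Some v \<Longrightarrow>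
   cobordism_step R D (Merge c c') (D(c \<mapsto> u @ v, c' := None))"
| "fst c = fst c' \<Longrightarrow> D c = Some (u @ v) \<Longrightarrow> D c' = None \<Longrightarrow>
   cobordism_step R D (Split c c') (D(c \<mapsto> u, c' \<mapsto> v))"
| "fst c = fst c' \<Longrightarrow> D c = Some u \<Longrightarrow> D c' = None \<Longrightarrow>
   cobordism_step R D (Rename c c') (D(c := None, c' \<mapsto> u))"

text \<open>
  The surface traced by a sequence of diagrams is recorded by a graph: its vertices are the circles
  at the various times, and an edge joins a circle with each circle of the next diagram into which it
  flows. Two circles lie on the same piece of the surface iff they are connected in this graph.
\<close>

fun flow :: "event \<Rightarrow> (circle \<times> circle) set" where
  "flow (Merge c c') = insert (c', c) Id"
| "flow (Split c c') = insert (c, c') Id"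
| "flow (Rename c c') = insert (c, c') Id"
| "flow Move = Id"
| "flow (Birth c) = Id"
| "flow (Death c) = Id"

definition trace_vertices :: "nat \<Rightarrow> (nat \<Rightarrow> diagram) \<Rightarrow> component \<Rightarrow> (nat \<times> circle) set" where
  "trace_vertices n Ds i = {(k, c). k \<le> n \<and> c \<in> dom (Ds k) \<and> fst c = i}"

definition trace_edges ::
  "nat \<Rightarrow> (nat \<Rightarrow> diagram) \<Rightarrow> (nat \<Rightarrow> event) \<Rightarrow> ((nat \<times> circle) \<times> (nat \<times> circle)) set" where
  "trace_edges n Ds ev =
     {((k, c), (Suc k, c')) | k c c'.
        k < n \<and> c \<in> dom (Ds k) \<and> c' \<in> dom (Ds (Suc k)) \<and> (c, c') \<in> flow (ev k)}"

definition connected_trace ::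
  "nat \<Rightarrow> (nat \<Rightarrow> diagram) \<Rightarrow> (nat \<Rightarrow> event) \<Rightarrow> component \<Rightarrow> bool" where
  "connected_trace n Ds ev i \<longleftrightarrow>
     (\<forall>x\<in>trace_vertices n Ds i. \<forall>y\<in>trace_vertices n Ds i.
        (x, y) \<in> (trace_edges n Ds ev \<union> (trace_edges n Ds ev)\<inverse>)\<^sup>*)"

definition births :: "nat \<Rightarrow> (nat \<Rightarrow> event) \<Rightarrow> component \<Rightarrow> nat" where
  "births n ev i = card {k. k < n \<and> (\<exists>m. ev k = Birth (i, m))}"

definition deaths :: "nat \<Rightarrow> (nat \<Rightarrow> event) \<Rightarrow> component \<Rightarrow> nat" where
  "deaths n ev i = card {k. k < n \<and> (\<exists>m. ev k = Death (i, m))}"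

definition saddles :: "nat \<Rightarrow> (nat \<Rightarrow> event) \<Rightarrow> component \<Rightarrow> nat" where
  "saddles n ev i =
     card {k. k < n \<and> (\<exists>m m'. ev k = Merge (i, m) (i, m') \<or> ev k = Split (i, m) (i, m'))}"

text \<open>
  Concordance of two link diagrams with the same components, relative to a set of moves \<open>R\<close>.
  The condition on \<open>fst ` dom (Ds k)\<close> excludes pieces of surface that belong to no component.
\<close>

definition concordant :: "(diagram \<Rightarrow> diagram \<Rightarrow> bool) \<Rightarrow> diagram \<Rightarrow> diagram \<Rightarrow> bool" where
  "concordant R D D' \<longleftrightarrow>
     (\<exists>n Ds ev.
        Ds 0 = D \<and> Ds n = D' \<and>
        (\<forall>k<n. cobordism_step R (Ds k) (ev k) (Ds (Suc k))) \<and>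
        (\<forall>k\<le>n. fst ` dom (Ds k) \<subseteq> fst ` dom D) \<and>
        (\<forall>i\<in>fst ` dom D.
           connected_trace n Ds ev i \<and>
           births n ev i + deaths n ev i = saddles n ev i))"

abbreviation virtual_concordant :: "diagram \<Rightarrow> diagram \<Rightarrow> bool" where
  "virtual_concordant \<equiv> concordant reidemeister"

abbreviation semi_welded_concordant :: "diagram \<Rightarrow> diagram \<Rightarrow> bool" where
  "semi_welded_concordant \<equiv> concordant semi_welded_move"


section \<open>The Zh-construction yields semi-welded diagrams\<close>

lemma finite_arrows:
  assumes "wf_diagram D"
  shows "finite (arrows D)"
proof -
  have "finite (ran D)"
    using assms by (simp add: wf_diagram_def finite_ran)
  then have fin: "finite (endpoints D)"
    by (simp add: endpoints_def)
  have "arrows D = Foot -` endpoints D \<union> Head -` endpoints D"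
    by (auto simp: arrows_def)
  with fin show ?thesis
    by (simp add: finite_vimageI inj_on_def)
qed

lemma ex_zh_diagram:
  assumes "wf_diagram D"
  shows "\<exists>Z. zh_diagram D Z"
proof -
  have "finite (omega_feet D)"
    using finite_arrows[OF assms] by (auto simp: omega_feet_def)
  then show ?thesis
    unfolding zh_diagram_def by (metis finite_distinct_list)
qed

lemma zh_endpoint_disjoint:
  assumes "x \<noteq> y"
  shows "set (zh_endpoint x) \<inter> set (zh_endpoint y) = {}"
proof -
  have *: "3 * m \<noteq> Suc (3 * n)" "Suc (3 * m) \<noteq> 3 * n" "3 * m \<noteq> Suc (Suc (3 * n))"
    "Suc (Suc (3 * m)) \<noteq> 3 * n" "Suc (3 * m) \<noteq> Suc (Suc (3 * n))"
    "Suc (Suc (3 * m)) \<noteq> Suc (3 * n)" for m n :: nat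
    by presburger+
  show ?thesis
    using assms
    by (cases x rule: zh_endpoint.cases; cases y rule: zh_endpoint.cases) (auto simp: *)
qed

lemma zh_endpoint_omega_feet: "set (zh_endpoint x) \<inter> omega_feet D = {}"
proof -
  have "n mod 3 = 0" if "Foot (n, e) \<in> set (zh_endpoint x)" for n e
    using that by (cases x rule: zh_endpoint.cases) auto
  moreover have "n mod 3 \<noteq> 0" if feet: "Foot (n, e) \<in> omega_feet D" for n e
  proof -
    obtain m where "n = 3 * m + 1 \<or> n = 3 * m + 2"
      using feet by (auto simp: omega_feet_def)
    then show ?thesis
      by presburger
  qed
  moreover have "\<exists>n e. y = Foot (n, e)" if "y \<in> omega_feet D" for y
    using that by (auto simp: omega_feet_def)
  ultimately show ?thesis
    by (metis disjoint_iff)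
qed

lemma distinct_zh_endpoint: "distinct (zh_endpoint x)"
  by (cases x rule: zh_endpoint.cases) auto

lemma set_zh_word: "set (zh_word w) = (\<Union>x\<in>set w. set (zh_endpoint x))"
  by (auto simp: zh_word_def)

lemma distinct_zh_word: "distinct w \<Longrightarrow> distinct (zh_word w)"
proof (induction w)
  case Nil
  then show ?case by (simp add: zh_word_def)
next
  case (Cons x w)
  have "set (zh_endpoint x) \<inter> set (zh_endpoint y) = {}" if "y \<in> set w" for y
    using that Cons.prems by (intro zh_endpoint_disjoint) auto
  then have "set (zh_endpoint x) \<inter> set (zh_word w) = {}"
    unfolding set_zh_word by blast
  with Cons distinct_zh_endpoint[of x] show ?case
    by (simp add: zh_word_def)
qed

lemma zh_word_disjoint:
  "set w \<inter> set w' = {} \<Longrightarrow> set (zh_word w) \<inter> set (zh_word w') = {}"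
  unfolding set_zh_word using zh_endpoint_disjoint by (simp add: disjoint_iff) metis

lemma semi_welded_diagram_zh:
  assumes D: "virtual_diagram \<mu> D" and Z: "zh_diagram D Z"
  shows "semi_welded_diagram \<mu> Z"
proof -
  have wf: "wf_diagram D" and dom: "dom D = {(Comp i, 0) | i. i < \<mu>}"
    using D by (auto simp: virtual_diagram_def)
  obtain ws where ws: "distinct ws" "set ws = omega_feet D"
    and Z_eq: "Z = (\<lambda>c. map_option zh_word (D c))((Omega, 0) \<mapsto> ws)"
    using Z by (auto simp: zh_diagram_def)
  have om: "D (Omega, 0) = None"
  proof -
    have "(Omega, 0) \<notin> dom D"
      unfolding dom by simp
    then show ?thesis
      by (simp add: domIff)
  qed
  have domZ: "dom Z = insert (Omega, 0) {(Comp i, 0) | i. i < \<mu>}"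
    unfolding Z_eq dom[symmetric] by (simp add: dom_def Collect_conv_if insert_Collect)
  have disj: "set (zh_word w) \<inter> set ws = {}" if w: "D c = Some w" for c w
    unfolding ws(2) set_zh_word using zh_endpoint_omega_feet by blast
  have ends: "endpoints Z = (\<Union>x\<in>endpoints D. set (zh_endpoint x)) \<union> omega_feet D"
  proof -
    have "ran Z = insert ws (ran (\<lambda>c. map_option zh_word (D c)))"
      unfolding Z_eq using om by (simp add: ran_map_upd)
    also have "ran (\<lambda>c. map_option zh_word (D c)) = zh_word ` ran D"
      by (auto simp: ran_def)
    finally have "ran Z = insert ws (zh_word ` ran D)" .
    then show ?thesis
      by (auto simp: endpoints_def set_zh_word ws)
  qed
  have bal: "Foot a \<in> endpoints D \<longleftrightarrow> Head a \<in> endpoints D" for a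
    using wf unfolding wf_diagram_def by blast
  have arr: "a \<in> arrows D \<longleftrightarrow> Foot a \<in> endpoints D" for a
    using bal by (auto simp: arrows_def)
  have omf: "Foot b \<in> omega_feet D \<longleftrightarrow>
      (\<exists>n e. Foot (n, e) \<in> endpoints D \<and> (b = (3 * n + 1, \<not> e) \<or> b = (3 * n + 2, e)))" for b
    unfolding omega_feet_def by (auto simp: Bex_def arr)
  have f: "Foot b \<in> endpoints Z \<longleftrightarrow>
      (\<exists>n e. Foot (n, e) \<in> endpoints D \<and>
             (b = (3 * n, e) \<or> b = (3 * n + 1, \<not> e) \<or> b = (3 * n + 2, e)))" for b
  proof -
    have eq: "Foot b \<in> set (zh_endpoint x) \<longleftrightarrow> (\<exists>n e. x = Foot (n, e) \<and> b = (3 * n, e))" for x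
      by (cases x rule: zh_endpoint.cases) simp_all
    have "(\<exists>x\<in>endpoints D. Foot b \<in> set (zh_endpoint x)) \<longleftrightarrow>
        (\<exists>n e. Foot (n, e) \<in> endpoints D \<and> b = (3 * n, e))"
      unfolding eq by blast
    with omf show ?thesis
      unfolding ends Un_iff UN_iff omf by blast
  qed
  have h: "Head b \<in> endpoints Z \<longleftrightarrow>
      (\<exists>n e. Foot (n, e) \<in> endpoints D \<and>
             (b = (3 * n, e) \<or> b = (3 * n + 1, \<not> e) \<or> b = (3 * n + 2, e)))" for b
  proof -
    have eq: "Head b \<in> set (zh_endpoint x) \<longleftrightarrow>
        (\<exists>n e. x = Foot (n, e) \<and> b = (3 * n + 1, \<not> e) \<or>
               x = Head (n, e) \<and> (b = (3 * n, e) \<or> b = (3 * n + 2, e)))" for x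
      by (cases x rule: zh_endpoint.cases) simp_all
    have "(\<exists>x\<in>endpoints D. Head b \<in> set (zh_endpoint x)) \<longleftrightarrow>
        (\<exists>n e. Foot (n, e) \<in> endpoints D \<and> b = (3 * n + 1, \<not> e) \<or>
               Head (n, e) \<in> endpoints D \<and> (b = (3 * n, e) \<or> b = (3 * n + 2, e)))"
      unfolding eq by blast
    moreover have "Head b \<notin> omega_feet D"
      by (auto simp: omega_feet_def)
    ultimately show ?thesis
      unfolding ends Un_iff UN_iff bal[symmetric] by blast
  qed
  have dist: "distinct w" if "D c = Some w" for c w
    using wf that unfolding wf_diagram_def by blast
  have sep: "set w \<inter> set w' = {}" if "c \<noteq> c'" "D c = Some w" "D c' = Some w'" for c c' w w'
    using wf that unfolding wf_diagram_def by blast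
  have "wf_diagram Z"
    unfolding wf_diagram_def
  proof (intro conjI allI impI)
    show "finite (dom Z)"
      using wf unfolding domZ dom[symmetric] by (simp add: wf_diagram_def)
    show "distinct w" if "Z c = Some w" for c w
      using that ws(1) dist[of c] distinct_zh_word
      by (auto simp: Z_eq split: if_splits)
    show "set w \<inter> set w' = {}" if "c \<noteq> c'" "Z c = Some w" "Z c' = Some w'" for c c' w w'
      using that disj[of c] disj[of c'] zh_word_disjoint[OF sep[of c c']]
      by (auto simp: Z_eq Int_commute split: if_splits) blast
    show "Foot b \<in> endpoints Z \<longleftrightarrow> Head b \<in> endpoints Z" for b
      by (simp only: f h)
  qed
  with domZ show ?thesis
    by (simp add: semi_welded_diagram_def)
qed

end

(*
  The feet on omega may be permuted freely, so an arrow leaving omega is just a signed token on a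
  component of the link. Neighbouring tokens of opposite sign cancel (second Reidemeister move), and
  a pair of equal tokens passes a crossing (third move with omega on top). Hence only the integer
  weight of each arc matters, up to gauge: at any crossing an integer g may be added to the weights
  of the two incoming arcs and subtracted from those of the two outgoing arcs. Zh gives a crossing of
  sign e the weight -e on its incoming over-arc and e on its outgoing under-arc. For every
  Reidemeister move the weights on the arcs between the crossings involved can be gauged away; after
  the move the weights of Zh of the new diagram are recovered in the same way. Births, deaths and
  saddles do not touch the arrows and lift directly, with omega tracing a cylinder.
*)

theory Submission
  imports Defs
begin


section \<open>Diagrams under moves\<close>

text \<open>The obstacle is that \<open>zh_diagram\<close> fixes arrow names and an order of feet,
  and that diagrams are words with base points. Computing with tokens hides all this, because two
  diagrams that realise the same letters are always equivalent (\<open>realises_unique\<close>).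
  Letters stay indexed by the endpoints of the old diagram even after a crossing is deleted or
  displaced; only a last re-indexing passes to the new diagram.

  That the weights can be gauged away is a cocycle condition. Gauging changes the weight of an arc
  by the gauge at its end minus the gauge at its start, so the inner arcs of a bigon or a triangle
  can be cleared iff the signed sum of their weights around it vanishes. For the weights of Zh this
  follows from the opposite signs in \<open>R2\<close> and from the two sign conditions in
  \<open>R3\<close>; the loop of \<open>R1\<close> has weight 0 from the start.

  A single Reidemeister move lifts to a chain of moves of unknown length. The lifted cobordism
  therefore has its own clock, and a monotone time map carries the Euler count and the connectedness
  of the surfaces over to it.\<close>

declare split_paired_All [simp del] split_paired_Ex [simp del]

lemma endpoints_iff: "x \<in> endpoints D \<longleftrightarrow> (\<exists>c w. D c = Some w \<and> x \<in> set w)"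
  by (auto simp: endpoints_def ran_def)

lemma wf_distinct: "wf_diagram D \<Longrightarrow> D c = Some w \<Longrightarrow> distinct w"
  by (simp add: wf_diagram_def)

lemma wf_same_circle:
  "wf_diagram D \<Longrightarrow> D c = Some w \<Longrightarrow> D c' = Some w' \<Longrightarrow> x \<in> set w \<Longrightarrow> x \<in> set w' \<Longrightarrow> c = c'"
  unfolding wf_diagram_def by (meson disjoint_iff)

lemma wf_balanced: "wf_diagram D \<Longrightarrow> Foot a \<in> endpoints D \<longleftrightarrow> Head a \<in> endpoints D"
  by (simp add: wf_diagram_def)

lemma wf_arrows:
  "wf_diagram D \<Longrightarrow> a \<in> arrows D \<longleftrightarrow> Foot a \<in> endpoints D"
  "wf_diagram D \<Longrightarrow> a \<in> arrows D \<longleftrightarrow> Head a \<in> endpoints D"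
  by (auto simp: arrows_def wf_balanced)

lemma wf_diagramI:
  assumes "finite (dom D)"
    and "\<And>c w. D c = Some w \<Longrightarrow> distinct w"
    and "\<And>c c' w w' x. D c = Some w \<Longrightarrow> D c' = Some w' \<Longrightarrow> x \<in> set w \<Longrightarrow> x \<in> set w' \<Longrightarrow> c = c'"
    and "\<And>a. Foot a \<in> endpoints D \<longleftrightarrow> Head a \<in> endpoints D"
  shows "wf_diagram D"
  unfolding wf_diagram_def using assms by (metis disjoint_iff)

lemma wf_finite_dom: "wf_diagram D \<Longrightarrow> finite (dom D)"
  by (simp add: wf_diagram_def)

lemma map_endpoints_eq_Some:
  "map_endpoints f D c = Some w \<longleftrightarrow> (\<exists>w0. D c = Some w0 \<and> w = map f w0)"
  by (auto simp: map_endpoints_def)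

lemma dom_map_endpoints [simp]: "dom (map_endpoints f D) = dom D"
  by (auto simp: map_endpoints_def)

lemma endpoints_map_endpoints: "endpoints (map_endpoints f D) = f ` endpoints D"
proof (intro set_eqI iffI)
  fix x assume "x \<in> f ` endpoints D"
  then obtain c w y where "D c = Some w" "y \<in> set w" "x = f y"
    by (auto simp: endpoints_iff)
  then have "map_endpoints f D c = Some (map f w)" "x \<in> set (map f w)"
    by (auto simp: map_endpoints_def)
  then show "x \<in> endpoints (map_endpoints f D)"
    unfolding endpoints_iff by blast
next
  fix x assume "x \<in> endpoints (map_endpoints f D)"
  then obtain c w where "D c = Some w" "x \<in> f ` set w"
    by (auto simp: endpoints_iff map_endpoints_eq_Some)
  moreover have "set w \<subseteq> endpoints D"
    using \<open>D c = Some w\<close> unfolding endpoints_iff subset_iff by blast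
  ultimately show "x \<in> f ` endpoints D"
    by blast
qed

lemma wf_map_endpoints:
  assumes wf: "wf_diagram D" and inj: "inj_on f (endpoints D)"
    and bal: "\<And>a. Foot a \<in> f ` endpoints D \<longleftrightarrow> Head a \<in> f ` endpoints D"
  shows "wf_diagram (map_endpoints f D)"
proof (rule wf_diagramI)
  show "finite (dom (map_endpoints f D))"
    using wf by (simp add: wf_finite_dom)
  show "distinct w" if w: "map_endpoints f D c = Some w" for c w
  proof -
    obtain w0 where w0: "D c = Some w0" "w = map f w0"
      using w by (auto simp: map_endpoints_eq_Some)
    then have "set w0 \<subseteq> endpoints D"
      unfolding endpoints_iff subset_iff by blast
    with w0 wf_distinct[OF wf] inj show ?thesis
      by (auto simp: distinct_map intro: inj_on_subset)
  qed
  show "c = c'" if "map_endpoints f D c = Some w" "map_endpoints f D c' = Some w'"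
    "x \<in> set w" "x \<in> set w'" for c c' w w' x
  proof -
    obtain u u' y y' where *: "D c = Some u" "D c' = Some u'" "y \<in> set u" "y' \<in> set u'" "f y = f y'"
      using \<open>map_endpoints f D c = Some w\<close> \<open>map_endpoints f D c' = Some w'\<close> \<open>x \<in> set w\<close> \<open>x \<in> set w'\<close>
      by (auto simp: map_endpoints_eq_Some)
    then have "y \<in> endpoints D" "y' \<in> endpoints D"
      by (auto simp: endpoints_iff)
    then have "y = y'"
      using * inj by (meson inj_onD)
    with * show ?thesis
      using wf_same_circle[OF wf] by blast
  qed
qed (simp add: endpoints_map_endpoints bal)

lemma delete_arrows_eq_Some:
  "delete_arrows A D c = Some w \<longleftrightarrow>
    (\<exists>w0. D c = Some w0 \<and> w = filter (\<lambda>x. x \<notin> Foot ` A \<and> x \<notin> Head ` A) w0)"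
  by (auto simp: delete_arrows_def)

lemma dom_delete_arrows [simp]: "dom (delete_arrows A D) = dom D"
  by (auto simp: delete_arrows_def)

lemma endpoints_delete_arrows:
  "endpoints (delete_arrows A D) = endpoints D - (Foot ` A \<union> Head ` A)"
proof (rule set_eqI)
  show "x \<in> endpoints (delete_arrows A D) \<longleftrightarrow> x \<in> endpoints D - (Foot ` A \<union> Head ` A)" for x
    unfolding endpoints_iff delete_arrows_eq_Some Diff_iff Un_iff
    by (metis (no_types, lifting) filter_set Set.filter_eq mem_Collect_eq)
qed

lemma wf_delete_arrows:
  assumes wf: "wf_diagram D"
  shows "wf_diagram (delete_arrows A D)"
proof (rule wf_diagramI)
  show "Foot a \<in> endpoints (delete_arrows A D) \<longleftrightarrow> Head a \<in> endpoints (delete_arrows A D)" for a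
    using wf_balanced[OF wf] by (auto simp: endpoints_delete_arrows)
qed (use wf_finite_dom[OF wf] wf_distinct[OF wf] wf_same_circle[OF wf]
     in \<open>auto simp: delete_arrows_eq_Some\<close>)

lemma endpoints_base_point:
  assumes "D c = Some (u @ v)"
  shows "endpoints (D(c \<mapsto> v @ u)) = endpoints D"
proof -
  have "(\<exists>w. (D(c \<mapsto> v @ u)) c' = Some w \<and> x \<in> set w) \<longleftrightarrow> (\<exists>w. D c' = Some w \<and> x \<in> set w)" for c' x
    using assms by auto
  then show ?thesis
    unfolding set_eq_iff endpoints_iff by blast
qed

lemma wf_base_point:
  assumes wf: "wf_diagram D" and c: "D c = Some (u @ v)"
  shows "wf_diagram (D(c \<mapsto> v @ u))"
proof (rule wf_diagramI)
  show "finite (dom (D(c \<mapsto> v @ u)))"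
    using wf by (simp add: wf_finite_dom)
  show "distinct w" if "(D(c \<mapsto> v @ u)) c' = Some w" for c' w
    using that wf_distinct[OF wf c] wf_distinct[OF wf, of c'] by (auto split: if_splits)
  show "c1 = c2" if "(D(c \<mapsto> v @ u)) c1 = Some w1" "(D(c \<mapsto> v @ u)) c2 = Some w2"
    "x \<in> set w1" "x \<in> set w2" for c1 c2 w1 w2 x
  proof -
    have "\<exists>w. D c' = Some w \<and> x \<in> set w" if "(D(c \<mapsto> v @ u)) c' = Some w'" "x \<in> set w'" for c' w'
      using that c by (auto split: if_splits)
    then show ?thesis
      using that wf_same_circle[OF wf] by metis
  qed
qed (simp only: endpoints_base_point[of D c u v, OF c] wf_balanced[OF wf])

lemma rename_arrow_inj_on:
  assumes "inj_on f A"
  shows "inj_on (rename_arrow f) (Foot ` A \<union> Head ` A)"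
proof (rule inj_onI)
  fix x y assume "x \<in> Foot ` A \<union> Head ` A" "y \<in> Foot ` A \<union> Head ` A"
    "rename_arrow f x = rename_arrow f y"
  then show "x = y"
    using inj_onD[OF assms] by (cases x; cases y) auto
qed

lemma endpoints_subset: "endpoints D \<subseteq> Foot ` arrows D \<union> Head ` arrows D"
proof
  fix x assume "x \<in> endpoints D"
  then show "x \<in> Foot ` arrows D \<union> Head ` arrows D"
    by (cases x) (auto simp: arrows_def)
qed

lemma wf_rename:
  assumes wf: "wf_diagram D" and inj: "inj_on f (arrows D)"
  shows "wf_diagram (map_endpoints (rename_arrow f) D)"
proof (rule wf_map_endpoints[OF wf])
  show "inj_on (rename_arrow f) (endpoints D)"
    using rename_arrow_inj_on[OF inj] endpoints_subset by (rule inj_on_subset)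
  have "Foot a \<in> rename_arrow f ` E \<longleftrightarrow> (\<exists>b. Foot b \<in> E \<and> a = f b)"
    "Head a \<in> rename_arrow f ` E \<longleftrightarrow> (\<exists>b. Head b \<in> E \<and> a = f b)" for a E
    by (force elim!: rename_arrow.elims[OF sym])+
  then show "Foot a \<in> rename_arrow f ` endpoints D \<longleftrightarrow> Head a \<in> rename_arrow f ` endpoints D" for a
    by (simp add: wf_balanced[OF wf])
qed

lemma wf_exchange:
  assumes "wf_diagram D" "x \<in> endpoints D" "y \<in> endpoints D"
  shows "wf_diagram (exchange x y D)" "endpoints (exchange x y D) = endpoints D"
proof -
  have "Transposition.transpose x y ` endpoints D = endpoints D"
    using assms by (simp add: transpose_image_eq)
  then show "wf_diagram (exchange x y D)" "endpoints (exchange x y D) = endpoints D"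
    unfolding exchange_def endpoints_map_endpoints
    using wf_balanced[OF assms(1)] by (simp_all add: wf_map_endpoints assms(1))
qed

lemma dom_exchange [simp]: "dom (exchange x y D) = dom D"
  by (simp add: exchange_def)

lemma adjacent_on_endpoints:
  assumes "adjacent_on D c x y"
  shows "x \<in> endpoints D" "y \<in> endpoints D"
proof -
  obtain w n u where w: "D c = Some w" "rotate n w = x # y # u"
    using assms by (auto simp: adjacent_on_def)
  then have "set w = set (x # y # u)"
    by (metis set_rotate)
  with w(1) show "x \<in> endpoints D" "y \<in> endpoints D"
    by (auto simp: endpoints_iff)
qed

lemma adjacent_endpoints:
  "adjacent D x y \<Longrightarrow> x \<in> endpoints D" "adjacent D x y \<Longrightarrow> y \<in> endpoints D"
  by (auto simp: adjacent_def dest: adjacent_on_endpoints)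

lemma adjacent_in_order_endpoints:
  "adjacent_in_order p D x y \<Longrightarrow> x \<in> endpoints D" "adjacent_in_order p D x y \<Longrightarrow> y \<in> endpoints D"
  by (auto simp: adjacent_in_order_def split: if_splits dest: adjacent_endpoints)

lemma reidemeister_dom: "reidemeister D D' \<Longrightarrow> dom D' = dom D"
proof (induction rule: reidemeister.induct)
  case (base_point D c u v)
  then show ?case
    unfolding dom_fun_upd by (auto simp only: option.simps if_False)
qed simp_all

lemma reidemeister_wf: "reidemeister D D' \<Longrightarrow> wf_diagram D \<and> wf_diagram D'"
proof (induction rule: reidemeister.induct)
  case (R3 D a b c p q r)
  then show ?case
    by (simp add: wf_exchange adjacent_in_order_endpoints)
qed (simp_all only: wf_base_point wf_rename wf_delete_arrows simp_thms)

lemma semi_welded_move_dom: "semi_welded_move D D' \<Longrightarrow> dom D' = dom D"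
  by (induction rule: semi_welded_move.induct) (auto simp: reidemeister_dom)

lemma semi_welded_move_wf: "semi_welded_move D D' \<Longrightarrow> wf_diagram D \<and> wf_diagram D'"
  by (induction rule: semi_welded_move.induct)
    (auto simp: reidemeister_wf wf_exchange adjacent_on_endpoints)

text \<open>The base point of the circle lies either away from the pair or exactly between its two
  members. Only the second, wrapped case forces a change of base point later, in
  \<open>leads_to_shift\<close>.\<close>

lemma adjacent_on_iff:
  "adjacent_on D c x y \<longleftrightarrow>
    (\<exists>u v. D c = Some (u @ x # y # v)) \<or> (\<exists>u. D c = Some (y # u @ [x]))"
proof
  assume "adjacent_on D c x y"
  then obtain w n u where w: "D c = Some w" "rotate n w = x # y # u"
    by (auto simp: adjacent_on_def)
  define m where "m = n mod length w"
  have len: "length w \<ge> 2"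
    using arg_cong[OF w(2), of length] by simp
  have m: "m < length w"
    unfolding m_def using len by (intro mod_less_divisor) linarith
  have eq: "drop m w @ take m w = x # y # u"
    using w(2) by (simp add: rotate_drop_take m_def)
  have split: "w = take m w @ drop m w"
    by simp
  show "(\<exists>u v. D c = Some (u @ x # y # v)) \<or> (\<exists>u. D c = Some (y # u @ [x]))"
  proof (cases "drop m w")
    case Nil
    with m show ?thesis by simp
  next
    case (Cons x' r)
    then have x: "x' = x" and r: "r @ take m w = y # u"
      using eq by auto
    show ?thesis
    proof (cases r)
      case Nil
      with r Cons x split have "w = (y # u) @ [x]"
        by (metis append_Nil)
      with w(1) show ?thesis by auto
    next
      case (Cons y' r')
      with r x \<open>drop m w = x' # r\<close> split w(1) show ?thesis
        by (metis (no_types, lifting) append_Cons list.inject)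
    qed
  qed
next
  assume "(\<exists>u v. D c = Some (u @ x # y # v)) \<or> (\<exists>u. D c = Some (y # u @ [x]))"
  then show "adjacent_on D c x y"
  proof (elim disjE exE)
    fix u v assume "D c = Some (u @ x # y # v)"
    moreover have "rotate (length u) (u @ x # y # v) = x # y # (v @ u)"
      by (simp add: rotate_append)
    ultimately show ?thesis
      unfolding adjacent_on_def by blast
  next
    fix u assume "D c = Some (y # u @ [x])"
    moreover have "rotate (length (y # u)) ((y # u) @ [x]) = x # y # u"
      by (simp only: rotate_append) simp
    ultimately show ?thesis
      unfolding adjacent_on_def by (metis append_Cons)
  qed
qed


section \<open>Inflated diagrams\<close>

abbreviation sw_equiv :: "diagram \<Rightarrow> diagram \<Rightarrow> bool" (infix "\<approx>" 50) where
  "Z \<approx> Z' \<equiv> equivclp semi_welded_move Z Z'"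

lemma sw_equiv_invariant:
  assumes "Z \<approx> Z'" and "\<And>X Y. semi_welded_move X Y \<Longrightarrow> P X \<longleftrightarrow> P Y" and "P Z"
  shows "P Z'"
  using assms(1,3) by (induction rule: equivclp_induct) (use assms(2) in blast)+

lemma sw_equiv_wf: "Z \<approx> Z' \<Longrightarrow> wf_diagram Z \<Longrightarrow> wf_diagram Z'"
  by (rule sw_equiv_invariant) (auto dest: semi_welded_move_wf)

lemma sw_equiv_dom: "Z \<approx> Z' \<Longrightarrow> dom Z' = dom Z"
  by (rule sw_equiv_invariant[where P = "\<lambda>X. dom X = dom Z"]) (simp_all add: semi_welded_move_dom)

text \<open>The property shared by all stages of the given cobordism. Unlike
  \<open>virtual_diagram\<close> it allows several circles per component, and it leaves the label
  \<open>Omega\<close> free for the new circle.\<close>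

definition plain_diagram :: "diagram \<Rightarrow> bool" where
  "plain_diagram D \<longleftrightarrow> wf_diagram D \<and> Omega \<notin> fst ` dom D"

lemma plain_wf: "plain_diagram D \<Longrightarrow> wf_diagram D"
  by (simp add: plain_diagram_def)

lemma plain_Omega: "plain_diagram D \<Longrightarrow> D (Omega, k) = None"
  by (force simp: plain_diagram_def)

lemma reidemeister_plain: "reidemeister D D' \<Longrightarrow> plain_diagram D \<longleftrightarrow> plain_diagram D'"
  using reidemeister_dom[of D D'] reidemeister_wf[of D D'] by (simp add: plain_diagram_def)

text \<open>The common shape of Zh diagrams and of the intermediate diagrams in the computation:
  \<open>D\<close> is only an index, and each of its endpoints is replaced by a block. Blocks may be
  empty or contain points that belong elsewhere.\<close>

definition inflate :: "(endpoint \<Rightarrow> endpoint list) \<Rightarrow> endpoint list \<Rightarrow> diagram \<Rightarrow> diagram" where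
  "inflate g ws D = (\<lambda>c. map_option (\<lambda>w. concat (map g w)) (D c))((Omega, 0) \<mapsto> ws)"

lemma inflate_Omega [simp]: "inflate g ws D (Omega, 0) = Some ws"
  by (simp add: inflate_def)

lemma inflate_circle:
  "plain_diagram D \<Longrightarrow> D c = Some w \<Longrightarrow> inflate g ws D c = Some (concat (map g w))"
  using plain_Omega[of D 0] by (auto simp: inflate_def)

lemma inflate_eq_Some:
  assumes "plain_diagram D"
  shows "inflate g ws D c = Some u \<longleftrightarrow>
    c = (Omega, 0) \<and> u = ws \<or> (\<exists>w. D c = Some w \<and> u = concat (map g w))"
  using plain_Omega[OF assms, of 0] by (auto simp: inflate_def)

lemma dom_inflate: "dom (inflate g ws D) = insert (Omega, 0) (dom D)"
  by (auto simp: inflate_def)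

lemma endpoints_inflate:
  assumes "plain_diagram D"
  shows "endpoints (inflate g ws D) = set ws \<union> (\<Union>x\<in>endpoints D. set (g x))"
proof (rule set_eqI)
  fix y
  have "y \<in> endpoints (inflate g ws D) \<longleftrightarrow>
      y \<in> set ws \<or> (\<exists>c w. D c = Some w \<and> y \<in> set (concat (map g w)))"
    unfolding endpoints_iff inflate_eq_Some[OF assms] by blast
  also have "\<dots> \<longleftrightarrow> y \<in> set ws \<union> (\<Union>x\<in>endpoints D. set (g x))"
    unfolding Un_iff UN_iff Bex_def endpoints_iff set_concat set_map by blast
  finally show "y \<in> endpoints (inflate g ws D) \<longleftrightarrow> y \<in> set ws \<union> (\<Union>x\<in>endpoints D. set (g x))" .
qed

lemma word_subset_endpoints: "D c = Some w \<Longrightarrow> set w \<subseteq> endpoints D"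
  unfolding endpoints_iff subset_iff by blast

lemma inflate_cong:
  assumes "\<And>x. x \<in> endpoints D \<Longrightarrow> g x = g' x" "ws = ws'" "D = D'"
  shows "inflate g ws D = inflate g' ws' D'"
proof
  fix c
  have "concat (map g w) = concat (map g' w)" if "D c = Some w" for w
    using word_subset_endpoints[of D c w, OF that] assms(1)
    by (intro arg_cong[of _ _ concat] map_cong) auto
  then have "map_option (\<lambda>w. concat (map g w)) (D c) = map_option (\<lambda>w. concat (map g' w)) (D c)"
    by (intro map_option_cong) auto
  then show "inflate g ws D c = inflate g' ws' D' c"
    using assms(2,3) by (simp add: inflate_def)
qed

lemma map_endpoints_inflate:
  "map_endpoints f (inflate g ws D) = inflate (map f \<circ> g) (map f ws) D"
  by (rule ext) (simp add: map_endpoints_def inflate_def option.map_comp comp_def map_concat)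

lemma delete_arrows_inflate:
  fixes A
  defines "F \<equiv> filter (\<lambda>x. x \<notin> Foot ` A \<and> x \<notin> Head ` A)"
  shows "delete_arrows A (inflate g ws D) = inflate (F \<circ> g) (F ws) D"
  by (rule ext)
    (simp add: delete_arrows_def inflate_def option.map_comp comp_def filter_concat F_def)

lemma inflate_map_endpoints: "inflate g ws (map_endpoints f D) = inflate (g \<circ> f) ws D"
  by (rule ext) (simp add: map_endpoints_def inflate_def option.map_comp comp_def)

lemma concat_map_filter:
  "concat (map g (filter P w)) = concat (map (\<lambda>x. if P x then g x else []) w)"
  by (induction w) auto

lemma inflate_delete_arrows:
  "inflate g ws (delete_arrows A D) =
    inflate (\<lambda>x. if x \<notin> Foot ` A \<and> x \<notin> Head ` A then g x else []) ws D"
  by (rule ext)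
    (simp add: delete_arrows_def inflate_def option.map_comp comp_def concat_map_filter)

lemma distinct_concat_map:
  "distinct xs \<Longrightarrow> distinct (concat (map g xs)) \<longleftrightarrow>
    (\<forall>x\<in>set xs. distinct (g x)) \<and>
    (\<forall>x\<in>set xs. \<forall>y\<in>set xs. \<forall>z. z \<in> set (g x) \<longrightarrow> z \<in> set (g y) \<longrightarrow> x = y)"
proof (induction xs)
  case (Cons a xs)
  then show ?case
    by (auto simp: disjoint_iff)
qed simp

lemma wf_inflateI:
  assumes D: "plain_diagram D" and "distinct ws"
    and dist: "\<And>x. x \<in> endpoints D \<Longrightarrow> distinct (g x)"
    and disj: "\<And>x y z. x \<in> endpoints D \<Longrightarrow> y \<in> endpoints D \<Longrightarrow> z \<in> set (g x) \<Longrightarrow>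
      z \<in> set (g y) \<Longrightarrow> x = y"
    and ws: "\<And>x z. x \<in> endpoints D \<Longrightarrow> z \<in> set (g x) \<Longrightarrow> z \<notin> set ws"
    and bal: "\<And>a. Foot a \<in> set ws \<union> (\<Union>x\<in>endpoints D. set (g x)) \<longleftrightarrow>
      Head a \<in> set ws \<union> (\<Union>x\<in>endpoints D. set (g x))"
  shows "wf_diagram (inflate g ws D)"
proof (rule wf_diagramI)
  show "finite (dom (inflate g ws D))"
    using wf_finite_dom[OF plain_wf[OF D]] by (simp add: dom_inflate)
  show "distinct u" if "inflate g ws D c = Some u" for c u
    using that unfolding inflate_eq_Some[OF D]
  proof (elim disjE conjE exE)
    fix w assume w: "D c = Some w" and u: "u = concat (map g w)"
    have "set w \<subseteq> endpoints D" "distinct w"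
      using w wf_distinct[OF plain_wf[OF D]] by (auto dest: word_subset_endpoints)
    then show ?thesis
      unfolding u using dist disj by (subst distinct_concat_map) (blast+)
  qed (use \<open>distinct ws\<close> in simp)
  show "c = c'" if "inflate g ws D c = Some u" "inflate g ws D c' = Some u'"
    and z: "z \<in> set u" "z \<in> set u'" for c c' u u' z
    using that(1,2) unfolding inflate_eq_Some[OF D]
  proof (elim disjE conjE exE)
    fix w w' assume *: "D c = Some w" "u = concat (map g w)" "D c' = Some w'" "u' = concat (map g w')"
    then obtain x y where xy: "x \<in> set w" "z \<in> set (g x)" "y \<in> set w'" "z \<in> set (g y)"
      using z by auto
    have "x = y"
      using xy word_subset_endpoints[of D c w, OF *(1)] word_subset_endpoints[of D c' w', OF *(3)] disj by blast
    with xy * show ?thesis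
      using wf_same_circle[OF plain_wf[OF D]] by blast
  next
    fix w assume *: "c = (Omega, 0)" "u = ws" "D c' = Some w" "u' = concat (map g w)"
    then show ?thesis
      using z ws word_subset_endpoints[of D c' w, OF *(3)] by auto
  next
    fix w assume *: "c' = (Omega, 0)" "u' = ws" "D c = Some w" "u = concat (map g w)"
    then show ?thesis
      using z ws word_subset_endpoints[of D c w, OF *(3)] by auto
  qed simp
qed (simp only: endpoints_inflate[OF D] bal)

lemma wf_inflateD:
  assumes D: "plain_diagram D" and wf: "wf_diagram (inflate g ws D)"
  shows "distinct ws"
    and "x \<in> endpoints D \<Longrightarrow> distinct (g x)"
    and "x \<in> endpoints D \<Longrightarrow> y \<in> endpoints D \<Longrightarrow> z \<in> set (g x) \<Longrightarrow> z \<in> set (g y) \<Longrightarrow> x = y"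
    and "x \<in> endpoints D \<Longrightarrow> z \<in> set (g x) \<Longrightarrow> z \<notin> set ws"
    and "Foot a \<in> set ws \<union> (\<Union>x\<in>endpoints D. set (g x)) \<longleftrightarrow>
      Head a \<in> set ws \<union> (\<Union>x\<in>endpoints D. set (g x))"
proof -
  have circ: "\<exists>c w. D c = Some w \<and> x \<in> set w \<and> inflate g ws D c = Some (concat (map g w)) \<and>
      c \<noteq> (Omega, 0)" if x: "x \<in> endpoints D" for x
  proof -
    obtain c w where "D c = Some w" "x \<in> set w"
      using x unfolding endpoints_iff by blast
    then show ?thesis
      using inflate_circle[OF D] plain_Omega[OF D] by fastforce
  qed
  show "distinct ws"
    using wf_distinct[OF wf inflate_Omega] .
  show "distinct (g x)" if x: "x \<in> endpoints D" for x
  proof -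
    obtain c w where "x \<in> set w" "inflate g ws D c = Some (concat (map g w))" "D c = Some w"
      using circ[OF x] by blast
    then have "distinct (concat (map g w))" "distinct w"
      using wf_distinct[OF wf] wf_distinct[OF plain_wf[OF D]] by blast+
    with \<open>x \<in> set w\<close> show ?thesis
      by (simp add: distinct_concat_map)
  qed
  show "x = y" if xy: "x \<in> endpoints D" "y \<in> endpoints D" "z \<in> set (g x)" "z \<in> set (g y)" for x y z
  proof -
    obtain c w where w: "D c = Some w" "x \<in> set w" "inflate g ws D c = Some (concat (map g w))"
      using circ[OF xy(1)] by blast
    obtain c' w' where w': "D c' = Some w'" "y \<in> set w'" "inflate g ws D c' = Some (concat (map g w'))"
      using circ[OF xy(2)] by blast
    have "z \<in> set (concat (map g w))" "z \<in> set (concat (map g w'))"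
      using xy w w' by auto
    then have "c = c'"
      using wf_same_circle[OF wf] w w' by blast
    then have "w = w'"
      using w w' by simp
    moreover have "distinct w" "distinct (concat (map g w))"
      using w wf_distinct[OF wf] wf_distinct[OF plain_wf[OF D]] by blast+
    ultimately show ?thesis
      using w(2) w'(2) xy(3,4) by (simp add: distinct_concat_map)
  qed
  show "z \<notin> set ws" if x: "x \<in> endpoints D" "z \<in> set (g x)" for x z
  proof
    assume z: "z \<in> set ws"
    obtain c w where w: "x \<in> set w" "inflate g ws D c = Some (concat (map g w))" "c \<noteq> (Omega, 0)"
      using circ[OF x(1)] by blast
    have "z \<in> set (concat (map g w))"
      using x w by auto
    then show False
      using wf_same_circle[OF wf w(2) inflate_Omega] z w(3) by blast
  qed
  show "Foot a \<in> set ws \<union> (\<Union>x\<in>endpoints D. set (g x)) \<longleftrightarrow>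
      Head a \<in> set ws \<union> (\<Union>x\<in>endpoints D. set (g x))"
    using wf_balanced[OF wf] unfolding endpoints_inflate[OF D] .
qed

section \<open>Adjacency in inflated diagrams and free permutation of the feet on omega\<close>

lemma adjacent_on_inflate_Omega:
  "adjacent_on (inflate g (u @ p # q # v) D) (Omega, 0) p q"
  unfolding adjacent_on_iff by auto

lemma adjacent_inflate_within:
  assumes D: "plain_diagram D" and x: "x \<in> endpoints D" "g x = u @ p # q # v"
  shows "adjacent (inflate g ws D) p q"
proof -
  obtain c w where w: "D c = Some w" "x \<in> set w"
    using x unfolding endpoints_iff by blast
  then obtain \<alpha> \<beta> where "w = \<alpha> @ x # \<beta>"
    by (auto dest: split_list)
  then have "inflate g ws D c = Some ((concat (map g \<alpha>) @ u) @ p # q # v @ concat (map g \<beta>))"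
    using inflate_circle[OF D w(1)] x by simp
  then show ?thesis
    unfolding adjacent_def adjacent_on_iff by blast
qed

lemma adjacent_inflate_between:
  assumes D: "plain_diagram D" and xy: "adjacent D x y" "g x = u @ [p]" "g y = q # v"
  shows "adjacent (inflate g ws D) p q"
proof -
  obtain c where "(\<exists>\<alpha> \<beta>. D c = Some (\<alpha> @ x # y # \<beta>)) \<or> (\<exists>\<alpha>. D c = Some (y # \<alpha> @ [x]))"
    using xy(1) unfolding adjacent_def adjacent_on_iff by blast
  then show ?thesis
  proof (elim disjE exE)
    fix \<alpha> \<beta> assume "D c = Some (\<alpha> @ x # y # \<beta>)"
    then have "inflate g ws D c = Some ((concat (map g \<alpha>) @ u) @ p # q # v @ concat (map g \<beta>))"
      using inflate_circle[OF D] xy by simp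
    then show ?thesis
      unfolding adjacent_def adjacent_on_iff by blast
  next
    fix \<alpha> assume "D c = Some (y # \<alpha> @ [x])"
    then have "inflate g ws D c = Some (q # (v @ concat (map g \<alpha>) @ u) @ [p])"
      using inflate_circle[OF D] xy by simp
    then show ?thesis
      unfolding adjacent_def adjacent_on_iff by blast
  qed
qed

text \<open>An exchange acts on all words at once, but feet on omega occur in no block by
  well-formedness, so only the list on omega changes. This is the one place where forbidden overpass
  moves are produced.\<close>

lemma omega_swap:
  assumes D: "plain_diagram D" and wf: "wf_diagram (inflate g (u @ Foot a # Foot b # v) D)"
  shows "semi_welded_move (inflate g (u @ Foot a # Foot b # v) D)
    (inflate g (u @ Foot b # Foot a # v) D)"
proof -
  let ?t = "Transposition.transpose (Foot a) (Foot b)"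
  have notin: "Foot a \<notin> set (g x)" "Foot b \<notin> set (g x)" if "x \<in> endpoints D" for x
    using wf_inflateD(4)[OF D wf that] by force+
  have "map ?t (g x) = g x" if "x \<in> endpoints D" for x
    using notin[OF that] by (intro map_idI) (metis Transposition.transpose_def)
  moreover have "map ?t (u @ Foot a # Foot b # v) = u @ Foot b # Foot a # v"
  proof -
    have "?t z = z" if "z \<in> set u \<union> set v" for z
      using that wf_inflateD(1)[OF D wf] by (auto simp: Transposition.transpose_def)
    then have "map ?t u = u" "map ?t v = v"
      by (auto intro: map_idI)
    then show ?thesis by simp
  qed
  ultimately have "exchange (Foot a) (Foot b) (inflate g (u @ Foot a # Foot b # v) D) =
      inflate g (u @ Foot b # Foot a # v) D"
    unfolding exchange_def map_endpoints_inflate by (intro inflate_cong) simp_all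
  then show ?thesis
    using omega_overpass[OF wf adjacent_on_inflate_Omega] by simp
qed

lemma omega_rotate:
  assumes D: "plain_diagram D" and "wf_diagram (inflate g (pre @ x # u @ v) D)"
    and "set (x # u) \<subseteq> range Foot"
  shows "inflate g (pre @ x # u @ v) D \<approx> inflate g (pre @ u @ x # v) D"
  using assms(2,3)
proof (induction u arbitrary: pre)
  case (Cons y u)
  obtain a b where [simp]: "x = Foot a" "y = Foot b"
    using Cons.prems by auto
  have 1: "inflate g (pre @ x # (y # u) @ v) D \<approx> inflate g ((pre @ [y]) @ x # u @ v) D"
    using omega_swap[OF D, of g pre a b "u @ v"] Cons.prems by (simp add: r_into_equivclp)
  have "inflate g ((pre @ [y]) @ x # u @ v) D \<approx> inflate g ((pre @ [y]) @ u @ x # v) D"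
    using sw_equiv_wf[OF 1 Cons.prems(1)] Cons.prems by (intro Cons.IH) auto
  with 1 show ?case
    by (metis append.assoc append_Cons append_Nil equivclp_trans)
qed simp

text \<open>Insertion sort: the first foot is kept in a growing prefix while the others are ordered
  by induction, and then it is carried to its place by \<open>omega_rotate\<close>.\<close>

lemma omega_permute:
  assumes D: "plain_diagram D" and "wf_diagram (inflate g ws D)"
    and "set ws \<subseteq> range Foot" "set ws' = set ws" "distinct ws'"
  shows "inflate g ws D \<approx> inflate g ws' D"
proof -
  have "inflate g (pre @ ws) D \<approx> inflate g (pre @ ws') D"
    if "wf_diagram (inflate g (pre @ ws) D)" for pre
    using that assms(3-5)
  proof (induction ws arbitrary: pre ws')
    case (Cons x ws)
    then obtain u v where ws': "ws' = u @ x # v"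
      by (metis list.set_intros(1) split_list)
    have "distinct (x # ws)"
      using wf_inflateD(1)[OF D Cons.prems(1)] by simp
    then have eq: "set (u @ v) = set ws"
      using Cons.prems(3,4) unfolding ws' by auto
    have 1: "inflate g ((pre @ [x]) @ ws) D \<approx> inflate g ((pre @ [x]) @ u @ v) D"
      using Cons.prems eq unfolding ws' by (intro Cons.IH) auto
    have "inflate g (pre @ x # u @ v) D \<approx> inflate g (pre @ u @ x # v) D"
      using sw_equiv_wf[OF 1] Cons.prems unfolding ws' by (intro omega_rotate[OF D]) auto
    with 1 show ?case
      unfolding ws' by simp (rule equivclp_trans)
  qed simp
  from this[of "[]"] show ?thesis
    using assms(2) by simp
qed


section \<open>Tokens\<close>

text \<open>
  Since the feet on \<open>\<omega>\<close> may be permuted freely, an arrow with foot on \<open>\<omega>\<close> is determined by the place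
  of its head and by its sign. \<open>Tok s\<close> stands for such a head of sign \<open>s\<close>, \<open>Pt x\<close> for an endpoint
  of the underlying diagram. In a realisation, \<open>\<nu>\<close> gives the new names of the underlying arrows.
\<close>

datatype letter = Tok bool | Pt endpoint

fun arrow_of :: "endpoint \<Rightarrow> arrow" where
  "arrow_of (Foot a) = a"
| "arrow_of (Head a) = a"

text \<open>\<open>W\<close> is the set of feet on omega. The two clauses make opposite demands on
  it, so no endpoint can be read both as a token and as a point.\<close>

fun represents :: "(arrow \<Rightarrow> arrow) \<Rightarrow> endpoint set \<Rightarrow> letter \<Rightarrow> endpoint \<Rightarrow> bool" where
  "represents \<nu> W (Tok s) y \<longleftrightarrow> (\<exists>t. y = Head t \<and> snd t = s \<and> Foot t \<in> W)"
| "represents \<nu> W (Pt x) y \<longleftrightarrow>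
     y = rename_arrow \<nu> x \<and> snd (\<nu> (arrow_of x)) = snd (arrow_of x) \<and> Foot (\<nu> (arrow_of x)) \<notin> W"

text \<open>Read off from the letters instead of \<open>arrows D\<close>, because blocks may have
  lost their point after a deletion or hold another point after an \<open>R3\<close> move.\<close>

definition point_arrows :: "diagram \<Rightarrow> (endpoint \<Rightarrow> letter list) \<Rightarrow> arrow set" where
  "point_arrows D h = {arrow_of y | y. \<exists>x\<in>endpoints D. Pt y \<in> set (h x)}"

definition realised_by ::
  "diagram \<Rightarrow> (endpoint \<Rightarrow> letter list) \<Rightarrow> (endpoint \<Rightarrow> endpoint list) \<Rightarrow> (arrow \<Rightarrow> arrow) \<Rightarrow>
    endpoint list \<Rightarrow> bool" where
  "realised_by D h g \<nu> ws \<longleftrightarrow>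
     wf_diagram (inflate g ws D) \<and> set ws \<subseteq> range Foot \<and> inj_on \<nu> (point_arrows D h) \<and>
     (\<forall>x\<in>endpoints D. list_all2 (represents \<nu> (set ws)) (h x) (g x))"

definition realises :: "diagram \<Rightarrow> (endpoint \<Rightarrow> letter list) \<Rightarrow> diagram \<Rightarrow> bool" where
  "realises D h Z \<longleftrightarrow> (\<exists>g \<nu> ws. realised_by D h g \<nu> ws \<and> Z = inflate g ws D)"

section \<open>Uniqueness of realisations up to semi-welded equivalence\<close>

lemma zip_blocks_unique:
  assumes D: "plain_diagram D" and wf: "wf_diagram (inflate g ws D)"
    and xy: "x \<in> endpoints D" "y \<in> endpoints D"
    "(z, z1) \<in> set (zip (g x) (g' x))" "(z, z2) \<in> set (zip (g y) (g' y))"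
  shows "z1 = z2"
proof -
  have "x = y"
    using xy wf_inflateD(3)[OF D wf] by (meson set_zip_leftD)
  obtain i j where "i < length (g x)" "g x ! i = z" "g' x ! i = z1"
    "j < length (g x)" "g x ! j = z" "g' x ! j = z2"
    using xy(3,4) \<open>x = y\<close> by (auto simp: set_zip)
  then show ?thesis
    using wf_inflateD(2)[OF D wf xy(1)] by (metis nth_eq_iff_index_eq)
qed

text \<open>Comparing the blocks position by position matches the endpoints off omega. Every arrow
  has its head in a block, so the matched heads define a renaming \<open>f\<close>; the feet of
  underlying arrows follow suit. After renaming, the two diagrams differ only in the order of the
  feet on omega.\<close>

lemma realised_by_unique:
  assumes D: "plain_diagram D" and R: "realised_by D h g \<nu> ws" and R': "realised_by D h g' \<nu>' ws'"
  shows "inflate g ws D \<approx> inflate g' ws' D"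
proof -
  let ?E = "endpoints D"
  have wf: "wf_diagram (inflate g ws D)" and wf': "wf_diagram (inflate g' ws' D)"
    using R R' by (simp_all add: realised_by_def)
  have feet: "set ws \<subseteq> range Foot" "set ws' \<subseteq> range Foot"
    using R R' by (simp_all add: realised_by_def)
  have rep: "list_all2 (represents \<nu> (set ws)) (h x) (g x)"
    "list_all2 (represents \<nu>' (set ws')) (h x) (g' x)" if "x \<in> ?E" for x
    using that R R' by (simp_all add: realised_by_def)
  have len: "length (g x) = length (h x)" "length (g' x) = length (h x)" if "x \<in> ?E" for x
    using rep[OF that] by (auto dest: list_all2_lengthD)
  define \<sigma> where "\<sigma> y y' \<longleftrightarrow> (\<exists>x\<in>?E. (y, y') \<in> set (zip (g x) (g' x)))" for y y'
  have uniq: "y1 = y2" if "\<sigma> y y1" "\<sigma> y y2" for y y1 y2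
    using that zip_blocks_unique[OF D wf] unfolding \<sigma>_def by meson
  have inj: "y1 = y2" if "\<sigma> y1 y" "\<sigma> y2 y" for y y1 y2
  proof -
    have swap: "(z', z) \<in> set (zip (g' x) (g x))" if "(z, z') \<in> set (zip (g x) (g' x))" for x z z'
      using that by (auto simp: set_zip)
    show ?thesis
      using that zip_blocks_unique[OF D wf'] swap unfolding \<sigma>_def by meson
  qed
  have \<sigma>_nth: "\<sigma> (g x ! j) (g' x ! j)" if "x \<in> ?E" "j < length (h x)" for x j
    using that len by (auto simp: \<sigma>_def set_zip)
  have \<sigma>_letter: "\<exists>x\<in>?E. \<exists>l\<in>set (h x). represents \<nu> (set ws) l y \<and> represents \<nu>' (set ws') l y'"
    if \<sigma>: "\<sigma> y y'" for y y'
  proof -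
    obtain x j where xj: "x \<in> ?E" "j < length (g x)" "j < length (g' x)" "g x ! j = y" "g' x ! j = y'"
      using \<sigma> by (auto simp: \<sigma>_def set_zip)
    then have "represents \<nu> (set ws) (h x ! j) y" "represents \<nu>' (set ws') (h x ! j) y'"
      using rep[OF xj(1)] by (auto simp: list_all2_conv_all_nth)
    with xj len show ?thesis
      by (metis nth_mem)
  qed
  have \<sigma>_total: "\<exists>y'. \<sigma> y y'" if "y \<in> endpoints (inflate g ws D)" "y \<notin> set ws" for y
    using that \<sigma>_nth len unfolding endpoints_inflate[OF D] by (metis UN_E UnE in_set_conv_nth)
  have \<sigma>_surj: "\<exists>y. \<sigma> y y'" if "y' \<in> endpoints (inflate g' ws' D)" "y' \<notin> set ws'" for y'
    using that \<sigma>_nth len unfolding endpoints_inflate[OF D] by (metis UN_E UnE in_set_conv_nth)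
  have \<sigma>_Head: "\<exists>t'. y' = Head t' \<and> snd t' = snd t \<and> (Foot t' \<in> set ws' \<longleftrightarrow> Foot t \<in> set ws)"
    if H: "\<sigma> (Head t) y'" for t y'
  proof -
    obtain l where l: "represents \<nu> (set ws) l (Head t)" "represents \<nu>' (set ws') l y'"
      using \<sigma>_letter[OF H] by blast
    show ?thesis
    proof (cases l)
      case (Pt x)
      with l show ?thesis by (cases x) auto
    qed (use l in auto)
  qed
  \<comment> \<open>Heads are used because the foot of a token lies on omega, where no position is
    matched. Outside the matched heads \<open>f\<close> is the identity, since \<open>rename\<close>
    asks for preserved signs of all arrows, present or not.\<close>
  define f where "f t = (if \<exists>t'. \<sigma> (Head t) (Head t') then THE t'. \<sigma> (Head t) (Head t') else t)" for t
  have f: "f t = t'" if "\<sigma> (Head t) (Head t')" for t t'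
    using that uniq by (auto simp: f_def intro!: the_equality)
  have \<sigma>_f: "\<sigma> (Head t) (Head (f t))" if "t \<in> arrows (inflate g ws D)" for t
  proof -
    have "Head t \<in> endpoints (inflate g ws D)" "Head t \<notin> set ws"
      using that wf_arrows(2)[OF wf] feet by auto
    then show ?thesis
      using \<sigma>_total \<sigma>_Head f by metis
  qed
  have f_sign: "snd (f t) = snd t" for t
  proof (cases "\<exists>t'. \<sigma> (Head t) (Head t')")
    case True
    then show ?thesis
      using f \<sigma>_Head by fastforce
  qed (simp add: f_def)
  have f_inj: "inj_on f (arrows (inflate g ws D))"
  proof (rule inj_onI)
    fix s t assume "s \<in> arrows (inflate g ws D)" "t \<in> arrows (inflate g ws D)" "f s = f t"
    then have "Head s = Head t"
      using \<sigma>_f inj by metis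
    then show "s = t" by simp
  qed
  have \<sigma>_rename: "y' = rename_arrow f y" if \<sigma>: "\<sigma> y y'" for y y'
  proof (cases y)
    case (Head t)
    then show ?thesis
      using that \<sigma>_Head f by fastforce
  next
    case (Foot t)
    obtain x l where xl: "x \<in> ?E" "l \<in> set (h x)" "represents \<nu> (set ws) l y" "represents \<nu>' (set ws') l y'"
      using \<sigma>_letter[OF \<sigma>] by blast
    obtain a where l: "l = Pt (Foot a)"
    proof (cases l)
      case (Pt z)
      with xl Foot show ?thesis by (cases z) (auto intro: that)
    qed (use xl Foot in auto)
    with xl Foot have t: "t = \<nu> a" "y' = Foot (\<nu>' a)" "Foot t \<notin> set ws"
      by auto
    have "t \<in> arrows (inflate g ws D)"
    proof -
      obtain x' where "x' \<in> ?E" "y \<in> set (g x')"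
        using \<open>\<sigma> y y'\<close> unfolding \<sigma>_def by (meson set_zip_leftD)
      then have "y \<in> endpoints (inflate g ws D)"
        unfolding endpoints_inflate[OF D] by blast
      then show ?thesis
        unfolding Foot wf_arrows(1)[OF wf] .
    qed
    \<comment> \<open>The head of the same arrow also comes from a point. Injectivity of
      \<open>\<nu>\<close> shows that it is a point of the same underlying arrow, so foot and head
      receive the same new name.\<close>
    from \<sigma>_f[OF this] obtain x' l' where xl': "x' \<in> ?E" "l' \<in> set (h x')"
      "represents \<nu> (set ws) l' (Head t)" "represents \<nu>' (set ws') l' (Head (f t))"
      using \<sigma>_letter by blast
    obtain b where l': "l' = Pt (Head b)"
    proof (cases l')
      case (Pt z)
      with xl' show ?thesis by (cases z) (auto intro: that)
    qed (use xl' t in auto)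
    with xl' have t': "t = \<nu> b" "f t = \<nu>' b"
      by auto
    have "a \<in> point_arrows D h" "b \<in> point_arrows D h"
      using xl(1,2) xl'(1,2) unfolding l l' point_arrows_def by force+
    then have "a = b"
      using t(1) t'(1) R unfolding realised_by_def by (metis inj_onD)
    then show ?thesis
      using t t' Foot by simp
  qed
  have blocks: "map (rename_arrow f) (g x) = g' x" if "x \<in> ?E" for x
    by (intro nth_equalityI) (simp_all add: len[OF that] \<sigma>_rename[OF \<sigma>_nth[OF that], symmetric])
  have ren: "inflate g ws D \<approx> inflate g' (map (rename_arrow f) ws) D"
  proof -
    have "map_endpoints (rename_arrow f) (inflate g ws D) = inflate g' (map (rename_arrow f) ws) D"
      unfolding map_endpoints_inflate using blocks by (intro inflate_cong) auto
    then show ?thesis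
      using rename[OF wf f_inj f_sign] reidemeister by (metis r_into_equivclp)
  qed
  have "set ws' = set (map (rename_arrow f) ws)"
  proof (intro equalityI subsetI)
    fix y assume "y \<in> set ws'"
    then obtain t' where y: "y = Foot t'" "Foot t' \<in> set ws'"
      using feet by auto
    then have "Foot t' \<in> endpoints (inflate g' ws' D)"
      unfolding endpoints_inflate[OF D] by blast
    then have "Head t' \<in> endpoints (inflate g' ws' D)" "Head t' \<notin> set ws'"
      using feet wf_balanced[OF wf'] by auto
    then obtain z where z: "\<sigma> z (Head t')"
      using \<sigma>_surj by blast
    then obtain l where l: "represents \<nu> (set ws) l z" "represents \<nu>' (set ws') l (Head t')"
      using \<sigma>_letter by blast
    obtain t where t: "z = Head t" "Foot t \<in> set ws"
    proof (cases l)
      case (Pt x)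
      with l y show ?thesis by (cases x) auto
    qed (use l in auto)
    then have "y = rename_arrow f (Foot t)"
      using z f y by auto
    with t show "y \<in> set (map (rename_arrow f) ws)"
      unfolding set_map by blast
  next
    fix y assume "y \<in> set (map (rename_arrow f) ws)"
    then obtain t where t: "y = Foot (f t)" "Foot t \<in> set ws"
      using feet by auto
    then have "t \<in> arrows (inflate g ws D)"
      unfolding wf_arrows(1)[OF wf] endpoints_inflate[OF D] by blast
    then show "y \<in> set ws'"
      using \<sigma>_Head[OF \<sigma>_f] t by auto
  qed
  moreover have "set (map (rename_arrow f) ws) \<subseteq> range Foot"
    using feet by auto
  ultimately show ?thesis
    using equivclp_trans[OF ren omega_permute[OF D sw_equiv_wf[OF ren wf]]]
      wf_inflateD(1)[OF D wf'] by simp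
qed

lemma realises_unique:
  "plain_diagram D \<Longrightarrow> realises D h Z \<Longrightarrow> realises D h Z' \<Longrightarrow> Z \<approx> Z'"
  unfolding realises_def using realised_by_unique by blast

lemma realised_byD:
  assumes "realised_by D h g \<nu> ws"
  shows "wf_diagram (inflate g ws D)" "set ws \<subseteq> range Foot" "inj_on \<nu> (point_arrows D h)"
    and "x \<in> endpoints D \<Longrightarrow> list_all2 (represents \<nu> (set ws)) (h x) (g x)"
  using assms by (simp_all add: realised_by_def)

lemma realises_cong:
  assumes "\<And>x. x \<in> endpoints D \<Longrightarrow> h x = h' x"
  shows "realises D h = realises D h'"
proof -
  have "point_arrows D h = point_arrows D h'"
    using assms by (simp add: point_arrows_def cong: bex_cong)
  then show ?thesis
    using assms by (simp add: realises_def realised_by_def fun_eq_iff cong: ball_cong)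
qed

lemma point_arrows_mono:
  assumes "\<And>x y. x \<in> endpoints D \<Longrightarrow> Pt y \<in> set (h' x) \<Longrightarrow> \<exists>x'\<in>endpoints D. Pt y \<in> set (h x')"
  shows "point_arrows D h' \<subseteq> point_arrows D h"
  using assms unfolding point_arrows_def by blast

lemma represents_in_arrows:
  assumes D: "plain_diagram D" and R: "realised_by D h g \<nu> ws" and a: "a \<in> point_arrows D h"
  shows "\<nu> a \<in> arrows (inflate g ws D)" "Foot (\<nu> a) \<notin> set ws" "snd (\<nu> a) = snd a"
proof -
  obtain x y where xy: "x \<in> endpoints D" "Pt y \<in> set (h x)" "arrow_of y = a"
    using a unfolding point_arrows_def by blast
  obtain j where j: "j < length (h x)" "h x ! j = Pt y"
    using xy(2) by (meson in_set_conv_nth)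
  have l2: "list_all2 (represents \<nu> (set ws)) (h x) (g x)"
    using realised_byD(4)[OF R xy(1)] .
  have rep: "represents \<nu> (set ws) (Pt y) (g x ! j)"
    using list_all2_nthD[OF l2 j(1)] j(2) by simp
  have "g x ! j \<in> set (g x)"
    using j(1) list_all2_lengthD[OF l2] by (auto intro: nth_mem)
  then have "rename_arrow \<nu> y \<in> endpoints (inflate g ws D)"
    using rep xy(1) unfolding endpoints_inflate[OF D] by auto
  then show "\<nu> a \<in> arrows (inflate g ws D)"
    using xy(3) by (cases y) (auto simp: arrows_def)
  show "Foot (\<nu> a) \<notin> set ws" "snd (\<nu> a) = snd a"
    using rep xy(3) by simp_all
qed

lemma realised_by_permute:
  assumes D: "plain_diagram D" and R: "realised_by D h g \<nu> ws"
    and ws: "distinct ws'" "set ws' = set ws"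
  shows "realised_by D h g \<nu> ws'" "inflate g ws D \<approx> inflate g ws' D"
proof -
  show eq: "inflate g ws D \<approx> inflate g ws' D"
    using omega_permute[OF D realised_byD(1,2)[OF R]] ws by simp
  show "realised_by D h g \<nu> ws'"
    using sw_equiv_wf[OF eq realised_byD(1)[OF R]] R ws by (simp add: realised_by_def)
qed

section \<open>Elementary steps on tokens: cancelling, inserting, sliding and passing a
  crossing\<close>

lemma represents_change_feet:
  assumes "list_all2 (represents \<nu> W) ls ys"
    and "\<And>t. Foot t \<in> set ys \<or> Head t \<in> set ys \<Longrightarrow> Foot t \<in> W \<longleftrightarrow> Foot t \<in> W'"
  shows "list_all2 (represents \<nu> W') ls ys"
  using assms(1)
proof (rule list.rel_mono_strong)
  fix l y assume "y \<in> set ys" "represents \<nu> W l y"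
  then show "represents \<nu> W' l y"
  proof (cases l)
    case (Pt x)
    with assms(2) \<open>y \<in> set ys\<close> \<open>represents \<nu> W l y\<close> show ?thesis
      by (cases x) auto
  qed (use assms(2) in auto)
qed

text \<open>Quantifying over all realisations lets steps compose without tracking names, base points
  or the order on omega. \<open>D\<close> is fixed throughout and serves only as an index.\<close>

definition leads_to :: "diagram \<Rightarrow> (endpoint \<Rightarrow> letter list) \<Rightarrow> (endpoint \<Rightarrow> letter list) \<Rightarrow> bool" where
  "leads_to D h h' \<longleftrightarrow> (\<forall>Z. realises D h Z \<longrightarrow> (\<exists>Z'. realises D h' Z' \<and> Z \<approx> Z'))"

lemma leads_to_refl: "leads_to D h h"
  unfolding leads_to_def using equivclp_refl by fast

lemma leads_to_trans [trans]: "leads_to D h h' \<Longrightarrow> leads_to D h' h'' \<Longrightarrow> leads_to D h h''"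
  unfolding leads_to_def using equivclp_trans by fast

lemma leads_to_cong:
  assumes "\<And>x. x \<in> endpoints D \<Longrightarrow> h x = h' x"
  shows "leads_to D h h'"
  using realises_cong[OF assms] leads_to_refl[of D h] unfolding leads_to_def by simp

lemma leads_toI:
  assumes "\<And>g \<nu> ws. realised_by D h g \<nu> ws \<Longrightarrow>
    \<exists>g' \<nu>' ws'. realised_by D h' g' \<nu>' ws' \<and> inflate g ws D \<approx> inflate g' ws' D"
  shows "leads_to D h h'"
  unfolding leads_to_def
proof (intro allI impI)
  fix Z assume "realises D h Z"
  then obtain g \<nu> ws where "realised_by D h g \<nu> ws" "Z = inflate g ws D"
    unfolding realises_def by blast
  with assms[of g \<nu> ws] show "\<exists>Z'. realises D h' Z' \<and> Z \<approx> Z'"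
    unfolding realises_def by blast
qed

text \<open>The feet are placed at the start of omega, so that they are adjacent as
  \<open>R2\<close> demands. Being an equivalence, the result serves both to cancel and to insert a
  pair.\<close>

lemma delete_token_pair:
  assumes D: "plain_diagram D" and y: "y \<in> endpoints D" "g y = u @ v" and sign: "snd t \<noteq> snd t'"
    and wf: "wf_diagram (inflate (g(y := u @ Head t # Head t' # v)) (Foot t # Foot t' # ws) D)"
      (is "wf_diagram (inflate ?g ?ws D)")
  shows "inflate ?g ?ws D \<approx> inflate g ws D"
proof -
  let ?P = "\<lambda>x. x \<notin> Foot ` {t, t'} \<and> x \<notin> Head ` {t, t'}"
  note * = wf_inflateD[OF D wf]
  have gx: "filter ?P (?g x) = g x" if x: "x \<in> endpoints D" for x
  proof (cases "x = y")
    case True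
    have "Foot t \<notin> set (?g y)" "Foot t' \<notin> set (?g y)" "distinct (?g y)"
      using *(2)[OF y(1)] *(4)[OF y(1), of "Foot t"] *(4)[OF y(1), of "Foot t'"] by auto
    then have "filter ?P u = u" "filter ?P v = v"
      by (auto simp: filter_id_conv)
    then show ?thesis
      using True y(2) by simp
  next
    case False
    have "Foot t \<notin> set (?g x)" "Foot t' \<notin> set (?g x)"
      using *(4)[OF x, of "Foot t"] *(4)[OF x, of "Foot t'"] by auto
    moreover have "Head t \<notin> set (?g x)" "Head t' \<notin> set (?g x)"
      using *(3)[OF x y(1), of "Head t"] *(3)[OF x y(1), of "Head t'"] False by auto
    ultimately show ?thesis
      using False by (auto simp: filter_id_conv)
  qed
  have wsP: "filter ?P ?ws = ws"
  proof -
    have "Head t \<notin> set ?ws" "Head t' \<notin> set ?ws"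
      using *(4)[OF y(1), of "Head t"] *(4)[OF y(1), of "Head t'"] by auto
    with *(1) show ?thesis
      by (auto simp: filter_id_conv)
  qed
  have "delete_arrows {t, t'} (inflate ?g ?ws D) = inflate g ws D"
    unfolding delete_arrows_inflate using gx wsP by (intro inflate_cong) auto
  moreover have "reidemeister (inflate ?g ?ws D) (delete_arrows {t, t'} (inflate ?g ?ws D))"
  proof (rule R2[OF wf sign])
    show "adjacent (inflate ?g ?ws D) (Foot t) (Foot t')"
      using adjacent_on_inflate_Omega[of ?g "[]" "Foot t" "Foot t'" ws D]
      unfolding adjacent_def append_Nil by blast
    show "adjacent (inflate ?g ?ws D) (Head t) (Head t') \<or> adjacent (inflate ?g ?ws D) (Head t') (Head t)"
      using adjacent_inflate_within[OF D y(1), of ?g u "Head t" "Head t'" v] by simp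
  qed
  ultimately show ?thesis
    by (metis reidemeister r_into_equivclp)
qed

text \<open>The feet of the two tokens may lie far apart on omega; they are first permuted to its
  beginning. \<open>R2\<close> accepts the heads in either order, so \<open>s\<close> is
  arbitrary.\<close>

lemma leads_to_cancel:
  assumes D: "plain_diagram D"
  shows "leads_to D (h(y := u @ Tok s # Tok (\<not> s) # v)) (h(y := u @ v))"
proof (cases "y \<in> endpoints D")
  case True
  let ?h = "h(y := u @ Tok s # Tok (\<not> s) # v)"
  show ?thesis
  proof (rule leads_toI)
    fix g \<nu> ws assume R: "realised_by D ?h g \<nu> ws"
    note wf = realised_byD(1)[OF R] and feet = realised_byD(2)[OF R]
    have "list_all2 (represents \<nu> (set ws)) (u @ Tok s # Tok (\<not> s) # v) (g y)"
      using realised_byD(4)[OF R True] by simp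
    then obtain u1 v1 t t' where gy: "g y = u1 @ Head t # Head t' # v1"
      and uv: "list_all2 (represents \<nu> (set ws)) u u1" "list_all2 (represents \<nu> (set ws)) v v1"
      and t: "snd t = s" "snd t' = (\<not> s)" "Foot t \<in> set ws" "Foot t' \<in> set ws"
      unfolding list_all2_append1 list_all2_Cons1 represents.simps by blast
    define rest where "rest = filter (\<lambda>x. x \<noteq> Foot t \<and> x \<noteq> Foot t') ws"
    let ?ws = "Foot t # Foot t' # rest"
    have ws: "distinct ?ws" "set ?ws = set ws"
      using wf_inflateD(1)[OF D wf] t by (auto simp: rest_def)
    note perm = realised_by_permute[OF D R ws]
    note wf' = realised_byD(1)[OF perm(1)]
    let ?g = "g(y := u1 @ v1)"
    have g: "?g(y := u1 @ Head t # Head t' # v1) = g"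
      using gy by auto
    have del: "inflate g ?ws D \<approx> inflate ?g rest D"
      using delete_token_pair[OF D True, of ?g u1 v1 t t' rest] t wf' g by simp
    have eq: "inflate g ws D \<approx> inflate ?g rest D"
      using equivclp_trans[OF perm(2) del] .
    have rep: "list_all2 (represents \<nu> (set rest)) ls ys"
      if "list_all2 (represents \<nu> (set ws)) ls ys" "set ys \<subseteq> set (?g x)" "x \<in> endpoints D" for ls ys x
    proof (rule represents_change_feet[OF that(1)])
      fix r assume "Foot r \<in> set ys \<or> Head r \<in> set ys"
      then have r: "Foot r \<in> set (?g x) \<or> Head r \<in> set (?g x)"
        using that(2) by blast
      have "r \<noteq> t \<and> r \<noteq> t'"
      proof (cases "x = y")
        case True
        with r have "Foot r \<in> set (g y) \<or> Head r \<in> set u1 \<union> set v1"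
          using gy by auto
        then show ?thesis
          using wf_inflateD(2,4)[OF D wf \<open>y \<in> endpoints D\<close>] gy t by auto
      next
        case False
        with r have "Foot r \<in> set (g x) \<or> Head r \<in> set (g x)"
          by auto
        then show ?thesis
          using wf_inflateD(4)[OF D wf that(3)] wf_inflateD(3)[OF D wf that(3) \<open>y \<in> endpoints D\<close>]
            False gy t by auto
      qed
      then show "Foot r \<in> set ws \<longleftrightarrow> Foot r \<in> set rest"
        by (auto simp: rest_def)
    qed
    have "realised_by D (h(y := u @ v)) ?g \<nu> rest"
      unfolding realised_by_def
    proof (intro conjI ballI)
      show "wf_diagram (inflate ?g rest D)"
        using sw_equiv_wf[OF eq wf] .
      show "set rest \<subseteq> range Foot"
        using feet by (auto simp: rest_def)
      show "inj_on \<nu> (point_arrows D (h(y := u @ v)))"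
      proof (rule inj_on_subset[OF realised_byD(3)[OF R]], rule point_arrows_mono)
        show "\<exists>x'\<in>endpoints D. Pt z \<in> set (?h x')"
          if "x \<in> endpoints D" "Pt z \<in> set ((h(y := u @ v)) x)" for x z
          using that by (intro bexI[of _ x]) (auto split: if_splits)
      qed
      show "list_all2 (represents \<nu> (set rest)) ((h(y := u @ v)) x) (?g x)" if "x \<in> endpoints D" for x
      proof (rule rep[OF _ subset_refl that])
        show "list_all2 (represents \<nu> (set ws)) ((h(y := u @ v)) x) (?g x)"
          using uv realised_byD(4)[OF R that] by (auto intro: list_all2_appendI)
      qed
    qed
    with eq show "\<exists>g' \<nu>' ws'. realised_by D (h(y := u @ v)) g' \<nu>' ws' \<and>
        inflate g ws D \<approx> inflate g' ws' D"
      by blast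
  qed
qed (auto intro: leads_to_cong)

text \<open>The second Reidemeister move read backwards; the work lies in showing that the enlarged
  diagram is well-formed.\<close>

lemma leads_to_insert:
  assumes D: "plain_diagram D"
  shows "leads_to D (h(y := u @ v)) (h(y := u @ Tok s # Tok (\<not> s) # v))"
proof (cases "y \<in> endpoints D")
  case True
  let ?h = "h(y := u @ v)" and ?h' = "h(y := u @ Tok s # Tok (\<not> s) # v)"
  show ?thesis
  proof (rule leads_toI)
    fix g \<nu> ws assume R: "realised_by D ?h g \<nu> ws"
    let ?Z = "inflate g ws D"
    note wf = realised_byD(1)[OF R] and feet = realised_byD(2)[OF R]
    have "list_all2 (represents \<nu> (set ws)) (u @ v) (g y)"
      using realised_byD(4)[OF R True] by simp
    then obtain u1 v1 where gy: "g y = u1 @ v1"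
      and uv: "list_all2 (represents \<nu> (set ws)) u u1" "list_all2 (represents \<nu> (set ws)) v v1"
      by (auto simp: list_all2_append1)
    obtain n where n: "n \<notin> fst ` arrows ?Z"
      using ex_new_if_finite[OF infinite_UNIV_nat] finite_arrows[OF wf] by blast
    define t where "t = (n, s)"
    define t' where "t' = (n, \<not> s)"
    have new: "t \<notin> arrows ?Z" "t' \<notin> arrows ?Z" "t \<noteq> t'"
      using n by (force simp: t_def t'_def)+
    then have fresh: "Foot t \<notin> endpoints ?Z" "Foot t' \<notin> endpoints ?Z" "Head t \<notin> endpoints ?Z"
      "Head t' \<notin> endpoints ?Z"
      by (auto simp: arrows_def)
    let ?g = "g(y := u1 @ Head t # Head t' # v1)" and ?ws = "Foot t # Foot t' # ws"
    have sub: "set ws \<subseteq> endpoints ?Z" "x \<in> endpoints D \<Longrightarrow> set (g x) \<subseteq> endpoints ?Z" for x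
      unfolding endpoints_inflate[OF D] by blast+
    have set_g: "set (?g x) = set (g x) \<union> (if x = y then {Head t, Head t'} else {})" for x
      using gy by auto
    have wf': "wf_diagram (inflate ?g ?ws D)"
    proof (rule wf_inflateI[OF D])
      show "distinct ?ws"
        using wf_inflateD(1)[OF D wf] fresh sub(1) new(3) by auto
      show "distinct (?g x)" if x: "x \<in> endpoints D" for x
        using wf_inflateD(2)[OF D wf x] gy sub(2)[OF x] fresh new(3) by auto
      show "x = x'" if "x \<in> endpoints D" "x' \<in> endpoints D" "z \<in> set (?g x)" "z \<in> set (?g x')"
        for x x' z
        using that(3,4) wf_inflateD(3)[OF D wf that(1,2)] fresh sub(2)[OF that(1)] sub(2)[OF that(2)]
        unfolding set_g by (auto split: if_splits)
      show "z \<notin> set ?ws" if "x \<in> endpoints D" "z \<in> set (?g x)" for x z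
        using that(2) wf_inflateD(4)[OF D wf that(1)] fresh sub(1) sub(2)[OF that(1)]
        unfolding set_g by (auto split: if_splits)
      have "(\<Union>x\<in>endpoints D. set (?g x)) = (\<Union>x\<in>endpoints D. set (g x)) \<union> {Head t, Head t'}"
        using True unfolding set_g by (auto split: if_splits)
      then have "set ?ws \<union> (\<Union>x\<in>endpoints D. set (?g x)) =
          endpoints ?Z \<union> {Foot t, Foot t', Head t, Head t'}"
        unfolding endpoints_inflate[OF D] by auto
      then show "Foot a \<in> set ?ws \<union> (\<Union>x\<in>endpoints D. set (?g x)) \<longleftrightarrow>
          Head a \<in> set ?ws \<union> (\<Union>x\<in>endpoints D. set (?g x))" for a
        using wf_balanced[OF wf, of a] by auto
    qed
    have eq: "?Z \<approx> inflate ?g ?ws D"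
      by (rule equivclp_sym, rule delete_token_pair[OF D True gy _ wf']) (simp add: t_def t'_def)
    have "realised_by D ?h' ?g \<nu> ?ws"
      unfolding realised_by_def
    proof (intro conjI ballI wf')
      show "set ?ws \<subseteq> range Foot"
        using feet by auto
      show "inj_on \<nu> (point_arrows D ?h')"
      proof (rule inj_on_subset[OF realised_byD(3)[OF R]], rule point_arrows_mono)
        show "\<exists>x'\<in>endpoints D. Pt z \<in> set (?h x')"
          if "x \<in> endpoints D" "Pt z \<in> set (?h' x)" for x z
          using that by (intro bexI[of _ x]) (auto split: if_splits)
      qed
      fix x assume x: "x \<in> endpoints D"
      have rep: "list_all2 (represents \<nu> (set ?ws)) ls ys"
        if "list_all2 (represents \<nu> (set ws)) ls ys" "set ys \<subseteq> endpoints ?Z" for ls ys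
        using that fresh by (intro represents_change_feet[OF that(1)]) auto
      have "set u1 \<subseteq> endpoints ?Z" "set v1 \<subseteq> endpoints ?Z"
        using sub(2)[OF True] gy by auto
      then show "list_all2 (represents \<nu> (set ?ws)) (?h' x) (?g x)"
        using rep[OF uv(1)] rep[OF uv(2)] rep[OF realised_byD(4)[OF R x] sub(2)[OF x]]
        by (auto simp: t_def t'_def intro!: list_all2_appendI)
    qed
    with eq show "\<exists>g' \<nu>' ws'. realised_by D ?h' g' \<nu>' ws' \<and> ?Z \<approx> inflate g' ws' D"
      by blast
  qed
qed (auto intro: leads_to_cong)

lemma inj_on_point_arrows_mono:
  assumes "realised_by D h g \<nu> ws"
    and "\<And>x y. x \<in> endpoints D \<Longrightarrow> Pt y \<in> set (h' x) \<Longrightarrow> \<exists>x'\<in>endpoints D. Pt y \<in> set (h x')"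
  shows "inj_on \<nu> (point_arrows D h')"
  using realised_byD(3)[OF assms(1)] point_arrows_mono[of D h' h] assms(2) by (blast intro: inj_on_subset)

text \<open>Cutting the same word into blocks differently changes nothing, unless the arc from
  \<open>x\<close> to \<open>y\<close> contains the base point. In that case
  \<open>base_point\<close> carries the letters \<open>q\<close> from the end of the word to its
  start.\<close>

lemma leads_to_shift:
  assumes D: "plain_diagram D" and adj: "adjacent D x y" and hx: "h x = p @ q"
  shows "leads_to D h (h(x := p, y := q @ h y))"
proof (rule leads_toI)
  fix g \<nu> ws assume R: "realised_by D h g \<nu> ws"
  note wf = realised_byD(1)[OF R]
  have xy: "x \<in> endpoints D" "y \<in> endpoints D"
    using adjacent_endpoints[OF adj] .
  obtain c where c: "(\<exists>\<alpha> \<beta>. D c = Some (\<alpha> @ x # y # \<beta>)) \<or> (\<exists>\<alpha>. D c = Some (y # \<alpha> @ [x]))"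
    using adj unfolding adjacent_def adjacent_on_iff by blast
  obtain w where w: "D c = Some w" "x \<in> set w" "y \<in> set w"
    using c by auto
  have "x \<noteq> y"
    using c wf_distinct[OF plain_wf[OF D], of c] by auto
  obtain p1 q1 where gx: "g x = p1 @ q1"
    and pq: "list_all2 (represents \<nu> (set ws)) p p1" "list_all2 (represents \<nu> (set ws)) q q1"
    using realised_byD(4)[OF R xy(1)] unfolding hx list_all2_append1 by blast
  let ?h = "h(x := p, y := q @ h y)" and ?g = "g(x := p1, y := q1 @ g y)"
  have other: "concat (map ?g u) = concat (map g u)" if "x \<notin> set u" "y \<notin> set u" for u
    using that by (intro arg_cong[of _ _ concat] map_cong) auto
  have circ: "inflate ?g ws D c' = inflate g ws D c'" if "c' \<noteq> c" for c'
  proof -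
    have "x \<notin> set u" "y \<notin> set u" if "D c' = Some u" for u
      using wf_same_circle[OF plain_wf[OF D] w(1) that] w \<open>c' \<noteq> c\<close> by blast+
    then show ?thesis
      using other by (auto simp: inflate_def intro!: map_option_cong)
  qed
  have "inflate ?g ws D = inflate g ws D \<or> reidemeister (inflate g ws D) (inflate ?g ws D)"
    using c
  proof (elim disjE exE)
    fix \<alpha> \<beta> assume Dc: "D c = Some (\<alpha> @ x # y # \<beta>)"
    then have "x \<notin> set \<alpha>" "y \<notin> set \<alpha>" "x \<notin> set \<beta>" "y \<notin> set \<beta>"
      using wf_distinct[OF plain_wf[OF D] Dc] by auto
    then have "inflate ?g ws D c = inflate g ws D c"
      using inflate_circle[OF D Dc] other[of \<alpha>] other[of \<beta>] \<open>x \<noteq> y\<close> gx by simp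
    then have "inflate ?g ws D = inflate g ws D"
      using circ by (metis ext)
    then show ?thesis ..
  next
    fix \<alpha> assume Dc: "D c = Some (y # \<alpha> @ [x])"
    then have \<alpha>: "x \<notin> set \<alpha>" "y \<notin> set \<alpha>"
      using wf_distinct[OF plain_wf[OF D] Dc] by auto
    have 1: "inflate g ws D c = Some ((g y @ concat (map g \<alpha>) @ p1) @ q1)"
      using inflate_circle[OF D Dc] gx by simp
    have "inflate ?g ws D c = Some (q1 @ (g y @ concat (map g \<alpha>) @ p1))"
      using inflate_circle[OF D Dc] other[OF \<alpha>] \<open>x \<noteq> y\<close> by simp
    then have "inflate ?g ws D = (inflate g ws D)(c \<mapsto> q1 @ (g y @ concat (map g \<alpha>) @ p1))"
      using circ by auto
    then show ?thesis
      using base_point[OF wf 1] by simp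
  qed
  then have eq: "inflate g ws D \<approx> inflate ?g ws D"
    using reidemeister by (metis equivclp_refl r_into_equivclp)
  have "realised_by D ?h ?g \<nu> ws"
    unfolding realised_by_def
  proof (intro conjI ballI)
    show "wf_diagram (inflate ?g ws D)"
      using sw_equiv_wf[OF eq wf] .
    show "set ws \<subseteq> range Foot"
      using realised_byD(2)[OF R] .
    show "inj_on \<nu> (point_arrows D ?h)"
    proof (rule inj_on_point_arrows_mono[OF R])
      show "\<exists>x'\<in>endpoints D. Pt b \<in> set (h x')" if "a \<in> endpoints D" "Pt b \<in> set (?h a)" for a b
      proof -
        have "set (?h a) \<subseteq> set (h x) \<union> set (h a)"
          using hx by auto
        with that xy(1) show ?thesis
          by blast
      qed
    qed
    show "list_all2 (represents \<nu> (set ws)) (?h z) (?g z)" if "z \<in> endpoints D" for z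
      using realised_byD(4)[OF R that] realised_byD(4)[OF R xy(2)] pq
      by (auto intro: list_all2_appendI)
  qed
  with eq show "\<exists>g' \<nu>' ws'. realised_by D ?h g' \<nu>' ws' \<and> inflate g ws D \<approx> inflate g' ws' D"
    by blast
qed

text \<open>The third Reidemeister move with the strand \<open>\<omega>\<close> on top moves a pair of tokens past a crossing.\<close>

lemma leads_to_pass:
  assumes D: "plain_diagram D" and a: "a \<in> arrows D"
    and hF: "h (Foot a) = u @ Tok s # Pt (Foot a) # v"
    and hH: "h (Head a) = u' @ Tok s # Pt (Head a) # v'"
  shows "leads_to D h (h(Foot a := u @ Pt (Foot a) # Tok s # v, Head a := u' @ Pt (Head a) # Tok s # v'))"
    (is "leads_to D h ?h")
proof (rule leads_toI)
  fix g \<nu> ws assume R: "realised_by D h g \<nu> ws"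
  let ?rep = "list_all2 (represents \<nu> (set ws))"
  note wf = realised_byD(1)[OF R] and feet = realised_byD(2)[OF R]
  have F: "Foot a \<in> endpoints D" and H: "Head a \<in> endpoints D"
    using a wf_arrows[OF plain_wf[OF D]] by blast+
  define \<alpha> where "\<alpha> = \<nu> a"
  obtain A u1 v1 where gF: "g (Foot a) = u1 @ Head A # Foot \<alpha> # v1"
    and uv: "?rep u u1" "?rep v v1" and A: "snd A = s" "Foot A \<in> set ws"
    and \<alpha>: "snd \<alpha> = snd a" "Foot \<alpha> \<notin> set ws"
    using realised_byD(4)[OF R F]
    unfolding hF list_all2_append1 list_all2_Cons1 represents.simps rename_arrow.simps arrow_of.simps \<alpha>_def
    by blast
  obtain B u2 v2 where gH: "g (Head a) = u2 @ Head B # Head \<alpha> # v2"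
    and uv': "?rep u' u2" "?rep v' v2" and B: "snd B = s" "Foot B \<in> set ws"
    using realised_byD(4)[OF R H]
    unfolding hH list_all2_append1 list_all2_Cons1 represents.simps rename_arrow.simps arrow_of.simps \<alpha>_def
    by blast
  have "A \<noteq> B"
    using wf_inflateD(3)[OF D wf F H, of "Head A"] gF gH by auto
  have dist: "distinct [A, B, \<alpha>]"
    using A B \<alpha> \<open>A \<noteq> B\<close> by auto
  \<comment> \<open>Both tokens come before their endpoint of the crossing, so \<open>q\<close> and
    \<open>r\<close> are true and each sign condition of \<open>R3\<close> says that
    \<open>p\<close> holds iff \<open>s\<close> is the sign of the crossing. The order of the two
    feet on omega is free and is chosen to fit.\<close>
  define p where "p \<longleftrightarrow> s = snd \<alpha>"
  define rest where "rest = filter (\<lambda>x. x \<noteq> Foot A \<and> x \<noteq> Foot B) ws"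
  let ?ws = "if p then Foot A # Foot B # rest else Foot B # Foot A # rest"
  let ?ws' = "if p then Foot B # Foot A # rest else Foot A # Foot B # rest"
  have ws: "distinct ?ws" "set ?ws = set ws"
    using wf_inflateD(1)[OF D wf] A B \<open>A \<noteq> B\<close> by (auto simp: rest_def)
  note perm = realised_by_permute[OF D R ws]
  let ?Z = "inflate g ?ws D"
  note wf' = realised_byD(1)[OF perm(1)]
  let ?t1 = "Transposition.transpose (Foot A) (Foot B)"
  let ?t2 = "Transposition.transpose (Head A) (Foot \<alpha>)"
  let ?t3 = "Transposition.transpose (Head B) (Head \<alpha>)"
  define \<tau> where "\<tau> = ?t1 \<circ> ?t2 \<circ> ?t3"
  have "reidemeister ?Z
      (exchange (Foot A) (Foot B) (exchange (Head A) (Foot \<alpha>) (exchange (Head B) (Head \<alpha>) ?Z)))"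
  proof (rule R3[OF wf' dist])
    show "adjacent_in_order p ?Z (Foot A) (Foot B)"
      using adjacent_on_inflate_Omega[of g "[]" _ _ rest D]
      unfolding adjacent_in_order_def adjacent_def append_Nil by metis
    show "adjacent_in_order True ?Z (Head A) (Foot \<alpha>)"
      using adjacent_inflate_within[of D _ g, OF D F gF] by (simp add: adjacent_in_order_def)
    show "adjacent_in_order True ?Z (Head B) (Head \<alpha>)"
      using adjacent_inflate_within[of D _ g, OF D H gH] by (simp add: adjacent_in_order_def)
  qed (use A B in \<open>auto simp: p_def\<close>)
  moreover have "exchange (Foot A) (Foot B) (exchange (Head A) (Foot \<alpha>) (exchange (Head B) (Head \<alpha>) ?Z)) =
      map_endpoints \<tau> ?Z"
    unfolding exchange_def \<tau>_def
    by (rule ext) (simp add: map_endpoints_def option.map_comp comp_def)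
  ultimately have "?Z \<approx> map_endpoints \<tau> ?Z"
    by (metis reidemeister r_into_equivclp)
  moreover
  let ?g = "g(Foot a := u1 @ Foot \<alpha> # Head A # v1, Head a := u2 @ Head \<alpha> # Head B # v2)"
  have \<tau>_id: "\<tau> z = z" if "z \<notin> {Foot A, Foot B, Head A, Foot \<alpha>, Head B, Head \<alpha>}" for z
    using that by (simp add: \<tau>_def Transposition.transpose_def)
  have \<tau>: "\<tau> (Foot A) = Foot B" "\<tau> (Foot B) = Foot A" "\<tau> (Head A) = Foot \<alpha>" "\<tau> (Foot \<alpha>) = Head A"
    "\<tau> (Head B) = Head \<alpha>" "\<tau> (Head \<alpha>) = Head B"
    using dist by (auto simp: \<tau>_def Transposition.transpose_def)
  have map_id: "map \<tau> zs = zs" if "set zs \<inter> {Foot A, Foot B, Head A, Foot \<alpha>, Head B, Head \<alpha>} = {}" for zs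
    using that \<tau>_id by (intro map_idI) blast
  have no_feet: "Foot A \<notin> set (g x)" "Foot B \<notin> set (g x)" if "x \<in> endpoints D" for x
    using wf_inflateD(4)[OF D wf that, of "Foot A"] wf_inflateD(4)[OF D wf that, of "Foot B"] A B by auto
  have "map \<tau> (g x) = ?g x" if x: "x \<in> endpoints D" for x
  proof -
    note sep = wf_inflateD(3)[OF D wf x]
    consider "x = Foot a" | "x = Head a" | "x \<noteq> Foot a" "x \<noteq> Head a"
      by blast
    then show ?thesis
    proof cases
      case 1
      have "map \<tau> u1 = u1" "map \<tau> v1 = v1"
        using no_feet[OF F] wf_inflateD(2)[OF D wf F] sep[OF H, of "Head B"] sep[OF H, of "Head \<alpha>"]
        unfolding 1 gF gH by (intro map_id, force)+
      then show ?thesis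
        using 1 gF \<tau> by simp
    next
      case 2
      have "map \<tau> u2 = u2" "map \<tau> v2 = v2"
        using no_feet[OF H] wf_inflateD(2)[OF D wf H] sep[OF F, of "Head A"] sep[OF F, of "Foot \<alpha>"]
        unfolding 2 gF gH by (intro map_id, force)+
      then show ?thesis
        using 2 gH \<tau> by simp
    next
      case 3
      have "map \<tau> (g x) = g x"
        using no_feet[OF x] 3 sep[OF F, of "Head A"] sep[OF F, of "Foot \<alpha>"] sep[OF H, of "Head B"]
          sep[OF H, of "Head \<alpha>"] gF gH by (intro map_id) auto
      then show ?thesis
        using 3 by simp
    qed
  qed
  moreover have "map \<tau> ?ws = ?ws'"
  proof -
    have "Head z \<notin> set ?ws" for z
      using feet ws(2) by auto
    then have "map \<tau> rest = rest"
      using ws \<alpha> by (intro map_id) (auto simp: rest_def)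
    then show ?thesis
      using \<tau> by simp
  qed
  ultimately have "?Z \<approx> inflate ?g ?ws' D"
    using inflate_cong[of D "map \<tau> \<circ> g" ?g "map \<tau> ?ws" ?ws' D]
    unfolding map_endpoints_inflate comp_apply by simp
  then have eq: "inflate g ws D \<approx> inflate ?g ?ws' D"
    using equivclp_trans[OF perm(2)] by blast
  have ws': "set ?ws' = set ws"
    unfolding ws(2)[symmetric] by (simp add: insert_commute)
  have "realised_by D ?h ?g \<nu> ?ws'"
    unfolding realised_by_def ws'
  proof (intro conjI ballI)
    show "wf_diagram (inflate ?g ?ws' D)"
      using sw_equiv_wf[OF eq wf] .
    show "set ws \<subseteq> range Foot"
      using feet .
    show "inj_on \<nu> (point_arrows D ?h)"
    proof (rule inj_on_point_arrows_mono[OF R])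
      show "\<exists>x'\<in>endpoints D. Pt y \<in> set (h x')" if "x \<in> endpoints D" "Pt y \<in> set (?h x)" for x y
        using that hF hH by (intro bexI[of _ x]) (auto split: if_splits)
    qed
    show "list_all2 (represents \<nu> (set ws)) (?h x) (?g x)" if "x \<in> endpoints D" for x
      using realised_byD(4)[OF R that] uv uv' A B \<alpha>
      by (auto simp: \<alpha>_def intro!: list_all2_appendI)
  qed
  with eq show "\<exists>g' \<nu>' ws'. realised_by D ?h g' \<nu>' ws' \<and> inflate g ws D \<approx> inflate g' ws' D"
    by blast
qed


section \<open>Moves of the crossings\<close>

lemma list_all2_filter:
  assumes "list_all2 R xs ys" and "\<And>x y. x \<in> set xs \<Longrightarrow> R x y \<Longrightarrow> P x \<longleftrightarrow> Q y"
  shows "list_all2 R (filter P xs) (filter Q ys)"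
  using assms by (induction rule: list_all2_induct) auto

fun keep_letter :: "arrow set \<Rightarrow> letter \<Rightarrow> bool" where
  "keep_letter A (Tok s) \<longleftrightarrow> True"
| "keep_letter A (Pt x) \<longleftrightarrow> arrow_of x \<notin> A"

lemma point_arrowsI: "x \<in> endpoints D \<Longrightarrow> Pt y \<in> set (h x) \<Longrightarrow> arrow_of y \<in> point_arrows D h"
  unfolding point_arrows_def by blast

text \<open>Since \<open>\<nu>\<close> is injective on the points, deleting \<open>\<nu>\<close>
  A\<open>removes exactly the points of\<close>A\<open>. No token is lost: its foot lies on omega, and the feet of\<close>\<nu>
  \<open>A\<close> do not.\<close>

lemma realised_by_remove:
  assumes D: "plain_diagram D" and R: "realised_by D h g \<nu> ws" and A: "A \<subseteq> point_arrows D h"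
  defines "F \<equiv> filter (\<lambda>x. x \<notin> Foot ` \<nu> ` A \<and> x \<notin> Head ` \<nu> ` A)"
  shows "delete_arrows (\<nu> ` A) (inflate g ws D) = inflate (F \<circ> g) ws D"
    and "realised_by D (filter (keep_letter A) \<circ> h) (F \<circ> g) \<nu> ws"
proof -
  have foot: "Foot (\<nu> a) \<notin> set ws" if "a \<in> A" for a
    using represents_in_arrows(2)[OF D R] A that by blast
  have "F ws = ws"
    using foot realised_byD(2)[OF R] by (auto simp: F_def filter_id_conv)
  then show eq: "delete_arrows (\<nu> ` A) (inflate g ws D) = inflate (F \<circ> g) ws D"
    unfolding delete_arrows_inflate F_def by (intro inflate_cong) simp_all
  have "list_all2 (represents \<nu> (set ws)) (filter (keep_letter A) (h x)) (F (g x))"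
    if x: "x \<in> endpoints D" for x
    unfolding F_def
  proof (rule list_all2_filter[OF realised_byD(4)[OF R x]])
    fix l y assume l: "l \<in> set (h x)" "represents \<nu> (set ws) l y"
    show "keep_letter A l \<longleftrightarrow> y \<notin> Foot ` \<nu> ` A \<and> y \<notin> Head ` \<nu> ` A"
    proof (cases l)
      case (Tok s)
      with l foot show ?thesis by auto
    next
      case (Pt z)
      have "arrow_of z \<in> point_arrows D h"
        using point_arrowsI[of x D z h] x l Pt by simp
      then have "\<nu> (arrow_of z) \<in> \<nu> ` A \<longleftrightarrow> arrow_of z \<in> A"
        using realised_byD(3)[OF R] A by (simp add: inj_on_image_mem_iff)
      with l Pt show ?thesis
        by (cases z) auto
    qed
  qed
  moreover have "inj_on \<nu> (point_arrows D (filter (keep_letter A) \<circ> h))"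
    by (rule inj_on_point_arrows_mono[OF R]) auto
  moreover have "wf_diagram (inflate (F \<circ> g) ws D)"
    using wf_delete_arrows[OF realised_byD(1)[OF R]] unfolding eq[symmetric] .
  ultimately show "realised_by D (filter (keep_letter A) \<circ> h) (F \<circ> g) \<nu> ws"
    using realised_byD(2)[OF R] by (simp add: realised_by_def)
qed

text \<open>For \<open>x\<close> and \<open>y\<close> adjacent in \<open>D\<close>: the arc between
  them carries no token, so that the two points are adjacent in every realisation and a Reidemeister
  move of the crossings becomes available.\<close>

definition meets :: "(endpoint \<Rightarrow> letter list) \<Rightarrow> endpoint \<Rightarrow> endpoint \<Rightarrow> bool" where
  "meets h x y \<longleftrightarrow> (\<exists>u v. h x = u @ [Pt x] \<and> h y = Pt y # v)"

lemma adjacent_points: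
  assumes D: "plain_diagram D" and R: "realised_by D h g \<nu> ws"
    and adj: "adjacent D x y" and m: "meets h x y"
  shows "adjacent (inflate g ws D) (rename_arrow \<nu> x) (rename_arrow \<nu> y)"
    and "arrow_of x \<in> point_arrows D h" "arrow_of y \<in> point_arrows D h"
proof -
  have xy: "x \<in> endpoints D" "y \<in> endpoints D"
    using adjacent_endpoints[OF adj] .
  obtain u v where h: "h x = u @ [Pt x]" "h y = Pt y # v"
    using m unfolding meets_def by blast
  obtain u1 v1 where "g x = u1 @ [rename_arrow \<nu> x]" "g y = rename_arrow \<nu> y # v1"
    using realised_byD(4)[OF R xy(1)] realised_byD(4)[OF R xy(2)] h
    by (auto simp: list_all2_append1 list_all2_Cons1)
  then show "adjacent (inflate g ws D) (rename_arrow \<nu> x) (rename_arrow \<nu> y)"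
    using adjacent_inflate_between[OF D adj] by blast
  show "arrow_of x \<in> point_arrows D h" "arrow_of y \<in> point_arrows D h"
    using point_arrowsI[OF xy(1), of x h] point_arrowsI[OF xy(2), of y h] h by simp_all
qed

text \<open>The blocks of deleted arrows remain together with their tokens. \<open>D\<close> stays
  the index until these leftovers have been cancelled.\<close>

lemma leads_to_removeI:
  assumes D: "plain_diagram D"
    and "\<And>g \<nu> ws. realised_by D h g \<nu> ws \<Longrightarrow> A \<subseteq> point_arrows D h \<and>
      reidemeister (inflate g ws D) (delete_arrows (\<nu> ` A) (inflate g ws D))"
  shows "leads_to D h (filter (keep_letter A) \<circ> h)"
proof (rule leads_toI)
  fix g \<nu> ws assume R: "realised_by D h g \<nu> ws"
  note * = assms(2)[OF R]
  note ** = realised_by_remove[OF D R conjunct1[OF *]]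
  show "\<exists>g' \<nu>' ws'. realised_by D (filter (keep_letter A) \<circ> h) g' \<nu>' ws' \<and>
      inflate g ws D \<approx> inflate g' ws' D"
    using **(2) conjunct2[OF *] unfolding **(1) by (metis reidemeister r_into_equivclp)
qed

lemma leads_to_R1:
  assumes D: "plain_diagram D" and adj: "adjacent D x y" and m: "meets h x y"
    and xy: "x = Foot a \<and> y = Head a \<or> x = Head a \<and> y = Foot a"
  shows "leads_to D h (filter (keep_letter {a}) \<circ> h)"
proof (rule leads_to_removeI[OF D])
  fix g \<nu> ws assume R: "realised_by D h g \<nu> ws"
  note pts = adjacent_points[OF D R adj m]
  show "{a} \<subseteq> point_arrows D h \<and> reidemeister (inflate g ws D) (delete_arrows (\<nu> ` {a}) (inflate g ws D))"
    using pts xy R1[OF realised_byD(1)[OF R], of "\<nu> a"] by auto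
qed

lemma leads_to_R2:
  assumes D: "plain_diagram D" and sign: "snd a \<noteq> snd b"
    and adj: "adjacent D (Foot a) (Foot b)" and m: "meets h (Foot a) (Foot b)"
    and adj': "adjacent D x y" and m': "meets h x y"
    and xy: "x = Head a \<and> y = Head b \<or> x = Head b \<and> y = Head a"
  shows "leads_to D h (filter (keep_letter {a, b}) \<circ> h)"
proof (rule leads_to_removeI[OF D])
  fix g \<nu> ws assume R: "realised_by D h g \<nu> ws"
  note pts = adjacent_points[OF D R adj m] and pts' = adjacent_points[OF D R adj' m']
  have "snd (\<nu> a) \<noteq> snd (\<nu> b)"
    using sign represents_in_arrows(3)[OF D R] pts(2,3) by simp
  then show "{a, b} \<subseteq> point_arrows D h \<and>
      reidemeister (inflate g ws D) (delete_arrows (\<nu> ` {a, b}) (inflate g ws D))"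
    using pts pts' xy R2[OF realised_byD(1)[OF R], of "\<nu> a" "\<nu> b"] by auto
qed

fun map_letter :: "(endpoint \<Rightarrow> endpoint) \<Rightarrow> letter \<Rightarrow> letter" where
  "map_letter f (Tok s) = Tok s"
| "map_letter f (Pt x) = Pt (f x)"

text \<open>For distinct arrows the three transposed pairs are disjoint. Hence this is an
  involution, which is what later allows re-indexing by it.\<close>

definition r3_swap :: "arrow \<Rightarrow> arrow \<Rightarrow> arrow \<Rightarrow> endpoint \<Rightarrow> endpoint" where
  "r3_swap a b c = Transposition.transpose (Foot a) (Foot b) \<circ>
     Transposition.transpose (Head a) (Foot c) \<circ> Transposition.transpose (Head b) (Head c)"

lemma r3_exchange:
  "exchange (Foot a) (Foot b) (exchange (Head a) (Foot c) (exchange (Head b) (Head c) D)) =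
    map_endpoints (r3_swap a b c) D"
  unfolding exchange_def r3_swap_def
  by (rule ext) (simp add: map_endpoints_def option.map_comp comp_def)

lemma r3_swap_simps:
  assumes "distinct [a, b, c]"
  shows "r3_swap a b c (Foot a) = Foot b" "r3_swap a b c (Foot b) = Foot a"
    "r3_swap a b c (Head a) = Foot c" "r3_swap a b c (Foot c) = Head a"
    "r3_swap a b c (Head b) = Head c" "r3_swap a b c (Head c) = Head b"
    "arrow_of x \<notin> {a, b, c} \<Longrightarrow> r3_swap a b c x = x"
  using assms by (cases x; auto simp: r3_swap_def Transposition.transpose_def)+

lemma arrow_of_cases:
  assumes "arrow_of x \<in> {a, b, c}"
  obtains "x = Foot a" | "x = Head a" | "x = Foot b" | "x = Head b" | "x = Foot c" | "x = Head c"
  using assms by (cases x) auto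

lemma r3_swap_rename:
  assumes "distinct [a, b, c]" and inj: "inj_on \<nu> A" and "{a, b, c} \<subseteq> A" "arrow_of x \<in> A"
  shows "r3_swap (\<nu> a) (\<nu> b) (\<nu> c) (rename_arrow \<nu> x) = rename_arrow \<nu> (r3_swap a b c x)"
proof -
  have dist: "distinct [\<nu> a, \<nu> b, \<nu> c]"
    using assms by (auto dest: inj_onD)
  note simps = r3_swap_simps[OF assms(1)] r3_swap_simps[OF dist]
  show ?thesis
  proof (cases "arrow_of x \<in> {a, b, c}")
    case True
    then show ?thesis
      by (cases rule: arrow_of_cases) (simp_all add: simps)
  next
    case False
    then have "\<nu> (arrow_of x) \<notin> {\<nu> a, \<nu> b, \<nu> c}"
      using assms by (auto dest: inj_onD)
    then have "arrow_of (rename_arrow \<nu> x) \<notin> {\<nu> a, \<nu> b, \<nu> c}"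
      by (cases x) auto
    with False show ?thesis
      by (simp add: simps(7) simps(14))
  qed
qed

lemma arrow_of_r3_swap:
  assumes "distinct [a, b, c]"
  shows "arrow_of (r3_swap a b c x) \<in> {a, b, c, arrow_of x}"
proof (cases "arrow_of x \<in> {a, b, c}")
  case True
  then show ?thesis
    by (cases rule: arrow_of_cases) (simp_all add: r3_swap_simps[OF assms])
qed (simp add: r3_swap_simps[OF assms])

text \<open>The triangle is free of tokens, so the three crossings themselves can move. The blocks
  stay in place and only the points in them are permuted; a weight therefore keeps its position on
  the strand while the crossing next to it changes.\<close>

lemma leads_to_R3:
  assumes D: "plain_diagram D" and dist: "distinct [a, b, c]"
    and adj: "adjacent_in_order p D (Foot a) (Foot b)" "adjacent_in_order q D (Head a) (Foot c)"
      "adjacent_in_order r D (Head b) (Head c)"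
    and signs: "p = q \<longleftrightarrow> snd b = snd c" "p = r \<longleftrightarrow> snd a = snd c"
    and m: "if p then meets h (Foot a) (Foot b) else meets h (Foot b) (Foot a)"
      "if q then meets h (Head a) (Foot c) else meets h (Foot c) (Head a)"
      "if r then meets h (Head b) (Head c) else meets h (Head c) (Head b)"
  shows "leads_to D h (map (map_letter (r3_swap a b c)) \<circ> h)"
proof (rule leads_toI)
  let ?\<tau> = "r3_swap a b c"
  fix g \<nu> ws assume R: "realised_by D h g \<nu> ws"
  let ?Z = "inflate g ws D" and ?\<tau>' = "r3_swap (\<nu> a) (\<nu> b) (\<nu> c)"
  let ?P = "point_arrows D h"
  note wf = realised_byD(1)[OF R] and feet = realised_byD(2)[OF R] and inj = realised_byD(3)[OF R]
  note pts = represents_in_arrows[OF D R]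
  have ordered: "adjacent_in_order s ?Z (rename_arrow \<nu> x) (rename_arrow \<nu> y) \<and>
      arrow_of x \<in> ?P \<and> arrow_of y \<in> ?P"
    if "adjacent_in_order s D x y" "if s then meets h x y else meets h y x" for s x y
    using that adjacent_points[OF D R] by (auto simp: adjacent_in_order_def split: if_splits)
  note adj' = ordered[OF adj(1) m(1)] ordered[OF adj(2) m(2)] ordered[OF adj(3) m(3)]
  have abc: "{a, b, c} \<subseteq> ?P"
    using adj' by auto
  have dist': "distinct [\<nu> a, \<nu> b, \<nu> c]"
    using dist inj abc by (auto dest: inj_onD)
  have "reidemeister ?Z (map_endpoints ?\<tau>' ?Z)"
    unfolding r3_exchange[symmetric]
    using adj' signs abc pts(3) by (intro R3[OF wf dist', of p q r]) auto
  moreover have "map ?\<tau>' ws = ws"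
  proof (rule map_idI)
    fix y assume "y \<in> set ws"
    then obtain t where "y = Foot t" "Foot t \<in> set ws"
      using feet by auto
    moreover from this have "t \<notin> {\<nu> a, \<nu> b, \<nu> c}"
      using pts(2) abc by blast
    ultimately show "?\<tau>' y = y"
      by (simp add: r3_swap_simps(7)[OF dist'])
  qed
  ultimately have eq: "?Z \<approx> inflate (map ?\<tau>' \<circ> g) ws D"
    unfolding map_endpoints_inflate by (metis reidemeister r_into_equivclp)
  have "realised_by D (map (map_letter ?\<tau>) \<circ> h) (map ?\<tau>' \<circ> g) \<nu> ws"
    unfolding realised_by_def
  proof (intro conjI ballI)
    show "wf_diagram (inflate (map ?\<tau>' \<circ> g) ws D)"
      using sw_equiv_wf[OF eq wf] .
    show "set ws \<subseteq> range Foot"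
      using feet .
    have "point_arrows D (map (map_letter ?\<tau>) \<circ> h) \<subseteq> ?P"
    proof
      fix d assume "d \<in> point_arrows D (map (map_letter ?\<tau>) \<circ> h)"
      then obtain x y l where xy: "x \<in> endpoints D" "d = arrow_of y" "l \<in> set (h x)" "Pt y = map_letter ?\<tau> l"
        unfolding point_arrows_def by auto
      then obtain z where z: "l = Pt z" "y = ?\<tau> z"
        by (cases l) auto
      then have "arrow_of z \<in> ?P"
        using xy point_arrowsI by metis
      then show "d \<in> ?P"
        using arrow_of_r3_swap[OF dist, of z] z xy abc by auto
    qed
    then show "inj_on \<nu> (point_arrows D (map (map_letter ?\<tau>) \<circ> h))"
      by (rule inj_on_subset[OF inj])
    fix x assume x: "x \<in> endpoints D"
    have "list_all2 (\<lambda>l y. represents \<nu> (set ws) (map_letter ?\<tau> l) (?\<tau>' y)) (h x) (g x)"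
    proof (rule list.rel_mono_strong[OF realised_byD(4)[OF R x]])
      fix l y assume l: "l \<in> set (h x)" "represents \<nu> (set ws) l y"
      show "represents \<nu> (set ws) (map_letter ?\<tau> l) (?\<tau>' y)"
      proof (cases l)
        case (Tok s)
        with l obtain t where t: "y = Head t" "snd t = s" "Foot t \<in> set ws"
          by auto
        then have "t \<notin> {\<nu> a, \<nu> b, \<nu> c}"
          using pts(2) abc by blast
        then have "?\<tau>' y = y"
          using t by (simp add: r3_swap_simps(7)[OF dist'])
        with Tok t show ?thesis by simp
      next
        case (Pt z)
        then have z: "arrow_of z \<in> ?P"
          using point_arrowsI[of x D z h] x l by simp
        then have "arrow_of (?\<tau> z) \<in> ?P"
          using arrow_of_r3_swap[OF dist, of z] abc by auto
        then show ?thesis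
          using Pt l r3_swap_rename[OF dist inj abc z] pts(2,3) by simp
      qed
    qed
    then show "list_all2 (represents \<nu> (set ws)) ((map (map_letter ?\<tau>) \<circ> h) x) ((map ?\<tau>' \<circ> g) x)"
      by (simp add: list_all2_map1 list_all2_map2)
  qed
  with eq show "\<exists>g' \<nu>' ws'. realised_by D (map (map_letter ?\<tau>) \<circ> h) g' \<nu>' ws' \<and>
      ?Z \<approx> inflate g' ws' D"
    by blast
qed


section \<open>Weights\<close>

text \<open>Free reduction in the free group on one generator, with points as inert separators. The
  exponent of a run of tokens is its weight.\<close>

definition cancels :: "letter list \<Rightarrow> letter list \<Rightarrow> bool" where
  "cancels w w' \<longleftrightarrow> (\<exists>u s v. w = u @ Tok s # Tok (\<not> s) # v \<and> w' = u @ v)"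

abbreviation teq :: "letter list \<Rightarrow> letter list \<Rightarrow> bool" (infix "\<sim>" 50) where
  "w \<sim> w' \<equiv> equivclp cancels w w'"

lemma cancels_context: "cancels w w' \<Longrightarrow> cancels (p @ w @ q) (p @ w' @ q)"
  unfolding cancels_def by (metis append.assoc append_Cons)

lemma teq_context: "w \<sim> w' \<Longrightarrow> p @ w @ q \<sim> p @ w' @ q"
proof (induction rule: equivclp_induct)
  case (step y z)
  then have "cancels (p @ y @ q) (p @ z @ q) \<or> cancels (p @ z @ q) (p @ y @ q)"
    using cancels_context by blast
  with step.IH show ?case
    by (rule equivclp_into_equivclp)
qed simp

lemma leads_to_teq:
  assumes D: "plain_diagram D" and "w \<sim> w'" and "h y = w"
  shows "leads_to D h (h(y := w'))"
proof -
  have "leads_to D (h(y := w)) (h(y := w'))"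
    using assms(2)
  proof (induction rule: equivclp_induct)
    case (step z z')
    then have "leads_to D (h(y := z)) (h(y := z'))"
      unfolding cancels_def using leads_to_cancel[OF D] leads_to_insert[OF D] by metis
    with step.IH show ?case
      by (rule leads_to_trans)
  qed (rule leads_to_refl)
  then show ?thesis
    using assms(3) by (metis fun_upd_triv)
qed

definition tok :: "int \<Rightarrow> letter list" where
  "tok k = replicate (nat \<bar>k\<bar>) (Tok (0 < k))"

definition sg :: "bool \<Rightarrow> int" where
  "sg s = (if s then 1 else -1)"

lemma tok_0 [simp]: "tok 0 = []"
  by (simp add: tok_def)

lemma tok_sg: "tok (sg s) = [Tok s]"
  by (simp add: tok_def sg_def)

lemma tok_minus_sg: "tok (- sg s) = [Tok (\<not> s)]"
  by (simp add: tok_def sg_def)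

lemma sg_Not: "sg (\<not> s) = - sg s"
  by (simp add: sg_def)

lemma tok_int: "tok (sg s * int n) = replicate n (Tok s)"
  by (cases "n = 0") (auto simp: tok_def sg_def)

text \<open>Separating sign from size allows statements about integer weights to be proved one token
  at a time.\<close>

lemma tok_cases:
  obtains s n where "k = sg s * int n"
proof
  show "k = sg (0 < k) * int (nat \<bar>k\<bar>)"
    by (simp add: sg_def)
qed

lemma teq_tok_snoc: "tok k @ [Tok s] \<sim> tok (k + sg s)"
proof -
  obtain s' n where k: "k = sg s' * int n"
    by (rule tok_cases)
  consider "s' = s" | "n = 0" | m where "s' = (\<not> s)" "n = Suc m"
    by (cases n) auto
  then show ?thesis
  proof cases
    case 1
    have "tok (sg s * int (Suc n)) = tok k @ [Tok s]"
      unfolding k tok_int 1 by (simp add: replicate_append_same)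
    moreover have "sg s * int (Suc n) = k + sg s"
      unfolding k 1 by (simp add: algebra_simps)
    ultimately show ?thesis
      by (metis equivclp_refl)
  next
    case 2
    then show ?thesis
      by (simp add: k tok_sg)
  next
    case (3 m)
    have "tok k @ [Tok s] = replicate m (Tok (\<not> s)) @ Tok (\<not> s) # Tok (\<not> \<not> s) # []"
      unfolding k tok_int 3 by (simp flip: replicate_append_same)
    moreover have "tok (k + sg s) = replicate m (Tok (\<not> s)) @ []"
    proof -
      have "k + sg s = sg (\<not> s) * int m"
        unfolding k 3 by (simp add: sg_Not algebra_simps)
      then show ?thesis
        by (simp add: tok_int)
    qed
    ultimately have "cancels (tok k @ [Tok s]) (tok (k + sg s))"
      unfolding cancels_def by blast
    then show ?thesis ..
  qed
qed

lemma teq_tok_add: "tok k @ tok l \<sim> tok (k + l)"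
proof -
  obtain s n where l: "l = sg s * int n"
    by (rule tok_cases)
  have "tok k @ replicate n (Tok s) \<sim> tok (k + sg s * int n)"
  proof (induction n)
    case (Suc n)
    have "tok k @ replicate (Suc n) (Tok s) = [] @ (tok k @ replicate n (Tok s)) @ [Tok s]"
      by (simp add: replicate_append_same)
    also have "\<dots> \<sim> [] @ tok (k + sg s * int n) @ [Tok s]"
      by (rule teq_context[OF Suc])
    also have "\<dots> \<sim> tok (k + sg s * int n + sg s)"
      using teq_tok_snoc by simp
    finally show ?case
      by (simp add: algebra_simps)
  qed simp
  then show ?thesis
    unfolding l tok_int .
qed

lemma teq_tok_add_context: "p @ tok k @ tok l @ q \<sim> p @ tok (k + l) @ q"
  using teq_context[OF teq_tok_add, of p k l q] by simp

text \<open>Blocks belong to endpoints, not to arcs, so the weight of an arc is split into the part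
  \<open>o'\<close> after its first endpoint and the part \<open>i\<close> before its last one. Only
  the sum has a meaning, by \<open>leads_to_move\<close>.\<close>

definition weighted :: "(endpoint \<Rightarrow> int) \<Rightarrow> (endpoint \<Rightarrow> int) \<Rightarrow> endpoint \<Rightarrow> letter list" where
  "weighted i o' x = tok (i x) @ Pt x # tok (o' x)"

definition bump :: "arrow \<Rightarrow> int \<Rightarrow> (endpoint \<Rightarrow> int) \<Rightarrow> endpoint \<Rightarrow> int" where
  "bump a k i = (\<lambda>x. if arrow_of x = a then i x + k else i x)"

text \<open>Before each endpoint of \<open>a\<close> a cancelling pair is created. Its tokens of
  sign \<open>s\<close> join the incoming weights, while the two tokens of the opposite sign pass
  the crossing together and join the outgoing weights.\<close>

lemma leads_to_gauge_unit:
  assumes D: "plain_diagram D" and a: "a \<in> arrows D"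
  shows "leads_to D (weighted i o') (weighted (bump a (sg s) i) (bump a (- sg s) o'))"
proof -
  define before where "before x = tok (i x + sg s) @ Tok (\<not> s) # Pt x # tok (o' x)" for x
  define after where "after x = tok (i x + sg s) @ Pt x # Tok (\<not> s) # tok (o' x)" for x
  define final where "final x = tok (i x + sg s) @ Pt x # tok (o' x - sg s)" for x
  let ?h = "weighted i o'"
  have start: "?h x \<sim> before x" for x
    unfolding before_def weighted_def
    using teq_tok_add_context[of "[]" "i x + sg s" "sg (\<not> s)" "Pt x # tok (o' x)"]
    by (simp add: tok_sg tok_minus_sg sg_Not equivclp_sym del: tok_0)
  have finish: "after x \<sim> final x" for x
    unfolding after_def final_def
    using teq_tok_add_context[of "tok (i x + sg s) @ [Pt x]" "sg (\<not> s)" "o' x" "[]"]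
    by (simp add: tok_sg tok_minus_sg sg_Not algebra_simps)
  let ?b = "?h(Foot a := before (Foot a), Head a := before (Head a))"
  let ?a = "?h(Foot a := after (Foot a), Head a := after (Head a))"
  let ?f = "?h(Foot a := final (Foot a), Head a := final (Head a))"
  have "leads_to D ?h (?h(Foot a := before (Foot a)))"
    by (rule leads_to_teq[OF D start]) simp
  also have "leads_to D (?h(Foot a := before (Foot a))) ?b"
    by (rule leads_to_teq[OF D start]) simp
  also have "leads_to D ?b ?a"
    using leads_to_pass[OF D a, of ?b "tok (i (Foot a) + sg s)" "\<not> s" "tok (o' (Foot a))"
        "tok (i (Head a) + sg s)" "tok (o' (Head a))"]
    by (simp add: before_def after_def fun_upd_twist)
  also have "leads_to D ?a (?a(Foot a := final (Foot a)))"
    by (rule leads_to_teq[OF D finish]) simp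
  also have "leads_to D (?a(Foot a := final (Foot a))) (?a(Foot a := final (Foot a), Head a := final (Head a)))"
    by (rule leads_to_teq[OF D finish]) simp
  also have "?a(Foot a := final (Foot a), Head a := final (Head a)) = ?f"
    by (simp add: fun_upd_twist)
  also have "?f = weighted (bump a (sg s) i) (bump a (- sg s) o')"
  proof
    fix x
    show "?f x = weighted (bump a (sg s) i) (bump a (- sg s) o') x"
      by (cases x) (auto simp: weighted_def bump_def final_def)
  qed
  finally show ?thesis .
qed

lemma leads_to_gauge:
  assumes D: "plain_diagram D" and a: "a \<in> arrows D"
  shows "leads_to D (weighted i o') (weighted (bump a k i) (bump a (- k) o'))"
proof -
  obtain s n where k: "k = sg s * int n"
    by (rule tok_cases)
  have "leads_to D (weighted i o') (weighted (bump a (sg s * int n) i) (bump a (- (sg s * int n)) o'))"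
  proof (induction n)
    case 0
    have "bump a 0 i = i" for i
      by (auto simp: bump_def)
    then show ?case
      by (simp add: leads_to_refl)
  next
    case (Suc n)
    have "bump a (sg s) (bump a (sg s * int n) i) = bump a (sg s * int (Suc n)) i"
      "bump a (- sg s) (bump a (- (sg s * int n)) o') = bump a (- (sg s * int (Suc n))) o'"
      by (auto simp: bump_def fun_eq_iff algebra_simps)
    then show ?case
      using leads_to_trans[OF Suc leads_to_gauge_unit[OF D a, of _ _ s]] by simp
  qed
  then show ?thesis
    unfolding k .
qed

lemma adjacent_neq:
  assumes "wf_diagram D" "adjacent D x y"
  shows "x \<noteq> y"
proof -
  obtain c where "(\<exists>u v. D c = Some (u @ x # y # v)) \<or> (\<exists>u. D c = Some (y # u @ [x]))"
    using assms(2) unfolding adjacent_def adjacent_on_iff by blast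
  then show ?thesis
    using wf_distinct[OF assms(1), of c] by auto
qed

lemma leads_to_move:
  assumes D: "plain_diagram D" and adj: "adjacent D x y"
  shows "leads_to D (weighted i o') (weighted (i(y := i y + k)) (o'(x := o' x - k)))"
proof -
  have xy: "x \<noteq> y"
    using adjacent_neq[OF plain_wf[OF D] adj] .
  let ?h = "weighted i o'"
  define p where "p = tok (i x) @ Pt x # tok (o' x - k)"
  have "?h x \<sim> p @ tok k"
    using teq_tok_add_context[of "tok (i x) @ [Pt x]" "o' x - k" k "[]"]
    by (simp add: weighted_def p_def equivclp_sym)
  then have "leads_to D ?h (?h(x := p @ tok k))"
    by (rule leads_to_teq[OF D]) simp
  also have "leads_to D (?h(x := p @ tok k)) (?h(x := p, y := tok k @ ?h y))"
    using leads_to_shift[OF D adj, of "?h(x := p @ tok k)" p "tok k"] xy by simp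
  also have "leads_to D (?h(x := p, y := tok k @ ?h y))
      (?h(x := p, y := tok (i y + k) @ Pt y # tok (o' y)))"
  proof -
    have "tok k @ ?h y \<sim> tok (i y + k) @ Pt y # tok (o' y)"
      using teq_tok_add_context[of "[]" k "i y" "Pt y # tok (o' y)"]
      by (simp add: weighted_def add.commute)
    from leads_to_teq[OF D this, of "?h(x := p, y := tok k @ ?h y)" y] show ?thesis
      by simp
  qed
  also have "?h(x := p, y := tok (i y + k) @ Pt y # tok (o' y)) =
      weighted (i(y := i y + k)) (o'(x := o' x - k))"
    using xy by (auto simp: weighted_def p_def fun_eq_iff)
  finally show ?thesis .
qed

text \<open>For use after a deletion: once their points are gone, the two blocks form a single run
  of tokens of total weight 0.\<close>

lemma leads_to_cancel_blocks:
  assumes D: "plain_diagram D" and adj: "adjacent D x y" and h: "h x = tok k" "h y = tok (- k)"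
  shows "leads_to D h (h(x := [], y := []))"
proof -
  have "leads_to D h (h(x := [], y := tok k @ h y))"
    using leads_to_shift[OF D adj, of h "[]" "tok k"] h by simp
  also have "leads_to D (h(x := [], y := tok k @ h y)) (h(x := [], y := []))"
  proof -
    have "tok k @ h y \<sim> []"
      using teq_tok_add[of k "- k"] h by simp
    from leads_to_teq[OF D this, of "h(x := [], y := tok k @ h y)" y] show ?thesis
      by simp
  qed
  finally show ?thesis .
qed

lemma meets_weighted: "o' x = 0 \<Longrightarrow> i y = 0 \<Longrightarrow> meets (weighted i o') x y"
  by (simp add: meets_def weighted_def)

lemma keep_tok [simp]: "filter (keep_letter A) (tok k) = tok k"
  by (simp add: tok_def filter_replicate)

lemma keep_weighted:
  "filter (keep_letter A) (weighted i o' x) =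
    (if arrow_of x \<in> A then tok (i x) @ tok (o' x) else weighted i o' x)"
  by (simp add: weighted_def)


section \<open>Invariance of the Zh-construction\<close>

lemma realises_delete:
  assumes "realises D (\<lambda>x. if arrow_of x \<in> A then [] else h x) Z"
  shows "realises (delete_arrows A D) h Z"
proof -
  let ?h = "\<lambda>x. if arrow_of x \<in> A then [] else h x"
  obtain g \<nu> ws where R: "realised_by D ?h g \<nu> ws" and Z: "Z = inflate g ws D"
    using assms unfolding realises_def by blast
  have mem: "x \<in> Foot ` A \<or> x \<in> Head ` A \<longleftrightarrow> arrow_of x \<in> A" for x
    by (cases x) auto
  have E: "endpoints (delete_arrows A D) = {x \<in> endpoints D. arrow_of x \<notin> A}"
    using mem unfolding endpoints_delete_arrows by blast
  have "g x = []" if "x \<in> endpoints D" "arrow_of x \<in> A" for x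
    using realised_byD(4)[OF R that(1)] that(2) by simp
  then have eq: "inflate g ws (delete_arrows A D) = inflate g ws D"
    unfolding inflate_delete_arrows using mem by (intro inflate_cong) auto
  have "realised_by (delete_arrows A D) h g \<nu> ws"
    unfolding realised_by_def eq
  proof (intro conjI ballI)
    show "wf_diagram (inflate g ws D)" "set ws \<subseteq> range Foot"
      using realised_byD(1,2)[OF R] .
    have "point_arrows (delete_arrows A D) h \<subseteq> point_arrows D ?h"
      unfolding point_arrows_def E by auto
    then show "inj_on \<nu> (point_arrows (delete_arrows A D) h)"
      by (rule inj_on_subset[OF realised_byD(3)[OF R]])
    show "list_all2 (represents \<nu> (set ws)) (h x) (g x)" if "x \<in> endpoints (delete_arrows A D)" for x
      using realised_byD(4)[OF R, of x] that unfolding E by simp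
  qed
  then show ?thesis
    unfolding realises_def Z eq[symmetric] by blast
qed

lemma realised_by_map_endpoints:
  "realised_by (map_endpoints f D) h g \<nu> ws \<longleftrightarrow> realised_by D (h \<circ> f) (g \<circ> f) \<nu> ws"
  by (simp add: realised_by_def inflate_map_endpoints endpoints_map_endpoints point_arrows_def)

text \<open>Inflating \<open>map_endpoints f D\<close> by \<open>g\<close> is inflating
  \<open>D\<close> by \<open>g \<circ> f\<close>. As \<open>f\<close> is an involution, the given
  blocks can be re-indexed without changing the diagram.\<close>

lemma realises_map_endpoints:
  assumes R: "realises D (h \<circ> f) Z" and inv: "\<And>x. f (f x) = x"
  shows "realises (map_endpoints f D) h Z"
proof -
  obtain g \<nu> ws where R: "realised_by D (h \<circ> f) g \<nu> ws" and Z: "Z = inflate g ws D"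
    using R unfolding realises_def by blast
  have g: "(g \<circ> f) \<circ> f = g"
    by (simp add: fun_eq_iff inv)
  then have "realised_by (map_endpoints f D) h (g \<circ> f) \<nu> ws"
    using R by (simp add: realised_by_map_endpoints)
  moreover have "Z = inflate (g \<circ> f) ws (map_endpoints f D)"
    unfolding Z inflate_map_endpoints g ..
  ultimately show ?thesis
    unfolding realises_def by blast
qed

section \<open>The Zh-construction in terms of letters\<close>

definition zh_before :: "endpoint \<Rightarrow> int" where
  "zh_before x = (case x of Foot a \<Rightarrow> - sg (snd a) | Head a \<Rightarrow> 0)"

definition zh_after :: "endpoint \<Rightarrow> int" where
  "zh_after x = (case x of Foot a \<Rightarrow> 0 | Head a \<Rightarrow> sg (snd a))"

abbreviation zh_letters :: "endpoint \<Rightarrow> letter list" where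
  "zh_letters \<equiv> weighted zh_before zh_after"

definition triple :: "arrow \<Rightarrow> arrow" where
  "triple a = (3 * fst a, snd a)"

lemma inj_triple: "inj triple"
  by (rule injI) (simp add: triple_def prod_eq_iff)

lemma zh_diagram_iff:
  "zh_diagram D Z \<longleftrightarrow> (\<exists>ws. distinct ws \<and> set ws = omega_feet D \<and> Z = inflate zh_endpoint ws D)"
proof -
  have "zh_word = (\<lambda>w. concat (map zh_endpoint w))"
    by (simp add: fun_eq_iff zh_word_def)
  then show ?thesis
    unfolding zh_diagram_def inflate_def by simp
qed

lemma Foot_omega_feet:
  assumes "wf_diagram D"
  shows "Foot b \<in> omega_feet D \<longleftrightarrow>
    (\<exists>n e. Foot (n, e) \<in> endpoints D \<and> (b = (3 * n + 1, \<not> e) \<or> b = (3 * n + 2, e)))"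
  unfolding omega_feet_def by (auto simp: Bex_def wf_arrows(1)[OF assms])

lemma wf_inflate_zh:
  assumes D: "plain_diagram D" and ws: "distinct ws" "set ws = omega_feet D"
  shows "wf_diagram (inflate zh_endpoint ws D)"
proof (rule wf_inflateI[OF D ws(1)])
  note wf = plain_wf[OF D]
  show "distinct (zh_endpoint x)" for x
    by (rule distinct_zh_endpoint)
  show "x = y" if "z \<in> set (zh_endpoint x)" "z \<in> set (zh_endpoint y)" for x y z
    using zh_endpoint_disjoint that by blast
  show "z \<notin> set ws" if "z \<in> set (zh_endpoint x)" for x z
    using zh_endpoint_omega_feet[of x D] that ws(2) by blast
  fix b
  have F: "Foot b \<in> set (zh_endpoint x) \<longleftrightarrow> (\<exists>n e. x = Foot (n, e) \<and> b = (3 * n, e))" for x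
    by (cases x rule: zh_endpoint.cases) simp_all
  have H: "Head b \<in> set (zh_endpoint x) \<longleftrightarrow>
      (\<exists>n e. x = Foot (n, e) \<and> b = (3 * n + 1, \<not> e) \<or>
             x = Head (n, e) \<and> (b = (3 * n, e) \<or> b = (3 * n + 2, e)))" for x
    by (cases x rule: zh_endpoint.cases) simp_all
  have "Head b \<notin> omega_feet D"
    by (auto simp: omega_feet_def)
  then show "Foot b \<in> set ws \<union> (\<Union>x\<in>endpoints D. set (zh_endpoint x)) \<longleftrightarrow>
      Head b \<in> set ws \<union> (\<Union>x\<in>endpoints D. set (zh_endpoint x))"
    unfolding ws(2) Un_iff UN_iff F H Foot_omega_feet[OF wf] wf_balanced[OF wf, symmetric]
    using wf_balanced[OF wf] by blast
qed

lemma realised_by_zh: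
  assumes D: "plain_diagram D" and ws: "distinct ws" "set ws = omega_feet D"
  shows "realised_by D zh_letters zh_endpoint triple ws"
  unfolding realised_by_def
proof (intro conjI ballI)
  note wf = plain_wf[OF D]
  show "wf_diagram (inflate zh_endpoint ws D)"
    using wf_inflate_zh[OF D ws] .
  show "set ws \<subseteq> range Foot"
    unfolding ws(2) by (auto simp: omega_feet_def)
  show "inj_on triple (point_arrows D zh_letters)"
    using inj_triple subset_UNIV by (rule inj_on_subset)
  fix x assume x: "x \<in> endpoints D"
  \<comment> \<open>Residues modulo 3 tell the old arrows, with residue 0, from the new
    ones.\<close>
  have no: "Foot (3 * n, e) \<notin> set ws" for n e
    unfolding ws(2) Foot_omega_feet[OF wf] by (auto; presburger)
  obtain n e where ne: "x = Foot (n, e) \<or> x = Head (n, e)"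
    by (cases x rule: zh_endpoint.cases) auto
  then have "Foot (n, e) \<in> endpoints D"
    using x wf_balanced[OF wf] by auto
  then have "Foot (3 * n + 1, \<not> e) \<in> set ws" "Foot (3 * n + 2, e) \<in> set ws"
    unfolding ws(2) Foot_omega_feet[OF wf] by blast+
  then show "list_all2 (represents triple (set ws)) (zh_letters x) (zh_endpoint x)"
    using ne no by (auto simp: weighted_def zh_before_def zh_after_def tok_sg tok_minus_sg triple_def)
qed

lemma realises_zh:
  assumes "plain_diagram D" "zh_diagram D Z"
  shows "realises D zh_letters Z"
  using assms realised_by_zh unfolding zh_diagram_iff realises_def by blast

lemma zh_diagram_wf_dom:
  assumes "plain_diagram D" "zh_diagram D Z"
  shows "wf_diagram Z" "dom Z = insert (Omega, 0) (dom D)"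
proof -
  obtain ws where "distinct ws" "set ws = omega_feet D" "Z = inflate zh_endpoint ws D"
    using assms(2) unfolding zh_diagram_iff by blast
  then show "wf_diagram Z" "dom Z = insert (Omega, 0) (dom D)"
    using wf_inflate_zh[OF assms(1)] by (simp_all add: dom_inflate)
qed

lemma zh_unique: "plain_diagram D \<Longrightarrow> zh_diagram D Z \<Longrightarrow> zh_diagram D Z' \<Longrightarrow> Z \<approx> Z'"
  using realises_unique realises_zh by blast

text \<open>Common pattern of the invariance proofs: simplify the letters over \<open>D\<close>,
  re-index to \<open>D'\<close>, and restore the letters of Zh there. After \<open>R1\<close> and
  \<open>R2\<close> nothing has to be restored.\<close>

lemma zh_via:
  assumes D: "plain_diagram D" and D': "plain_diagram D'" and Z: "zh_diagram D Z" "zh_diagram D' Z'"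
    and lead: "leads_to D zh_letters h" and D'h: "\<And>X. realises D h X \<Longrightarrow> realises D' h' X"
    and lead': "leads_to D' h' zh_letters"
  shows "Z \<approx> Z'"
proof -
  obtain X where X: "realises D h X" "Z \<approx> X"
    using lead realises_zh[OF D Z(1)] unfolding leads_to_def by blast
  obtain Y where Y: "realises D' zh_letters Y" "X \<approx> Y"
    using lead' D'h[OF X(1)] unfolding leads_to_def by blast
  have "Y \<approx> Z'"
    using realises_unique[OF D' Y(1) realises_zh[OF D' Z(2)]] .
  then show ?thesis
    using X(2) Y(2) equivclp_trans by metis
qed

section \<open>Invariance under each Reidemeister move\<close>

lemma adjacent_map_endpoints:
  assumes "adjacent D x y"
  shows "adjacent (map_endpoints f D) (f x) (f y)"
proof -
  obtain c w n u where "D c = Some w" "rotate n w = x # y # u"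
    using assms unfolding adjacent_def adjacent_on_def by blast
  then have "map_endpoints f D c = Some (map f w)" "rotate n (map f w) = f x # f y # map f u"
    by (simp_all add: map_endpoints_def rotate_map)
  then show ?thesis
    unfolding adjacent_def adjacent_on_def by blast
qed

lemma omega_feet_cong: "arrows D = arrows D' \<Longrightarrow> omega_feet D = omega_feet D'"
  by (simp add: omega_feet_def)

text \<open>Inflation turns the two halves of the word into two halves of the inflated word, so the
  move lifts to a move of the same kind. The arrows are unchanged, and the same list on omega serves
  both diagrams.\<close>

lemma zh_base_point:
  assumes D: "plain_diagram D" and c: "D c = Some (u @ v)"
    and Z: "zh_diagram D Z" "zh_diagram (D(c \<mapsto> v @ u)) Z'"
  shows "Z \<approx> Z'"
proof -
  let ?D' = "D(c \<mapsto> v @ u)"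
  have D': "plain_diagram ?D'"
    using reidemeister_plain[OF base_point[OF plain_wf[OF D] c]] D by blast
  obtain ws where ws: "distinct ws" "set ws = omega_feet D" and Zeq: "Z = inflate zh_endpoint ws D"
    using Z(1) unfolding zh_diagram_iff by blast
  have "c \<noteq> (Omega, 0)"
    using plain_Omega[OF D] c by auto
  then have eq: "inflate zh_endpoint ws ?D' =
      Z(c \<mapsto> concat (map zh_endpoint v) @ concat (map zh_endpoint u))"
    unfolding Zeq inflate_def by (auto simp: fun_eq_iff)
  have "Z c = Some (concat (map zh_endpoint u) @ concat (map zh_endpoint v))"
    unfolding Zeq inflate_circle[OF D c] by simp
  then have 1: "Z \<approx> inflate zh_endpoint ws ?D'"
    unfolding eq using zh_diagram_wf_dom(1)[OF D Z(1)] base_point reidemeister r_into_equivclp by metis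
  have "omega_feet ?D' = omega_feet D"
    using endpoints_base_point[of D c u v, OF c] by (intro omega_feet_cong) (simp add: arrows_def)
  then have "zh_diagram ?D' (inflate zh_endpoint ws ?D')"
    unfolding zh_diagram_iff using ws by blast
  from zh_unique[OF D' this Z(2)] 1 show ?thesis
    by (metis equivclp_trans)
qed

text \<open>Indexed by \<open>D\<close>, the Zh diagram of the renamed diagram realises the same
  letters with point names \<open>triple \<circ> f\<close>. The different names of the tokens are
  absorbed by uniqueness.\<close>

lemma zh_rename:
  assumes D: "plain_diagram D" and inj: "inj_on f (arrows D)" and sign: "\<And>a. snd (f a) = snd a"
    and Z: "zh_diagram D Z" "zh_diagram (map_endpoints (rename_arrow f) D) Z'"
  shows "Z \<approx> Z'"
proof -
  let ?D' = "map_endpoints (rename_arrow f) D"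
  have D': "plain_diagram ?D'"
    using reidemeister_plain[OF rename[OF plain_wf[OF D] inj sign]] D by blast
  obtain ws where ws: "distinct ws" "set ws = omega_feet ?D'" and Zeq: "Z' = inflate zh_endpoint ws ?D'"
    using Z(2) unfolding zh_diagram_iff by blast
  have R: "realised_by D (zh_letters \<circ> rename_arrow f) (zh_endpoint \<circ> rename_arrow f) triple ws"
    using realised_by_zh[OF D' ws] unfolding realised_by_map_endpoints .
  have "realised_by D zh_letters (zh_endpoint \<circ> rename_arrow f) (triple \<circ> f) ws"
    unfolding realised_by_def
  proof (intro conjI ballI)
    show "wf_diagram (inflate (zh_endpoint \<circ> rename_arrow f) ws D)" "set ws \<subseteq> range Foot"
      using realised_byD(1,2)[OF R] .
    have "point_arrows D zh_letters \<subseteq> arrows D"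
    proof
      fix a assume "a \<in> point_arrows D zh_letters"
      then obtain x where "x \<in> endpoints D" "a = arrow_of x"
        unfolding point_arrows_def weighted_def tok_def by auto
      then show "a \<in> arrows D"
        by (cases x) (auto simp: arrows_def)
    qed
    then have "inj_on f (point_arrows D zh_letters)"
      using inj by (rule inj_on_subset[rotated])
    then show "inj_on (triple \<circ> f) (point_arrows D zh_letters)"
      using inj_on_subset[OF inj_triple subset_UNIV] by (rule comp_inj_on)
    fix x assume x: "x \<in> endpoints D"
    have "list_all2 (represents triple (set ws)) (zh_letters (rename_arrow f x)) (zh_endpoint (rename_arrow f x))"
      using realised_byD(4)[OF R x] by simp
    then show "list_all2 (represents (triple \<circ> f) (set ws)) (zh_letters x) ((zh_endpoint \<circ> rename_arrow f) x)"
      using sign by (cases x)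
        (auto simp: weighted_def zh_before_def zh_after_def tok_sg tok_minus_sg list_all2_Cons1)
  qed
  then have "realises D zh_letters Z'"
    unfolding realises_def Zeq inflate_map_endpoints by blast
  then show ?thesis
    using realises_unique[OF D realises_zh[OF D Z(1)]] by blast
qed

lemma zh_R1:
  assumes D: "plain_diagram D" and adj: "adjacent D x y"
    and xy: "x = Foot a \<and> y = Head a \<or> x = Head a \<and> y = Foot a"
    and Z: "zh_diagram D Z" "zh_diagram (delete_arrows {a} D) Z'"
  shows "Z \<approx> Z'"
proof -
  have D': "plain_diagram (delete_arrows {a} D)"
    using D wf_delete_arrows by (simp add: plain_diagram_def)
  define i where "i = zh_before(y := zh_before y + zh_after x)"
  \<comment> \<open>Written as a difference, although it is 0, to match the form of
    \<open>leads_to_move\<close>.\<close>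
  define t where "t = zh_after(x := zh_after x - zh_after x)"
  let ?h = "filter (keep_letter {a}) \<circ> weighted i t"
  have zero: "t x = 0" "i y = 0" and opposite: "t y = - i x"
    using xy by (auto simp: i_def t_def zh_before_def zh_after_def)
  have "leads_to D zh_letters (weighted i t)"
    unfolding i_def t_def by (rule leads_to_move[OF D adj])
  also have "leads_to D (weighted i t) ?h"
    by (rule leads_to_R1[OF D adj meets_weighted[of t x i y, OF zero] xy])
  also have "leads_to D ?h (?h(x := [], y := []))"
    by (rule leads_to_cancel_blocks[OF D adj, of _ "i x"])
      (use xy zero opposite in \<open>auto simp: keep_weighted\<close>)
  also have "?h(x := [], y := []) = (\<lambda>z. if arrow_of z \<in> {a} then [] else zh_letters z)"
  proof
    fix z
    show "(?h(x := [], y := [])) z = (if arrow_of z \<in> {a} then [] else zh_letters z)"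
      using xy by (cases z) (auto simp: keep_weighted weighted_def i_def t_def)
  qed
  finally show ?thesis
    by (rule zh_via[OF D D' Z _ realises_delete leads_to_refl])
qed

text \<open>The arc from \<open>Foot a\<close> to \<open>Foot b\<close> has weight
  \<open>- sg (snd b)\<close>, which equals \<open>sg (snd a)\<close>; gauging \<open>a\<close> by
  this amount clears it. The same gauge clears the arc between the heads, whose weight is
  \<open>sg (snd a)\<close> when it runs from \<open>a\<close> to \<open>b\<close> and
  \<open>sg (snd b)\<close> when it runs back.\<close>

lemma zh_R2:
  assumes D: "plain_diagram D" and sign: "snd a \<noteq> snd b"
    and adj: "adjacent D (Foot a) (Foot b)" and adj': "adjacent D x y"
    and xy: "x = Head a \<and> y = Head b \<or> x = Head b \<and> y = Head a"
    and Z: "zh_diagram D Z" "zh_diagram (delete_arrows {a, b} D) Z'"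
  shows "Z \<approx> Z'"
proof -
  have D': "plain_diagram (delete_arrows {a, b} D)"
    using D wf_delete_arrows by (simp add: plain_diagram_def)
  have a: "a \<in> arrows D"
    using adjacent_endpoints(1)[OF adj] by (simp add: arrows_def)
  have "a \<noteq> b"
    using sign by auto
  have sgb: "sg (snd b) = - sg (snd a)"
    using sign by (auto simp: sg_def)
  define e where "e = sg (snd a)"
  define i1 where "i1 = bump a e zh_before"
  define t1 where "t1 = bump a (- e) zh_after"
  define i2 where "i2 = i1(Foot b := i1 (Foot b) + t1 (Foot a))"
  define t2 where "t2 = t1(Foot a := t1 (Foot a) - t1 (Foot a))"
  define i where "i = i2(y := i2 y + t2 x)"
  define t where "t = t2(x := t2 x - t2 x)"
  let ?h = "filter (keep_letter {a, b}) \<circ> weighted i t"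
  note defs = i_def t_def i2_def t2_def i1_def t1_def bump_def zh_before_def zh_after_def e_def
  have zero: "t (Foot a) = 0" "i (Foot b) = 0" "t x = 0" "i y = 0"
    and opposite: "t (Foot b) = - i (Foot a)" "t y = - i x"
    using xy \<open>a \<noteq> b\<close> sgb by (auto simp: defs)
  have "leads_to D zh_letters (weighted i1 t1)"
    unfolding i1_def t1_def by (rule leads_to_gauge[OF D a])
  also have "leads_to D (weighted i1 t1) (weighted i2 t2)"
    unfolding i2_def t2_def by (rule leads_to_move[OF D adj])
  also have "leads_to D (weighted i2 t2) (weighted i t)"
    unfolding i_def t_def by (rule leads_to_move[OF D adj'])
  also have "leads_to D (weighted i t) ?h"
    by (rule leads_to_R2[OF D sign adj meets_weighted[of t _ i, OF zero(1,2)] adj'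
        meets_weighted[of t x i y, OF zero(3,4)] xy])
  also have "leads_to D ?h (?h(Foot a := [], Foot b := []))"
    by (rule leads_to_cancel_blocks[OF D adj, of _ "i (Foot a)"])
      (use zero opposite in \<open>auto simp: keep_weighted\<close>)
  also have "leads_to D (?h(Foot a := [], Foot b := [])) (?h(Foot a := [], Foot b := [], x := [], y := []))"
    by (rule leads_to_cancel_blocks[OF D adj', of _ "i x"])
      (use xy zero opposite in \<open>auto simp: keep_weighted\<close>)
  also have "?h(Foot a := [], Foot b := [], x := [], y := []) =
      (\<lambda>z. if arrow_of z \<in> {a, b} then [] else zh_letters z)"
  proof
    fix z
    show "(?h(Foot a := [], Foot b := [], x := [], y := [])) z =
        (if arrow_of z \<in> {a, b} then [] else zh_letters z)"
      using xy by (cases z) (auto simp: keep_weighted weighted_def i_def t_def i2_def t2_def i1_def t1_def bump_def)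
  qed
  finally show ?thesis
    by (rule zh_via[OF D D' Z _ realises_delete leads_to_refl])
qed

text \<open>Each pair of the three crossings is joined by one inner arc. A common shift of all
  gauges does not affect these arcs, which is why \<open>a\<close> may get gauge 0 before the move;
  two arcs then determine \<open>gb\<close> and \<open>gc\<close>, and the third is cleared thanks
  to the sign conditions. After the move there is no such freedom, because the outer weights are
  already fixed.\<close>

lemma zh_R3:
  assumes D: "plain_diagram D" and dist: "distinct [a, b, c]"
    and adj: "adjacent_in_order p D (Foot a) (Foot b)" "adjacent_in_order q D (Head a) (Foot c)"
      "adjacent_in_order r D (Head b) (Head c)"
    and signs: "p = q \<longleftrightarrow> snd b = snd c" "p = r \<longleftrightarrow> snd a = snd c"
    and Z: "zh_diagram D Z" "zh_diagram (map_endpoints (r3_swap a b c) D) Z'"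
  shows "Z \<approx> Z'"
proof -
  let ?\<tau> = "r3_swap a b c"
  let ?D' = "map_endpoints ?\<tau> D"
  have "reidemeister D ?D'"
    using R3[OF plain_wf[OF D] dist adj signs] unfolding r3_exchange .
  then have D': "plain_diagram ?D'"
    using D reidemeister_plain by blast
  have arr: "a \<in> arrows D" "b \<in> arrows D" "c \<in> arrows D"
    using adj(1,3)[THEN adjacent_in_order_endpoints(1)] adj(3)[THEN adjacent_in_order_endpoints(2)]
    by (simp_all add: arrows_def)
  have \<tau>2: "?\<tau> (?\<tau> x) = x" for x
  proof (cases "arrow_of x \<in> {a, b, c}")
    case True
    then show ?thesis
      by (cases rule: arrow_of_cases) (simp_all add: r3_swap_simps[OF dist])
  qed (simp add: r3_swap_simps[OF dist])
  have arr': "a \<in> arrows ?D'" "b \<in> arrows ?D'" "c \<in> arrows ?D'"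
  proof -
    have "Foot a = ?\<tau> (Foot b)" "Foot b = ?\<tau> (Foot a)" "Head c = ?\<tau> (Head b)"
      by (simp_all add: r3_swap_simps[OF dist])
    then show "a \<in> arrows ?D'" "b \<in> arrows ?D'" "c \<in> arrows ?D'"
      using arr wf_arrows[OF plain_wf[OF D]]
      unfolding arrows_def endpoints_map_endpoints by blast+
  qed
  define A where "A = sg (snd a)"
  define B where "B = sg (snd b)"
  define C where "C = sg (snd c)"
  \<comment> \<open>On the top, middle and bottom strand the endpoint \<open>x\<close> comes before
    \<open>y\<close> prior to the move and after it afterwards. This keeps \<open>p\<close>,
    \<open>q\<close>, \<open>r\<close> out of the token computation.\<close>
  define x1 where "x1 = (if p then Foot a else Foot b)"
  define y1 where "y1 = (if p then Foot b else Foot a)"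
  define x2 where "x2 = (if q then Head a else Foot c)"
  define y2 where "y2 = (if q then Foot c else Head a)"
  define x3 where "x3 = (if r then Head b else Head c)"
  define y3 where "y3 = (if r then Head c else Head b)"
  note ends = x1_def y1_def x2_def y2_def x3_def y3_def
  have adjD: "adjacent D x1 y1" "adjacent D x2 y2" "adjacent D x3 y3"
    using adj by (auto simp: adjacent_in_order_def ends)
  have \<tau>_ends: "?\<tau> x1 = y1" "?\<tau> y1 = x1" "?\<tau> x2 = y2" "?\<tau> y2 = x2" "?\<tau> x3 = y3" "?\<tau> y3 = x3"
    by (simp_all add: ends r3_swap_simps[OF dist])
  have adjD': "adjacent ?D' y1 x1" "adjacent ?D' y2 x2" "adjacent ?D' y3 x3"
    using adjD[THEN adjacent_map_endpoints[of D _ _ ?\<tau>]] unfolding \<tau>_ends .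

  txt \<open>The gauges \<open>0\<close>, \<open>gb\<close>, \<open>gc\<close> of \<open>a\<close>, \<open>b\<close>, \<open>c\<close> before the move and \<open>ha\<close>, \<open>hb\<close>, \<open>hc\<close> after it
    solve the linear system saying that the three arcs inside the triangle have weight \<open>0\<close> on both
    sides and that the weights of the six outer arcs agree.\<close>
  define gb where "gb = (if p then B else - A)"
  define gc where "gc = (if q then C - A else 0)"
  define i1 where "i1 = bump c gc (bump b gb zh_before)"
  define t1 where "t1 = bump c (- gc) (bump b (- gb) zh_after)"
  define i where "i = i1(y1 := i1 y1 + t1 x1, y2 := i1 y2 + t1 x2, y3 := i1 y3 + t1 x3)"
  define t where "t = t1(x1 := t1 x1 - t1 x1, x2 := t1 x2 - t1 x2, x3 := t1 x3 - t1 x3)"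

  define ha where "ha = (if p then B else - B)"
  define hb where "hb = (if p then B - A else 0)"
  define hc where "hc = (if q then C else - A)"
  \<comment> \<open>On the new side the path leads from the cleared triangle back to Zh, so the
    gauges enter with a minus sign. The double negations are those of
    \<open>leads_to_gauge\<close>.\<close>
  define i2 where "i2 = bump c (- hc) (bump b (- hb) (bump a (- ha) (i \<circ> ?\<tau>)))"
  define t2 where "t2 = bump c (- (- hc)) (bump b (- (- hb)) (bump a (- (- ha)) (t \<circ> ?\<tau>)))"
  \<comment> \<open>The surplus behind \<open>y\<close> compared with Zh. Sliding it along the inner
    arc to the following endpoint restores the prescribed split of the weight.\<close>
  let ?k = "\<lambda>y. t2 y - zh_after y"
  define i' where "i' = i2(x1 := i2 x1 + ?k y1, x2 := i2 x2 + ?k y2, x3 := i2 x3 + ?k y3)"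
  define t' where "t' = t2(y1 := t2 y1 - ?k y1, y2 := t2 y2 - ?k y2, y3 := t2 y3 - ?k y3)"

  have neq: "a \<noteq> b" "a \<noteq> c" "b \<noteq> c" "b \<noteq> a" "c \<noteq> a" "c \<noteq> b"
    using dist by auto
  have dist_ends: "distinct [x1, x2, x3, y1, y2, y3]"
    using neq by (auto simp: ends)
  have sep: "y2 \<noteq> y1" "y3 \<noteq> y1" "y3 \<noteq> y2" "x2 \<noteq> x1" "x3 \<noteq> x1" "x3 \<noteq> x2"
    using dist_ends by auto
  \<comment> \<open>The two sign conditions express all signs by that of \<open>c\<close> and the
    orders. This is what makes the overdetermined linear systems consistent.\<close>
  have BC: "B = (if p = q then C else - C)" and AC: "A = (if p = r then C else - C)"
    using signs by (auto simp: A_def B_def C_def sg_def)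
  have vals1: "i1 (Foot a) = - A" "i1 (Head a) = 0" "i1 (Foot b) = gb - B" "i1 (Head b) = gb"
    "i1 (Foot c) = gc - C" "i1 (Head c) = gc"
    "t1 (Foot a) = 0" "t1 (Head a) = A" "t1 (Foot b) = - gb" "t1 (Head b) = B - gb"
    "t1 (Foot c) = - gc" "t1 (Head c) = C - gc"
    using neq by (simp_all add: i1_def t1_def bump_def zh_before_def zh_after_def A_def B_def C_def)
  have zero: "t x1 = 0" "i y1 = 0" "t x2 = 0" "i y2 = 0" "t x3 = 0" "i y3 = 0"
    using dist_ends BC AC
    by (auto simp: i_def t_def) (auto simp: ends vals1 gb_def gc_def split: if_splits)

  have "leads_to D zh_letters (weighted (bump b gb zh_before) (bump b (- gb) zh_after))"
    by (rule leads_to_gauge[OF D arr(2)])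
  also have "leads_to D (weighted (bump b gb zh_before) (bump b (- gb) zh_after)) (weighted i1 t1)"
    unfolding i1_def t1_def by (rule leads_to_gauge[OF D arr(3)])
  also have "leads_to D (weighted i1 t1) (weighted (i1(y1 := i1 y1 + t1 x1)) (t1(x1 := t1 x1 - t1 x1)))"
    by (rule leads_to_move[OF D adjD(1)])
  also have "leads_to D \<dots> (weighted (i1(y1 := i1 y1 + t1 x1, y2 := i1 y2 + t1 x2))
      (t1(x1 := t1 x1 - t1 x1, x2 := t1 x2 - t1 x2)))"
    using leads_to_move[OF D adjD(2), of "i1(y1 := i1 y1 + t1 x1)" "t1(x1 := t1 x1 - t1 x1)" "t1 x2"]
      sep by (simp del: diff_self)
  also have "leads_to D \<dots> (weighted i t)"
    using leads_to_move[OF D adjD(3), of "i1(y1 := i1 y1 + t1 x1, y2 := i1 y2 + t1 x2)"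
        "t1(x1 := t1 x1 - t1 x1, x2 := t1 x2 - t1 x2)" "t1 x3"]
      sep unfolding i_def t_def by (simp del: diff_self)
  also have "leads_to D (weighted i t) (map (map_letter ?\<tau>) \<circ> weighted i t)"
  proof (rule leads_to_R3[OF D dist adj signs])
    note m = meets_weighted[of t x1 i y1, OF zero(1,2)] meets_weighted[of t x2 i y2, OF zero(3,4)]
      meets_weighted[of t x3 i y3, OF zero(5,6)]
    show "if p then meets (weighted i t) (Foot a) (Foot b) else meets (weighted i t) (Foot b) (Foot a)"
      "if q then meets (weighted i t) (Head a) (Foot c) else meets (weighted i t) (Foot c) (Head a)"
      "if r then meets (weighted i t) (Head b) (Head c) else meets (weighted i t) (Head c) (Head b)"
      using m by (auto simp: ends split: if_splits)
  qed
  also have "map (map_letter ?\<tau>) \<circ> weighted i t = weighted (i \<circ> ?\<tau>) (t \<circ> ?\<tau>) \<circ> ?\<tau>"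
    by (simp add: fun_eq_iff weighted_def tok_def \<tau>2)
  finally have lead: "leads_to D zh_letters (weighted (i \<circ> ?\<tau>) (t \<circ> ?\<tau>) \<circ> ?\<tau>)" .

  have "leads_to ?D' (weighted (i \<circ> ?\<tau>) (t \<circ> ?\<tau>))
      (weighted (bump a (- ha) (i \<circ> ?\<tau>)) (bump a (- (- ha)) (t \<circ> ?\<tau>)))"
    by (rule leads_to_gauge[OF D' arr'(1)])
  also have "leads_to ?D' \<dots> (weighted (bump b (- hb) (bump a (- ha) (i \<circ> ?\<tau>)))
      (bump b (- (- hb)) (bump a (- (- ha)) (t \<circ> ?\<tau>))))"
    by (rule leads_to_gauge[OF D' arr'(2)])
  also have "leads_to ?D' \<dots> (weighted i2 t2)"
    unfolding i2_def t2_def by (rule leads_to_gauge[OF D' arr'(3)])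
  also have "leads_to ?D' (weighted i2 t2) (weighted (i2(x1 := i2 x1 + ?k y1)) (t2(y1 := t2 y1 - ?k y1)))"
    by (rule leads_to_move[OF D' adjD'(1)])
  also have "leads_to ?D' \<dots> (weighted (i2(x1 := i2 x1 + ?k y1, x2 := i2 x2 + ?k y2))
      (t2(y1 := t2 y1 - ?k y1, y2 := t2 y2 - ?k y2)))"
    using leads_to_move[OF D' adjD'(2), of "i2(x1 := i2 x1 + ?k y1)" "t2(y1 := t2 y1 - ?k y1)" "?k y2"]
      sep by (simp del: diff_diff_eq2)
  also have "leads_to ?D' \<dots> (weighted i' t')"
    using leads_to_move[OF D' adjD'(3), of "i2(x1 := i2 x1 + ?k y1, x2 := i2 x2 + ?k y2)"
        "t2(y1 := t2 y1 - ?k y1, y2 := t2 y2 - ?k y2)" "?k y3"]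
      sep unfolding i'_def t'_def by (simp del: diff_diff_eq2)
  also have "weighted i' t' = zh_letters"
  proof -
    have "i' x = zh_before x \<and> t' x = zh_after x" for x
    proof (cases "arrow_of x \<in> {a, b, c}")
      case False
      then have "x \<notin> {x1, x2, x3, y1, y2, y3}"
        by (auto simp: ends)
      with False show ?thesis
        by (simp add: i'_def t'_def i2_def t2_def bump_def r3_swap_simps[OF dist] i_def t_def i1_def t1_def)
    next
      case True
      note simps = i2_def t2_def bump_def r3_swap_simps[OF dist] zh_before_def zh_after_def
        A_def[symmetric] B_def[symmetric] C_def[symmetric]
      have "(i' (Foot a) = - A \<and> t' (Foot a) = 0) \<and> (i' (Head a) = 0 \<and> t' (Head a) = A) \<and>
         (i' (Foot b) = - B \<and> t' (Foot b) = 0) \<and> (i' (Head b) = 0 \<and> t' (Head b) = B) \<and>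
         (i' (Foot c) = - C \<and> t' (Foot c) = 0) \<and> (i' (Head c) = 0 \<and> t' (Head c) = C)"
        \<comment> \<open>For each of the eight choices of orders the claim is linear in
          \<open>C\<close> alone.\<close>
        using neq BC AC
        by (cases p; cases q; cases r)
          (simp_all add: i'_def t'_def simps i_def t_def ends vals1 gb_def gc_def ha_def hb_def hc_def)
      with True show ?thesis
        by (cases rule: arrow_of_cases) (simp_all add: zh_before_def zh_after_def A_def B_def C_def)
    qed
    then show ?thesis
      by (simp add: fun_eq_iff weighted_def)
  qed
  finally have lead': "leads_to ?D' (weighted (i \<circ> ?\<tau>) (t \<circ> ?\<tau>)) zh_letters" .
  show ?thesis
    by (rule zh_via[OF D D' Z lead realises_map_endpoints lead']) (simp_all add: \<tau>2)
qed

theorem zh_reidemeister: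
  assumes "reidemeister D D'" and "plain_diagram D" and "zh_diagram D Z" and "zh_diagram D' Z'"
  shows "Z \<approx> Z'"
  using assms
proof (induction rule: reidemeister.induct)
  case (base_point D c u v)
  then show ?case
    using zh_base_point by blast
next
  case (rename D f)
  then show ?case
    using zh_rename by blast
next
  case (R1 D a)
  then show ?case
    using zh_R1 by blast
next
  case (R2 D a b)
  then show ?case
    using zh_R2 by blast
next
  case (R3 D a b c p q r)
  then show ?case
    unfolding r3_exchange using zh_R3[of D a b c p q r Z Z'] by blast
qed


section \<open>Lifting a cobordism\<close>

lemma zh_equivclp_reidemeister:
  assumes "equivclp reidemeister D D'" and D: "plain_diagram D"
  shows "plain_diagram D' \<and> (\<forall>Z Z'. zh_diagram D Z \<longrightarrow> zh_diagram D' Z' \<longrightarrow> Z \<approx> Z')"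
  using assms(1)
proof (induction rule: equivclp_induct)
  case base
  then show ?case
    using D zh_unique by blast
next
  case (step X Y)
  then have X: "plain_diagram X" and Y: "plain_diagram Y"
    using reidemeister_plain by blast+
  obtain W where W: "zh_diagram X W"
    using ex_zh_diagram[OF plain_wf[OF X]] ..
  have "W \<approx> Z'" if "zh_diagram Y Z'" for Z'
    using step(2) zh_reidemeister[OF _ X W that] zh_reidemeister[OF _ Y that W] equivclp_sym by metis
  then have "Z \<approx> Z'" if "zh_diagram D Z" "zh_diagram Y Z'" for Z Z'
    using that step.IH W equivclp_trans by metis
  with Y show ?case
    by blast
qed

section \<open>Births, deaths, saddles and renamings of circles\<close>

lemma plain_Omega_circle: "plain_diagram D \<Longrightarrow> D c = Some w \<Longrightarrow> c \<noteq> (Omega, 0)"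
  using plain_Omega by fastforce

text \<open>Events other than moves only regroup words, so no endpoint appears or vanishes. For
  merging, splitting and renaming, the fact \<open>old\<close> traces a new word back to the circles
  it came from, and disjointness is inherited from there.\<close>

lemma cobordism_step_wf:
  assumes "cobordism_step reidemeister D e D'" and wf: "wf_diagram D"
  shows "wf_diagram D' \<and> (e \<noteq> Move \<longrightarrow> endpoints D' = endpoints D)"
  using assms(1)
proof cases
  case 1
  then show ?thesis
    using reidemeister_wf by (auto simp: symclp_def)
next
  case (2 c)
  have E: "endpoints D' = endpoints D"
    using 2 unfolding set_eq_iff endpoints_iff by (metis fun_upd_apply list.set(1) empty_iff option.inject option.distinct(1))
  have "wf_diagram D'"
    by (rule wf_diagramI)
      (use 2 wf_finite_dom[OF wf] wf_distinct[OF wf] wf_same_circle[OF wf] wf_balanced[OF wf] E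
        in \<open>auto split: if_splits\<close>)
  with E show ?thesis by blast
next
  case (3 c)
  have E: "endpoints D' = endpoints D"
    using 3 unfolding set_eq_iff endpoints_iff by (metis fun_upd_apply list.set(1) empty_iff option.inject option.distinct(1))
  have "wf_diagram D'"
    by (rule wf_diagramI)
      (use 3 wf_finite_dom[OF wf] wf_distinct[OF wf] wf_same_circle[OF wf] wf_balanced[OF wf] E
        in \<open>auto split: if_splits\<close>)
  with E show ?thesis by blast
next
  case (4 c c' u v)
  have old: "\<exists>d w'. D d = Some w' \<and> x \<in> set w' \<and> (if b = c then d \<in> {c, c'} else d = b \<and> b \<noteq> c')"
    if "D' b = Some w" "x \<in> set w" for b w x
  proof (cases "b = c")
    case True
    with that 4 have "x \<in> set u \<or> x \<in> set v"
      by auto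
    with True 4 show ?thesis
      by (metis insertI1 insertI2)
  next
    case False
    with that 4 have "D b = Some w" "b \<noteq> c'"
      by (auto split: if_splits)
    with that(2) False show ?thesis
      by auto
  qed
  have new: "\<exists>d w'. D' d = Some w' \<and> x \<in> set w'" if "D b = Some w" "x \<in> set w" for b w x
  proof (cases "b = c \<or> b = c'")
    case True
    with that 4 have "D' c = Some (u @ v)" "x \<in> set (u @ v)"
      by auto
    then show ?thesis by blast
  next
    case False
    with that 4 show ?thesis by auto
  qed
  have E: "endpoints D' = endpoints D"
    unfolding set_eq_iff endpoints_iff using old new by metis
  have "wf_diagram D'"
  proof (rule wf_diagramI)
    show "finite (dom D')"
      using 4 wf_finite_dom[OF wf] by simp
    show "distinct w" if "D' b = Some w" for b w
    proof (cases "b = c")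
      case True
      have "set u \<inter> set v = {}"
        using wf_same_circle[OF wf, of c u c' v] 4 by blast
      then show ?thesis
        using True that 4 wf_distinct[OF wf, of c u] wf_distinct[OF wf, of c' v] by auto
    next
      case False
      then show ?thesis
        using that 4 wf_distinct[OF wf, of b w] by (auto split: if_splits)
    qed
    show "b = b'" if *: "D' b = Some w" "D' b' = Some w'" "x \<in> set w" "x \<in> set w'" for b b' w w' x
    proof -
      obtain d y d' y' where d: "D d = Some y" "x \<in> set y" "if b = c then d \<in> {c, c'} else d = b \<and> b \<noteq> c'"
        and d': "D d' = Some y'" "x \<in> set y'" "if b' = c then d' \<in> {c, c'} else d' = b' \<and> b' \<noteq> c'"
        using old[OF *(1,3)] old[OF *(2,4)] by blast
      have "d = d'"
        using wf_same_circle[OF wf] d(1,2) d'(1,2) by blast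
      then show ?thesis
        using d(3) d'(3) by (auto split: if_splits)
    qed
  qed (simp add: E wf_balanced[OF wf])
  with E show ?thesis by blast
next
  case (5 c c' u v)
  have old: "\<exists>w'. D (if b = c' then c else b) = Some w' \<and> set w \<subseteq> set w'"
    if "D' b = Some w" for b w
    using that 5 by (auto split: if_splits)
  have new: "\<exists>d w'. D' d = Some w' \<and> x \<in> set w'" if "D b = Some w" "x \<in> set w" for b w x
  proof (cases "b = c")
    case True
    with that 5 have "D' c = Some u" "D' c' = Some v" "x \<in> set u \<or> x \<in> set v"
      by auto
    then show ?thesis by blast
  next
    case False
    with that 5 have "D' b = Some w"
      by auto
    with that show ?thesis by blast
  qed
  have E: "endpoints D' = endpoints D"
    unfolding set_eq_iff endpoints_iff using old new by (metis subsetD)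
  have uv: "distinct (u @ v)"
    using wf_distinct[OF wf, of c] 5 by blast
  have "wf_diagram D'"
  proof (rule wf_diagramI)
    show "finite (dom D')"
      using 5 wf_finite_dom[OF wf] by simp
    show "distinct w" if "D' b = Some w" for b w
      using that 5 uv wf_distinct[OF wf, of b w] by (auto split: if_splits)
    show "b = b'" if *: "D' b = Some w" "D' b' = Some w'" "x \<in> set w" "x \<in> set w'" for b b' w w' x
    proof -
      have "(if b = c' then c else b) = (if b' = c' then c else b')"
        using old[OF *(1)] old[OF *(2)] *(3,4) wf_same_circle[OF wf] by blast
      then consider "b = b'" | "b = c" "b' = c'" | "b = c'" "b' = c"
        by (metis)
      then show ?thesis
        by cases (use * 5 uv in \<open>auto split: if_splits\<close>)
    qed
  qed (simp add: E wf_balanced[OF wf])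
  with E show ?thesis by blast
next
  case (6 c c' u)
  have old: "D (if b = c' then c else b) = Some w \<and> b \<noteq> c" if "D' b = Some w" for b w
    using that 6 by (auto split: if_splits)
  have new: "\<exists>d. D' d = Some w" if "D b = Some w" for b w
  proof (cases "b = c")
    case True
    with that 6 have "D' c' = Some w"
      by auto
    then show ?thesis by blast
  next
    case False
    with that 6 have "D' b = Some w"
      by auto
    then show ?thesis by blast
  qed
  have E: "endpoints D' = endpoints D"
    unfolding set_eq_iff endpoints_iff using old new by metis
  have "wf_diagram D'"
  proof (rule wf_diagramI)
    show "finite (dom D')"
      using 6 wf_finite_dom[OF wf] by simp
    show "distinct w" if "D' b = Some w" for b w
      using old[OF that] wf_distinct[OF wf] by blast
    show "b = b'" if *: "D' b = Some w" "D' b' = Some w'" "x \<in> set w" "x \<in> set w'" for b b' w w' x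
    proof -
      have "(if b = c' then c else b) = (if b' = c' then c else b')"
        using old[OF *(1)] old[OF *(2)] *(3,4) wf_same_circle[OF wf] by blast
      then show ?thesis
        using old[OF *(1)] old[OF *(2)] by metis
    qed
  qed (simp add: E wf_balanced[OF wf])
  with E show ?thesis by blast
qed

lemma inflate_upd:
  assumes "c \<noteq> (Omega, 0)"
  shows "inflate g ws (D(c := v)) = (inflate g ws D)(c := map_option (\<lambda>w. concat (map g w)) v)"
  using assms by (auto simp: inflate_def fun_eq_iff)

text \<open>The arrows do not change, so the same list on omega serves before and after the event.
  Inflation respects concatenation and the empty word, hence the event lifts verbatim.\<close>

lemma cobordism_step_lift:
  assumes step: "cobordism_step reidemeister D e D'" and e: "e \<noteq> Move"
    and D: "plain_diagram D" and D': "plain_diagram D'" and Z: "zh_diagram D Z"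
  shows "\<exists>Z'. zh_diagram D' Z' \<and> cobordism_step semi_welded_move Z e Z'"
proof -
  obtain ws where ws: "distinct ws" "set ws = omega_feet D" and Z_eq: "Z = inflate zh_endpoint ws D"
    using Z unfolding zh_diagram_iff by blast
  have "omega_feet D' = omega_feet D"
    using cobordism_step_wf[OF step plain_wf[OF D]] e by (intro omega_feet_cong) (simp add: arrows_def)
  then have "zh_diagram D' (inflate zh_endpoint ws D')"
    unfolding zh_diagram_iff using ws by blast
  moreover have "cobordism_step semi_welded_move Z e (inflate zh_endpoint ws D')"
    using step
  proof cases
    case 1
    with e show ?thesis by blast
  next
    case (2 c)
    then have c: "c \<noteq> (Omega, 0)"
      using plain_Omega_circle[OF D', of c] by auto
    have "Z c = None"
      using 2 c by (simp add: Z_eq inflate_def)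
    from cobordism_step.intros(2)[of Z c, OF this] show ?thesis
      unfolding 2 Z_eq inflate_upd[OF c] by simp
  next
    case (3 c)
    then have c: "c \<noteq> (Omega, 0)"
      using plain_Omega_circle[OF D, of c] by auto
    have "Z c = Some []"
      using 3 c by (simp add: Z_eq inflate_def)
    from cobordism_step.intros(3)[of Z c, OF this] show ?thesis
      unfolding 3 Z_eq inflate_upd[OF c] by simp
  next
    case (4 c c' u v)
    then have c: "c \<noteq> (Omega, 0)" "c' \<noteq> (Omega, 0)"
      using plain_Omega_circle[OF D, of c] plain_Omega_circle[OF D, of c'] by auto
    have "Z c = Some (concat (map zh_endpoint u))" "Z c' = Some (concat (map zh_endpoint v))"
      using 4 c by (simp_all add: Z_eq inflate_def)
    from cobordism_step.intros(4)[of c c' Z, OF 4(3,4) this] show ?thesis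
      unfolding 4(1,2) Z_eq inflate_upd[OF c(1)] inflate_upd[OF c(2)] by simp
  next
    case (5 c c' u v)
    then have c: "c \<noteq> (Omega, 0)" "c' \<noteq> (Omega, 0)"
      using plain_Omega_circle[OF D, of c] plain_Omega_circle[OF D', of c'] by auto
    have "Z c = Some (concat (map zh_endpoint u) @ concat (map zh_endpoint v))" "Z c' = None"
      using 5 c by (simp_all add: Z_eq inflate_def)
    from cobordism_step.intros(5)[of c c' Z, OF 5(3) this] show ?thesis
      unfolding 5(1,2) Z_eq inflate_upd[OF c(1)] inflate_upd[OF c(2)] by simp
  next
    case (6 c c' u)
    then have c: "c \<noteq> (Omega, 0)" "c' \<noteq> (Omega, 0)"
      using plain_Omega_circle[OF D, of c] plain_Omega_circle[OF D', of c'] by auto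
    have "Z c = Some (concat (map zh_endpoint u))" "Z c' = None"
      using 6 c by (simp_all add: Z_eq inflate_def)
    from cobordism_step.intros(6)[of c c' Z, OF 6(3) this] show ?thesis
      unfolding 6(1,2) Z_eq inflate_upd[OF c(1)] inflate_upd[OF c(2)] by simp
  qed
  ultimately show ?thesis
    by blast
qed

section \<open>The lifted sequence and its time map\<close>

lemma flow_refl: "(c, c) \<in> flow e"
  by (cases e) auto

text \<open>
  Each step of \<open>Es\<close> either follows a step of \<open>Ds\<close> or is an additional move; \<open>\<phi>\<close> records how far
  \<open>Ds\<close> has been followed.
\<close>

definition lifts :: "(nat \<Rightarrow> diagram) \<Rightarrow> (nat \<Rightarrow> event) \<Rightarrow> nat \<Rightarrow> (nat \<Rightarrow> diagram) \<Rightarrow> (nat \<Rightarrow> event) \<Rightarrow>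
    (nat \<Rightarrow> nat) \<Rightarrow> bool" where
  "lifts Ds ev m Es ev' \<phi> \<longleftrightarrow> \<phi> 0 = 0 \<and>
     (\<forall>j<m. cobordism_step semi_welded_move (Es j) (ev' j) (Es (Suc j)) \<and>
        (\<phi> (Suc j) = \<phi> j \<and> ev' j = Move \<or> \<phi> (Suc j) = Suc (\<phi> j) \<and> ev' j = ev (\<phi> j))) \<and>
     (\<forall>j\<le>m. dom (Es j) = insert (Omega, 0) (dom (Ds (\<phi> j))))"

lemma liftsD:
  assumes "lifts Ds ev m Es ev' \<phi>"
  shows "\<phi> 0 = 0"
    and "j < m \<Longrightarrow> cobordism_step semi_welded_move (Es j) (ev' j) (Es (Suc j))"
    and "j < m \<Longrightarrow> \<phi> (Suc j) = \<phi> j \<and> ev' j = Move \<or> \<phi> (Suc j) = Suc (\<phi> j) \<and> ev' j = ev (\<phi> j)"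
    and "j \<le> m \<Longrightarrow> dom (Es j) = insert (Omega, 0) (dom (Ds (\<phi> j)))"
  using assms unfolding lifts_def by blast+

text \<open>Remembers of a lifted sequence only its last diagram and the time reached, which is all
  that appending a further step requires.\<close>

definition reaches :: "(nat \<Rightarrow> diagram) \<Rightarrow> (nat \<Rightarrow> event) \<Rightarrow> diagram \<Rightarrow> nat \<Rightarrow> diagram \<Rightarrow> bool" where
  "reaches Ds ev Z k E \<longleftrightarrow> (\<exists>m Es ev' \<phi>. lifts Ds ev m Es ev' \<phi> \<and> Es 0 = Z \<and> Es m = E \<and> \<phi> m = k)"

lemma reaches_step:
  assumes "reaches Ds ev Z k E" and "cobordism_step semi_welded_move E e E'"
    and "k' = k \<and> e = Move \<or> k' = Suc k \<and> e = ev k"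
    and "dom E' = insert (Omega, 0) (dom (Ds k'))"
  shows "reaches Ds ev Z k' E'"
proof -
  obtain m Es ev' \<phi> where l: "lifts Ds ev m Es ev' \<phi>" "Es 0 = Z" "Es m = E" "\<phi> m = k"
    using assms(1) unfolding reaches_def by blast
  have "lifts Ds ev (Suc m) (Es(Suc m := E')) (ev'(m := e)) (\<phi>(Suc m := k'))"
    unfolding lifts_def
  proof (intro conjI allI impI)
    fix j assume j: "j < Suc m"
    show "cobordism_step semi_welded_move ((Es(Suc m := E')) j) ((ev'(m := e)) j) ((Es(Suc m := E')) (Suc j))"
      "(\<phi>(Suc m := k')) (Suc j) = (\<phi>(Suc m := k')) j \<and> (ev'(m := e)) j = Move \<or>
       (\<phi>(Suc m := k')) (Suc j) = Suc ((\<phi>(Suc m := k')) j) \<and> (ev'(m := e)) j = ev ((\<phi>(Suc m := k')) j)"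
      using liftsD(2,3)[OF l(1), of j] l assms j by (cases "j = m"; auto)+
  next
    fix j assume "j \<le> Suc m"
    then show "dom ((Es(Suc m := E')) j) = insert (Omega, 0) (dom (Ds ((\<phi>(Suc m := k')) j)))"
      using liftsD(4)[OF l(1), of j] assms(4) by (cases "j = Suc m") auto
  qed (use liftsD(1)[OF l(1)] in simp)
  with l show ?thesis
    unfolding reaches_def by (intro exI[of _ "Suc m"] exI) (auto intro: exI)
qed

lemma reaches_0:
  assumes "dom Z = insert (Omega, 0) (dom (Ds 0))"
  shows "reaches Ds ev Z 0 Z"
  unfolding reaches_def lifts_def using assms
  by (intro exI[of _ 0] exI[of _ "\<lambda>_. Z"] exI[of _ ev] exI[of _ "\<lambda>_. 0"]) simp

lemma reaches_dom:
  assumes "reaches Ds ev Z k E"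
  shows "dom E = insert (Omega, 0) (dom (Ds k))"
  using assms liftsD(4) unfolding reaches_def by blast

lemma reaches_sw_equiv:
  assumes "E \<approx> E'" and "reaches Ds ev Z k E"
  shows "reaches Ds ev Z k E'"
  using assms(1)
proof (induction rule: equivclp_induct)
  case (step X Y)
  have "dom Y = dom X"
    using step(2) semi_welded_move_dom by metis
  then have "dom Y = insert (Omega, 0) (dom (Ds k))"
    using reaches_dom[OF step.IH] by simp
  moreover have "cobordism_step semi_welded_move X Move Y"
    using step(2) by (auto simp: symclp_def intro: cobordism_step.intros(1))
  ultimately show ?case
    using reaches_step[OF step.IH] by blast
qed (rule assms(2))

text \<open>Renaming by the identity is an idle move. It lets the clock advance by one exactly when
  the given cobordism makes a move.\<close>

lemma semi_welded_move_refl: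
  assumes "wf_diagram Z"
  shows "semi_welded_move Z Z"
proof -
  have "rename_arrow id x = x" for x
    by (cases x) auto
  then have "map (rename_arrow id) = id"
    by (simp add: fun_eq_iff map_idI)
  then have "map_endpoints (rename_arrow id) Z = Z"
    by (simp add: map_endpoints_def option.map_id)
  moreover have "semi_welded_move Z (map_endpoints (rename_arrow id) Z)"
    by (rule semi_welded_move.reidemeister, rule rename[OF assms]) simp_all
  ultimately show ?thesis
    by simp
qed

text \<open>Induction over the stages for every choice of the Zh diagram \<open>E\<close>: different
  choices are equivalent, and the chain joining them is inserted as additional moves during which
  the time map rests. In the same way \<open>Z\<close> need only be equivalent to a Zh diagram of
  the first stage.\<close>

lemma reaches_zh:
  assumes steps: "\<forall>k<n. cobordism_step reidemeister (Ds k) (ev k) (Ds (Suc k))"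
    and plain: "\<And>k. k \<le> n \<Longrightarrow> plain_diagram (Ds k)"
    and start: "zh_diagram (Ds 0) Z0" "Z \<approx> Z0" "dom Z = dom Z0"
    and k: "k \<le> n" and E: "zh_diagram (Ds k) E"
  shows "reaches Ds ev Z k E"
  using k E
proof (induction k arbitrary: E)
  case 0
  have "dom Z = insert (Omega, 0) (dom (Ds 0))"
    using start(3) zh_diagram_wf_dom(2)[OF plain start(1)] by simp
  then have "reaches Ds ev Z 0 Z"
    by (rule reaches_0)
  then show ?case
    using reaches_sw_equiv start(2) zh_unique[OF plain start(1) 0(2)] by blast
next
  case (Suc k)
  have k: "k < n" "k \<le> n" and step: "cobordism_step reidemeister (Ds k) (ev k) (Ds (Suc k))"
    using Suc.prems(1) steps by auto
  note D = plain[OF k(2)] and D' = plain[OF Suc.prems(1)]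
  obtain W where W: "zh_diagram (Ds k) W"
    using ex_zh_diagram[OF plain_wf[OF D]] ..
  have r: "reaches Ds ev Z k W"
    using Suc.IH[OF k(2) W] .
  show ?case
  proof (cases "ev k = Move")
    case True
    from step have "symclp reidemeister (Ds k) (Ds (Suc k))"
      unfolding True by cases
    then have R: "reidemeister (Ds k) (Ds (Suc k)) \<or> reidemeister (Ds (Suc k)) (Ds k)"
      by (simp add: symclp_def)
    then have "dom (Ds (Suc k)) = dom (Ds k)"
      using reidemeister_dom by blast
    then have "dom W = insert (Omega, 0) (dom (Ds (Suc k)))"
      using zh_diagram_wf_dom(2)[OF D W] by simp
    \<comment> \<open>The idle move accounts for the passage from time \<open>k\<close> to
      \<open>Suc k\<close>; the true moves from \<open>W\<close> to \<open>E\<close> are made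
      afterwards, with the clock at rest.\<close>
    moreover have "cobordism_step semi_welded_move W Move W"
      using semi_welded_move_refl[OF zh_diagram_wf_dom(1)[OF D W]]
      by (auto simp: symclp_def intro: cobordism_step.intros(1))
    ultimately have "reaches Ds ev Z (Suc k) W"
      using reaches_step[OF r] True by simp
    moreover have "W \<approx> E"
      using R zh_reidemeister[OF _ D W Suc.prems(2)] zh_reidemeister[OF _ D' Suc.prems(2) W]
        equivclp_sym by metis
    ultimately show ?thesis
      using reaches_sw_equiv by blast
  next
    case False
    obtain E1 where E1: "zh_diagram (Ds (Suc k)) E1" "cobordism_step semi_welded_move W (ev k) E1"
      using cobordism_step_lift[OF step False D D' W] by blast
    then have "reaches Ds ev Z (Suc k) E1"
      using reaches_step[OF r E1(2)] zh_diagram_wf_dom(2)[OF D' E1(1)] by simp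
    then show ?thesis
      using reaches_sw_equiv zh_unique[OF D' E1(1) Suc.prems(2)] by blast
  qed
qed

section \<open>Transfer of event counts and connectedness along the time map\<close>

lemma lifts_mono:
  assumes l: "lifts Ds ev m Es ev' \<phi>" and "j \<le> j'" "j' \<le> m"
  shows "\<phi> j \<le> \<phi> j'"
  using assms(2,3)
proof (induction j' rule: dec_induct)
  case (step i)
  then show ?case
    using liftsD(3)[OF l, of i] by auto
qed simp

text \<open>A discrete intermediate value argument: \<open>\<phi>\<close> starts at 0 and grows by
  at most 1 per step, so it cannot skip the passage from \<open>k\<close> to
  \<open>Suc k\<close>.\<close>

lemma lifts_crossing:
  assumes l: "lifts Ds ev m Es ev' \<phi>" and "k < \<phi> j" "j \<le> m"
  shows "\<exists>i<m. \<phi> i = k \<and> \<phi> (Suc i) = Suc k \<and> ev' i = ev k"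
  using assms(2,3)
proof (induction j)
  case 0
  then show ?case
    using liftsD(1)[OF l] by simp
next
  case (Suc j)
  show ?case
  proof (cases "k < \<phi> j")
    case True
    then show ?thesis
      using Suc by simp
  next
    case False
    then have "\<phi> j = k"
      using Suc.prems liftsD(3)[OF l, of j] by auto
    then have "\<phi> j = k \<and> \<phi> (Suc j) = Suc k \<and> ev' j = ev k"
      using Suc.prems liftsD(3)[OF l, of j] by auto
    then show ?thesis
      using Suc.prems(2) by (intro exI[of _ j]) simp
  qed
qed

text \<open>Steps with the clock at rest are moves, which \<open>P\<close> does not count; every
  other step repeats the event of one step of the given sequence.\<close>

lemma lifts_count:
  assumes l: "lifts Ds ev m Es ev' \<phi>" and "\<not> P Move" "j \<le> m"
  shows "card {i. i < j \<and> P (ev' i)} = card {k. k < \<phi> j \<and> P (ev k)}"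
  using assms(3)
proof (induction j)
  case 0
  then show ?case
    using liftsD(1)[OF l] by simp
next
  case (Suc j)
  have split: "card {i. i < Suc x \<and> Q i} = card {i. i < x \<and> Q i} + (if Q x then 1 else 0)" for x and Q :: "nat \<Rightarrow> bool"
  proof -
    have "{i. i < Suc x \<and> Q i} = {i. i < x \<and> Q i} \<union> (if Q x then {x} else {})"
      by (auto simp: less_Suc_eq)
    then show ?thesis
      by simp
  qed
  show ?case
    using Suc liftsD(3)[OF l, of j] assms(2)
    by (auto simp: split[of j "\<lambda>i. P (ev' i)"] split[of "\<phi> j" "\<lambda>i. P (ev i)"])
qed

text \<open>Path lifting. An edge of the given trace is lifted to the step at which
  \<open>\<phi>\<close> crosses it, and stages with equal value of \<open>\<phi>\<close> are joined
  by constant paths (\<open>wait\<close>). Apart from omega both sequences have the same circles at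
  corresponding times, so this reaches all vertices.\<close>

lemma lifts_connected:
  assumes l: "lifts Ds ev m Es ev' \<phi>" and i: "i \<noteq> Omega"
    and conn: "connected_trace (\<phi> m) Ds ev i"
  shows "connected_trace m Es ev' i"
proof -
  let ?S = "trace_edges m Es ev'" and ?T = "trace_edges (\<phi> m) Ds ev"
  let ?C = "(?S \<union> ?S\<inverse>)\<^sup>*"
  have sym: "(y, x) \<in> ?C" if "(x, y) \<in> ?C" for x y
    using that by (metis converse_Un converse_converse rtrancl_converseD sup_commute)
  have wait1: "((j, c), (j', c)) \<in> ?C"
    if "j \<le> j'" "j' \<le> m" "\<phi> j = \<phi> j'" "c \<in> dom (Ds (\<phi> j))" for j j' c
    using that
  proof (induction j' rule: dec_induct)
    case (step k)
    have "\<phi> j \<le> \<phi> k" "\<phi> k \<le> \<phi> (Suc k)"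
      using step lifts_mono[OF l, of j k] lifts_mono[OF l, of k "Suc k"] by simp_all
    then have eq: "\<phi> k = \<phi> j"
      using step by simp
    then have "c \<in> dom (Es k)" "c \<in> dom (Es (Suc k))"
      using step liftsD(4)[OF l, of k] liftsD(4)[OF l, of "Suc k"] by auto
    then have "((k, c), (Suc k, c)) \<in> ?S"
      using step flow_refl unfolding trace_edges_def by auto
    moreover have "((j, c), (k, c)) \<in> ?C"
      using step eq by simp
    ultimately show ?case
      by (meson UnI1 rtrancl.rtrancl_into_rtrancl)
  qed simp
  have wait: "((j, c), (j', c)) \<in> ?C"
    if "j \<le> m" "j' \<le> m" "\<phi> j = \<phi> j'" "c \<in> dom (Ds (\<phi> j))" for j j' c
    using that wait1[of j j' c] wait1[of j' j c] sym by (metis nle_le)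
  have edge: "\<exists>j<m. \<phi> j = k \<and> \<phi> (Suc j) = Suc k \<and> ((j, c), (Suc j, c')) \<in> ?S \<and>
      c \<in> dom (Ds k) \<and> c' \<in> dom (Ds (Suc k))"
    if "((k, c), (k', c')) \<in> ?T" and "k' = Suc k" for k c k' c'
  proof -
    have *: "k < \<phi> m" "c \<in> dom (Ds k)" "c' \<in> dom (Ds (Suc k))" "(c, c') \<in> flow (ev k)"
      using that unfolding trace_edges_def by auto
    obtain j where j: "j < m" "\<phi> j = k" "\<phi> (Suc j) = Suc k" "ev' j = ev k"
      using lifts_crossing[OF l *(1)] by blast
    then have "c \<in> dom (Es j)" "c' \<in> dom (Es (Suc j))"
      using * liftsD(4)[OF l, of j] liftsD(4)[OF l, of "Suc j"] by auto
    then have "((j, c), (Suc j, c')) \<in> ?S"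
      using j * unfolding trace_edges_def by auto
    with j * show ?thesis by blast
  qed
  have T_Suc: "k' = Suc k" if "((k, c), (k', c')) \<in> ?T" for k c k' c'
    using that unfolding trace_edges_def by auto
  have path: "((j, c), (j', c')) \<in> ?C"
    if "((k, c), (k', c')) \<in> (?T \<union> ?T\<inverse>)\<^sup>*" "j \<le> m" "\<phi> j = k" "c \<in> dom (Ds k)"
      "j' \<le> m" "\<phi> j' = k'" for j c j' c' k k'
    using that
  proof (induction "(k', c')" arbitrary: k' c' j' rule: rtrancl_induct)
    case base
    then show ?case
      using wait by simp
  next
    case (step y)
    obtain k1 c1 where y: "y = (k1, c1)"
      by (cases y)
    from step(2) consider "((k1, c1), (k', c')) \<in> ?T" | "((k', c'), (k1, c1)) \<in> ?T"
      unfolding y by blast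
    then show ?case
    proof cases
      case 1
      obtain i where i: "i < m" "\<phi> i = k1" "\<phi> (Suc i) = k'" "((i, c1), (Suc i, c')) \<in> ?S"
        "c' \<in> dom (Ds k')"
        using edge[OF 1 T_Suc[OF 1]] T_Suc[OF 1] by blast
      have "((j, c), (i, c1)) \<in> ?C"
        using step(3)[OF y, of i] step.prems i by simp
      moreover have "((i, c1), (Suc i, c')) \<in> ?C"
        using i by blast
      moreover have "((Suc i, c'), (j', c')) \<in> ?C"
        using wait[of "Suc i" j' c'] i step.prems by simp
      ultimately show ?thesis
        by (meson rtrancl_trans)
    next
      case 2
      obtain i where i: "i < m" "\<phi> i = k'" "\<phi> (Suc i) = k1" "((i, c'), (Suc i, c1)) \<in> ?S"
        "c' \<in> dom (Ds k')"
        using edge[OF 2 T_Suc[OF 2]] T_Suc[OF 2] by blast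
      have "((j, c), (Suc i, c1)) \<in> ?C"
        using step(3)[OF y, of "Suc i"] step.prems i by simp
      moreover have "((Suc i, c1), (i, c')) \<in> ?C"
        using i by blast
      moreover have "((i, c'), (j', c')) \<in> ?C"
        using wait[of i j' c'] i step.prems by simp
      ultimately show ?thesis
        by (meson rtrancl_trans)
    qed
  qed
  show ?thesis
    unfolding connected_trace_def
  proof (intro ballI)
    fix x y assume vert: "x \<in> trace_vertices m Es i" "y \<in> trace_vertices m Es i"
    obtain j c j' c' where eq: "x = (j, c)" "y = (j', c')"
      by (cases x; cases y)
    with vert have xy: "x = (j, c)" "y = (j', c')" "j \<le> m" "j' \<le> m"
      "c \<in> dom (Es j)" "c' \<in> dom (Es j')" "fst c = i" "fst c' = i"
      by (simp_all add: trace_vertices_def)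
    then have "c \<in> dom (Ds (\<phi> j))" "c' \<in> dom (Ds (\<phi> j'))"
      using liftsD(4)[OF l, of j] liftsD(4)[OF l, of j'] i by auto
    moreover from this have "(\<phi> j, c) \<in> trace_vertices (\<phi> m) Ds i" "(\<phi> j', c') \<in> trace_vertices (\<phi> m) Ds i"
      using xy lifts_mono[OF l] unfolding trace_vertices_def by auto
    ultimately show "(x, y) \<in> ?C"
      using conn path xy unfolding connected_trace_def by blast
  qed
qed

lemma lifts_connected_Omega:
  assumes l: "lifts Ds ev m Es ev' \<phi>" and no: "\<And>k. k \<le> \<phi> m \<Longrightarrow> Omega \<notin> fst ` dom (Ds k)"
  shows "connected_trace m Es ev' Omega"
proof -
  let ?S = "trace_edges m Es ev'"
  let ?C = "(?S \<union> ?S\<inverse>)\<^sup>*"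
  have dom: "(Omega, 0) \<in> dom (Es j)" if "j \<le> m" for j
    using liftsD(4)[OF l that] by simp
  have to0: "((0, (Omega, 0)), (j, (Omega, 0))) \<in> ?C" if "j \<le> m" for j
    using that
  proof (induction j)
    case (Suc j)
    then have "((j, (Omega, 0)), (Suc j, (Omega, 0))) \<in> ?S"
      using dom flow_refl unfolding trace_edges_def by auto
    then show ?case
      using Suc by (meson UnI1 Suc_leD rtrancl.rtrancl_into_rtrancl)
  qed simp
  have sym: "(y, x) \<in> ?C" if "(x, y) \<in> ?C" for x y
    using that by (metis converse_Un converse_converse rtrancl_converseD sup_commute)
  have only: "\<exists>j\<le>m. x = (j, (Omega, 0))" if x: "x \<in> trace_vertices m Es Omega" for x
  proof -
    obtain j c where x: "x = (j, c)" "j \<le> m" "c \<in> dom (Es j)" "fst c = Omega"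
      using x unfolding trace_vertices_def by auto
    then show ?thesis
      using liftsD(4)[OF l x(2)] no[OF lifts_mono[OF l x(2) order_refl]] by (force simp: image_iff)
  qed
  show ?thesis
    unfolding connected_trace_def
  proof (intro ballI)
    fix x y assume "x \<in> trace_vertices m Es Omega" "y \<in> trace_vertices m Es Omega"
    then obtain j j' where "x = (j, (Omega, 0))" "j \<le> m" "y = (j', (Omega, 0))" "j' \<le> m"
      using only by blast
    then show "(x, y) \<in> ?C"
      using sym[OF to0[of j]] to0[of j'] by (simp add: rtrancl_trans)
  qed
qed

text \<open>The first circle named in such an event exists just before or just after it. Hence omega
  contributes 0 to both sides of the Euler count.\<close>

lemma cobordism_step_Omega_free:
  assumes "cobordism_step R D e D'" "Omega \<notin> fst ` dom D" "Omega \<notin> fst ` dom D'"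
  shows "e \<noteq> Birth (Omega, k)" "e \<noteq> Death (Omega, k)" "e \<noteq> Merge (Omega, k) (Omega, k')"
    "e \<noteq> Split (Omega, k) (Omega, k')"
proof -
  have *: "d \<in> dom D \<union> dom D'" if "e = Birth d \<or> e = Death d \<or> e = Merge d d' \<or> e = Split d d'" for d d'
    using assms(1) that by cases auto
  have "(Omega, k) \<notin> dom D \<union> dom D'"
    using assms(2,3) by (force simp: image_iff)
  with * show "e \<noteq> Birth (Omega, k)" "e \<noteq> Death (Omega, k)" "e \<noteq> Merge (Omega, k) (Omega, k')"
    "e \<noteq> Split (Omega, k) (Omega, k')"
    by blast+
qed

lemma lifts_concordant:
  assumes l: "lifts Ds ev m Es ev' \<phi>"
    and steps: "\<forall>k<\<phi> m. cobordism_step reidemeister (Ds k) (ev k) (Ds (Suc k))"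
    and doms: "\<forall>k\<le>\<phi> m. fst ` dom (Ds k) \<subseteq> fst ` dom (Ds 0)"
    and no: "Omega \<notin> fst ` dom (Ds 0)"
    and annuli: "\<forall>i\<in>fst ` dom (Ds 0). connected_trace (\<phi> m) Ds ev i \<and>
      births (\<phi> m) ev i + deaths (\<phi> m) ev i = saddles (\<phi> m) ev i"
  shows "semi_welded_concordant (Es 0) (Es m)"
proof -
  have no': "Omega \<notin> fst ` dom (Ds k)" if "k \<le> \<phi> m" for k
    using doms no that by blast
  have dom0: "fst ` dom (Es 0) = insert Omega (fst ` dom (Ds 0))"
    using liftsD(4)[OF l, of 0] liftsD(1)[OF l] by simp
  have counts: "births m ev' i = births (\<phi> m) ev i" "deaths m ev' i = deaths (\<phi> m) ev i"
    "saddles m ev' i = saddles (\<phi> m) ev i" for i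
    using lifts_count[OF l, of "\<lambda>e. \<exists>k. e = Birth (i, k)" m]
      lifts_count[OF l, of "\<lambda>e. \<exists>k. e = Death (i, k)" m]
      lifts_count[OF l, of "\<lambda>e. \<exists>k k'. e = Merge (i, k) (i, k') \<or> e = Split (i, k) (i, k')" m]
    unfolding births_def deaths_def saddles_def by simp_all
  have free: "ev k \<noteq> Birth (Omega, q)" "ev k \<noteq> Death (Omega, q)" "ev k \<noteq> Merge (Omega, q) (Omega, q')"
    "ev k \<noteq> Split (Omega, q) (Omega, q')" if "k < \<phi> m" for k q q'
    using cobordism_step_Omega_free[of reidemeister "Ds k" "ev k" "Ds (Suc k)"] steps that
      no'[of k] no'[of "Suc k"] by simp_all
  have "births (\<phi> m) ev Omega = 0" "deaths (\<phi> m) ev Omega = 0" "saddles (\<phi> m) ev Omega = 0"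
    by (simp_all add: births_def deaths_def saddles_def free cong: conj_cong)
  moreover have "connected_trace m Es ev' i" if "i \<in> fst ` dom (Es 0)" for i
  proof (cases "i = Omega")
    case True
    then show ?thesis
      using lifts_connected_Omega[OF l no'] by blast
  next
    case False
    then have "i \<in> fst ` dom (Ds 0)"
      using that unfolding dom0 by simp
    then show ?thesis
      using lifts_connected[OF l False] annuli by simp
  qed
  ultimately have "\<forall>i\<in>fst ` dom (Es 0). connected_trace m Es ev' i \<and>
      births m ev' i + deaths m ev' i = saddles m ev' i"
    unfolding counts using annuli dom0 by auto
  moreover have "\<forall>k\<le>m. fst ` dom (Es k) \<subseteq> fst ` dom (Es 0)"
  proof (intro allI impI)
    fix k assume k: "k \<le> m"
    have "fst ` dom (Es k) = insert Omega (fst ` dom (Ds (\<phi> k)))"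
      using liftsD(4)[OF l k] by simp
    then show "fst ` dom (Es k) \<subseteq> fst ` dom (Es 0)"
      using doms lifts_mono[OF l k] unfolding dom0 by blast
  qed
  ultimately show ?thesis
    unfolding concordant_def using liftsD(2)[OF l] by blast
qed

section \<open>From diagrams to links, and the conclusion\<close>

lemma virtual_linksD:
  assumes "L \<in> virtual_links \<mu>"
  shows "X \<in> L \<Longrightarrow> plain_diagram X"
    and "X \<in> L \<Longrightarrow> Y \<in> L \<Longrightarrow> equivclp reidemeister X Y"
proof -
  obtain D0 where D0: "virtual_diagram \<mu> D0" and L: "L = {D. equivclp reidemeister D0 D}"
    using assms unfolding virtual_links_def by (auto elim!: quotientE)
  have "plain_diagram D0"
    using D0 by (auto simp: virtual_diagram_def plain_diagram_def)
  then show "X \<in> L \<Longrightarrow> plain_diagram X"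
    unfolding L using zh_equivclp_reidemeister by blast
  show "X \<in> L \<Longrightarrow> Y \<in> L \<Longrightarrow> equivclp reidemeister X Y"
    unfolding L by (metis mem_Collect_eq equivclp_sym equivclp_trans)
qed

lemma Zh_sw_equiv:
  assumes L: "L \<in> virtual_links \<mu>" and "D \<in> L" and "Z \<in> Zh L" and Z0: "zh_diagram D Z0"
  shows "Z \<approx> Z0"
proof -
  obtain D1 Z1 where D1: "D1 \<in> L" "zh_diagram D1 Z1" "Z1 \<approx> Z"
    using assms(3) unfolding Zh_def by blast
  have "Z1 \<approx> Z0"
    using zh_equivclp_reidemeister[OF virtual_linksD(2)[OF L D1(1) \<open>D \<in> L\<close>] virtual_linksD(1)[OF L D1(1)]]
      D1(2) Z0 by blast
  then show ?thesis
    using D1(3) by (meson equivclp_sym equivclp_trans)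
qed

theorem corollary4p4:
  fixes \<mu> :: nat and L L' :: "diagram set" and D D' Z Z' :: diagram
  assumes "L \<in> virtual_links \<mu>" and "L' \<in> virtual_links \<mu>"
    and "D \<in> L" and "D' \<in> L'" and "virtual_concordant D D'"
    and "Z \<in> Zh L" and "Z' \<in> Zh L'"
  shows "semi_welded_concordant Z Z'"
proof -
  obtain n Ds ev where Ds: "Ds 0 = D" "Ds n = D'"
    and steps: "\<forall>k<n. cobordism_step reidemeister (Ds k) (ev k) (Ds (Suc k))"
    and "\<forall>k\<le>n. fst ` dom (Ds k) \<subseteq> fst ` dom D"
    and "\<forall>i\<in>fst ` dom D. connected_trace n Ds ev i \<and>
      births n ev i + deaths n ev i = saddles n ev i"
    using assms(5) unfolding concordant_def by (elim exE conjE)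
  then have doms: "\<forall>k\<le>n. fst ` dom (Ds k) \<subseteq> fst ` dom (Ds 0)"
    and annuli: "\<forall>i\<in>fst ` dom (Ds 0). connected_trace n Ds ev i \<and>
      births n ev i + deaths n ev i = saddles n ev i"
    by simp_all
  have D: "plain_diagram (Ds 0)" and D': "plain_diagram (Ds n)"
    using virtual_linksD(1) assms(1-4) unfolding Ds by blast+
  have no: "Omega \<notin> fst ` dom (Ds 0)"
    using D by (simp add: plain_diagram_def)
  have plain: "plain_diagram (Ds k)" if "k \<le> n" for k
    using that
  proof (induction k)
    case (Suc k)
    then have "wf_diagram (Ds (Suc k))"
      using cobordism_step_wf[of "Ds k" "ev k" "Ds (Suc k)"] steps by (simp add: plain_wf)
    moreover have "Omega \<notin> fst ` dom (Ds (Suc k))"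
      using doms no Suc.prems by blast
    ultimately show ?case
      by (simp add: plain_diagram_def)
  qed (rule D)
  obtain Z0 Z1 where zh: "zh_diagram (Ds 0) Z0" "zh_diagram (Ds n) Z1"
    using ex_zh_diagram plain_wf D D' by metis
  have "Z \<approx> Z0" "Z' \<approx> Z1"
    using Zh_sw_equiv assms zh unfolding Ds by blast+
  \<comment> \<open>The arbitrary representatives \<open>Z\<close> and \<open>Z'\<close> of the Zh
    classes cost nothing: the chains joining them to the chosen Zh diagrams become additional moves
    at the two ends of the lifted cobordism.\<close>
  then have "reaches Ds ev Z n Z1"
    using reaches_zh[OF steps plain zh(1) _ _ order_refl zh(2)] sw_equiv_dom by metis
  then have "reaches Ds ev Z n Z'"
    using reaches_sw_equiv \<open>Z' \<approx> Z1\<close> equivclp_sym by metis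
  then obtain m Es ev' \<phi> where l: "lifts Ds ev m Es ev' \<phi>" "Es 0 = Z" "Es m = Z'" "\<phi> m = n"
    unfolding reaches_def by blast
  show ?thesis
    using lifts_concordant[OF l(1)] steps doms no annuli unfolding l(2-4) by blast
qed

end
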